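(* Let $F$ be a number field of degree $n$ with $r_2$ complex infinite primes and discriminant $\Delta_F$, and put $\partial_F=(2/\pi)^{r_2}\sqrt{|\Delta_F|}$. (i) For every Arakelov divisor $D=(I,u)$ of degree $0$ there exist a reduced Arakelov divisor $D'$, an element $f\in F^*$ and $v=(v_\sigma)_\sigma\in\prod_\sigma\mathbb{R}_{>0}$ such that $$D-D'=(f)+(O_F,v)\quad\text{in }{\rm Div}_F,\qquad \log|v_\sigma|\le \tfrac1n\log(\partial_F)\ \text{ for every infinite prime }\sigma .$$ In particular $\|D-D'\|_{\rm Pic}\le\log(\partial_F)$. (ii) The natural map $\bigcup_{D}\Sigma_D\to{\rm Pic}^0_F$, where $D$ runs over the reduced Arakelov divisors of $F$, is surjective.
   Context: Let $F$ be a number field of degree $n$, ring of integers $O_F$, unit group $O_F^*$. An infinite prime is a field embedding $\sigma:F\to\mathbb{C}$ up to complex conjugation; $\deg(\sigma)=1$ if $\sigma(F)\subset\mathbb{R}$ (real) and $\deg(\sigma)=2$ otherwise (complex); $r_2$ is the number of complex infinite primes. An Arakelov divisor is a pair $D=(I,u)$ with $I$ a nonzero fractional ideal of $F$ and $u=(u_\sigma)_\sigma\in\prod_\sigma\mathbb{R}_{>0}$ (this corresponds to the formal sum $\sum_{\mathfrak p}n_{\mathfrak p}\mathfrak p+\sum_\sigma x_\sigma\sigma$ with $I=\prod\mathfrak p^{-n_{\mathfrak p}}$, $u_\sigma=e^{-x_\sigma}$). They form a group ${\rm Div}_F$ under $(I,u)+(J,v)=(IJ,uv)$. The principal divisor of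 $f\in F^*$ is $(f)=(f^{-1}O_F,(|\sigma(f)|)_\sigma)$. The degree is $\deg(I,u)=-\log\big(N(I)\prod_\sigma u_\sigma^{\deg\sigma}\big)$, $N(I)$ the absolute norm; ${\rm Div}^0_F$ is the degree-zero subgroup and ${\rm Pic}^0_F$ its quotient by the principal divisors. If the classes of $D,D'$ in ${\rm Pic}^0_F$ differ by the class of $(O_F,w)$ with $w\in\prod_\sigma\mathbb{R}_{>0}$, their distance is $\|D-D'\|_{\rm Pic}=\min_{\varepsilon\in O_F^*}\big(\sum_\sigma\deg(\sigma)(\log(|\sigma(\varepsilon)|w_\sigma))^2\big)^{1/2}$. For a fractional ideal $I$ put $d(I)=(I,N(I)^{-1/n})$ (with $N(I)^{-1/n}$ in every coordinate). A nonzero $f\in I$ is minimal in $I$ if the only $g\in I$ with $|\sigma(g)|<|\sigma(f)|$ for all $\sigma$ is $g=0$. An Arakelov divisor is reduced if it equals $d(I)$ for a fractional ideal $I$ with $1\in I$ and $1$ minimal in $I$. For a degree-zero divisor $D=(I,u)$, $\Sigma_D=\{(I,v)\in{\rm Div}^0_F:\ \log(v_\sigma)\le\frac1n\log(\partial_F)\text{ for all }\sigma\}$. *)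

theory Defs
  imports
    Complex_Main
    "HOL-Library.FuncSet"
    "HOL-Algebra.Coset"
    "Jordan_Normal_Form.Determinant"
begin

section \<open>Number fields\<close>

class number_field = field_char_0 +
  assumes finite_dim_over_rat:
    "\<exists>B. finite B \<and> (\<forall>x. \<exists>c :: 'a \<Rightarrow> rat. x = (\<Sum>b\<in>B. of_rat (c b) * b))"

instance rat :: number_field
proof
  show "\<exists>B::rat set. finite B \<and> (\<forall>x. \<exists>c :: rat \<Rightarrow> rat. x = (\<Sum>b\<in>B. of_rat (c b) * b))"
    by (intro exI[of _ "{1}"] conjI allI) (auto simp: of_rat_eq_id)
qed

definition field_degree :: "'a::number_field itself \<Rightarrow> nat" where
  "field_degree _ = vector_space.dim (\<lambda>(q::rat) (x::'a). of_rat q * x) UNIV"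

definition ring_of_integers :: "'a::number_field set" where
  "ring_of_integers = {x. algebraic_int x}"

definition unit_group :: "'a::number_field set" where
  "unit_group = {\<epsilon> \<in> ring_of_integers. \<exists>\<eta>\<in>ring_of_integers. \<epsilon> * \<eta> = 1}"

definition embeddings :: "('a::number_field \<Rightarrow> complex) set" where
  "embeddings = {\<sigma>. field_hom \<sigma>}"


section \<open>Infinite primes\<close>

text \<open>An infinite prime is a class of embeddings up to complex conjugation: a singleton if it is
  real, and a pair of conjugate embeddings if it is complex.\<close>

type_synonym 'a infinite_prime = "('a \<Rightarrow> complex) set"

definition infinite_primes :: "'a::number_field infinite_prime set" where
  "infinite_primes =
     embeddings // {(\<sigma>, \<tau>). \<sigma> \<in> embeddings \<and> \<tau> \<in> embeddings \<and> (\<tau> = \<sigma> \<or> \<tau> = cnj \<circ> \<sigma>)}"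

definition prime_deg :: "'a::number_field infinite_prime \<Rightarrow> nat" where
  "prime_deg P = (if \<forall>\<sigma>\<in>P. range \<sigma> \<subseteq> \<real> then 1 else 2)"

text \<open>The value does not depend on the chosen representative, as conjugation preserves the
  modulus.\<close>

definition prime_abs :: "'a::number_field infinite_prime \<Rightarrow> 'a \<Rightarrow> real" where
  "prime_abs P x = cmod ((SOME \<sigma>. \<sigma> \<in> P) x)"

definition num_complex_primes :: "'a::number_field itself \<Rightarrow> nat" where
  "num_complex_primes _ = card {P \<in> (infinite_primes :: 'a infinite_prime set). prime_deg P = 2}"

text \<open>The group \<open>\<Prod>\<^sub>\<sigma> \<real>\<^sub>>\<^sub>0\<close>; its elements are extensional functions, so that equality of Arakelov
  divisors is equality of pairs.\<close>

definition pos_vectors :: "('a::number_field infinite_prime \<Rightarrow> real) set" where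
  "pos_vectors = infinite_primes \<rightarrow>\<^sub>E {0<..}"


section \<open>Discriminant\<close>

definition integral_basis :: "(nat \<Rightarrow> 'a::number_field) \<Rightarrow> bool" where
  "integral_basis \<omega> \<longleftrightarrow>
     ring_of_integers =
       {\<Sum>i<field_degree TYPE('a). of_int (c i) * \<omega> i | c :: nat \<Rightarrow> int. True} \<and>
     (\<forall>c :: nat \<Rightarrow> int. (\<Sum>i<field_degree TYPE('a). of_int (c i) * \<omega> i) = 0 \<longrightarrow>
        (\<forall>i<field_degree TYPE('a). c i = 0))"

text \<open>The discriminant \<open>det (\<sigma>\<^sub>i (\<omega>\<^sub>j))\<^sup>2\<close> is a rational integer, here regarded as a complex number.
  It does not depend on the integral basis \<open>\<omega>\<close>, nor on the enumeration \<open>\<sigma>\<close> of the embeddings.\<close>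

definition discriminant :: "'a::number_field itself \<Rightarrow> complex" where
  "discriminant _ =
     (let n = field_degree TYPE('a);
          \<omega> = (SOME \<omega> :: nat \<Rightarrow> 'a. integral_basis \<omega>);
          \<sigma> = (SOME \<sigma> :: nat \<Rightarrow> 'a \<Rightarrow> complex. bij_betw \<sigma> {..<n} embeddings)
      in (Determinant.det (mat n n (\<lambda>(i, j). \<sigma> i (\<omega> j))))\<^sup>2)"

text \<open>The constant \<open>\<partial>\<^sub>F\<close>.\<close>

definition del_const :: "'a::number_field itself \<Rightarrow> real" where
  "del_const _ =
     (2 / pi) ^ num_complex_primes TYPE('a) * sqrt (cmod (discriminant TYPE('a)))"


section \<open>Fractional ideals\<close>

definition fractional_ideal :: "'a::number_field set \<Rightarrow> bool" where
  "fractional_ideal I \<longleftrightarrow>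
     0 \<in> I \<and> (\<forall>x\<in>I. \<forall>y\<in>I. x + y \<in> I) \<and>
     (\<forall>a\<in>ring_of_integers. \<forall>x\<in>I. a * x \<in> I) \<and>
     (\<exists>d\<in>ring_of_integers. d \<noteq> 0 \<and> (\<forall>x\<in>I. d * x \<in> ring_of_integers))"

definition ideal_mult :: "'a::number_field set \<Rightarrow> 'a set \<Rightarrow> 'a set" where
  "ideal_mult I J =
     {\<Sum>i<k. a i * b i | (k::nat) a b. (\<forall>i<k. a i \<in> I) \<and> (\<forall>i<k. b i \<in> J)}"

text \<open>The norm of a nonzero integral ideal, i.e. the number of its cosets in the ring of
  integers.\<close>

definition integral_ideal_norm :: "'a::number_field set \<Rightarrow> nat" where
  "integral_ideal_norm J =
     card (ring_of_integers //
       {(x, y). x \<in> ring_of_integers \<and> y \<in> ring_of_integers \<and> x - y \<in> J})"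

text \<open>The multiplicative extension to fractional ideals: \<open>N(I) = N(d I) / N(d O\<^sub>F)\<close> for any common
  denominator \<open>d\<close> of \<open>I\<close>.\<close>

definition ideal_norm :: "'a::number_field set \<Rightarrow> real" where
  "ideal_norm I =
     (let d = (SOME d. d \<in> ring_of_integers \<and> d \<noteq> 0 \<and> (\<lambda>x. d * x) ` I \<subseteq> ring_of_integers)
      in real (integral_ideal_norm ((\<lambda>x. d * x) ` I)) /
         real (integral_ideal_norm ((\<lambda>x. d * x) ` ring_of_integers)))"


section \<open>Arakelov divisors\<close>

text \<open>The groups of divisors are additive in the literature; as HOL-Algebra groups they are
  written multiplicatively, so that \<open>D - D'\<close> is \<open>D \<otimes> inv D'\<close>.\<close>

type_synonym 'a divisor = "'a set \<times> ('a infinite_prime \<Rightarrow> real)"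

definition Div_grp :: "'a::number_field divisor monoid" where
  "Div_grp =
     \<lparr>carrier = {I. fractional_ideal I \<and> I \<noteq> {0}} \<times> pos_vectors,
      monoid.mult = (\<lambda>(I, u) (J, v). (ideal_mult I J, restrict (\<lambda>P. u P * v P) infinite_primes)),
      monoid.one = (ring_of_integers, restrict (\<lambda>_. 1) infinite_primes)\<rparr>"

definition principal_divisor :: "'a::number_field \<Rightarrow> 'a divisor" where
  "principal_divisor f =
     ((\<lambda>x. inverse f * x) ` ring_of_integers, restrict (\<lambda>P. prime_abs P f) infinite_primes)"

definition principal_divisors :: "'a::number_field divisor set" where
  "principal_divisors = principal_divisor ` (UNIV - {0})"

definition div_degree :: "'a::number_field divisor \<Rightarrow> real" where
  "div_degree D =
     - ln (ideal_norm (fst D) * (\<Prod>P\<in>infinite_primes. snd D P ^ prime_deg P))"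

definition Div0_grp :: "'a::number_field divisor monoid" where
  "Div0_grp = Div_grp\<lparr>carrier := {D \<in> carrier Div_grp. div_degree D = 0}\<rparr>"

definition Pic0_grp :: "'a::number_field divisor set monoid" where
  "Pic0_grp = Div0_grp Mod principal_divisors"

definition div_class :: "'a::number_field divisor \<Rightarrow> 'a divisor set" where
  "div_class D = principal_divisors #>\<^bsub>Div0_grp\<^esub> D"

text \<open>The distance is only meaningful for \<open>D\<close>, \<open>D'\<close> of degree 0 whose classes differ by the class
  of some \<open>(O\<^sub>F, w)\<close>. Such \<open>w\<close> is unique up to \<open>(|\<sigma>(\<epsilon>)|)\<^sub>\<sigma>\<close> with \<open>\<epsilon>\<close> a unit, so the minimum does
  not depend on the choice of \<open>w\<close>.\<close>

definition pic_dist :: "'a::number_field divisor \<Rightarrow> 'a divisor \<Rightarrow> real" where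
  "pic_dist D D' =
     (let w = (SOME w. w \<in> pos_vectors \<and> (ring_of_integers, w) \<in> carrier Div0_grp \<and>
                 div_class D \<otimes>\<^bsub>Pic0_grp\<^esub> inv\<^bsub>Pic0_grp\<^esub> div_class D' =
                 div_class (ring_of_integers, w))
      in LEAST r. \<exists>\<epsilon>\<in>unit_group.
           r = sqrt (\<Sum>P\<in>infinite_primes. real (prime_deg P) * (ln (prime_abs P \<epsilon> * w P))\<^sup>2))"


section \<open>Reduced divisors\<close>

definition ideal_divisor :: "'a::number_field set \<Rightarrow> 'a divisor" where
  "ideal_divisor I =
     (I, restrict (\<lambda>_. ideal_norm I powr (- 1 / real (field_degree TYPE('a)))) infinite_primes)"

definition minimal_in :: "'a::number_field set \<Rightarrow> 'a \<Rightarrow> bool" where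
  "minimal_in I f \<longleftrightarrow>
     f \<in> I \<and> f \<noteq> 0 \<and>
     (\<forall>g\<in>I. (\<forall>P\<in>infinite_primes. prime_abs P g < prime_abs P f) \<longrightarrow> g = 0)"

definition reduced_divisor :: "'a::number_field divisor \<Rightarrow> bool" where
  "reduced_divisor D \<longleftrightarrow>
     (\<exists>I. fractional_ideal I \<and> I \<noteq> {0} \<and> minimal_in I 1 \<and> D = ideal_divisor I)"

text \<open>The set \<open>\<Sigma>\<^sub>D\<close>.\<close>

definition Sigma_set :: "'a::number_field divisor \<Rightarrow> 'a divisor set" where
  "Sigma_set D =
     {E \<in> carrier Div0_grp. fst E = fst D \<and>
        (\<forall>P\<in>infinite_primes.
           ln (snd E P) \<le> 1 / real (field_degree TYPE('a)) * ln (del_const TYPE('a)))}"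

end

theory Submission
  imports Defs "HOL-Analysis.Analysis" "HOL-Computational_Algebra.Polynomial_Factorial"
    "HOL-Computational_Algebra.Field_as_Ring" "Jordan_Normal_Form.Char_Poly" "HOL-Library.Function_Algebras"
begin

text \<open>
  By Minkowski's theorem a fractional ideal \<open>I\<close> contains a nonzero \<open>f\<close> with \<open>|\<sigma>(f)| < c\<^sub>\<sigma>\<close> for all \<open>\<sigma>\<close> as soon as
  \<open>\<Prod> c\<^sub>\<sigma>\<^bsup>deg \<sigma>\<^esup> > \<partial>\<^sub>F N(I)\<close>. For \<open>D = (I, u)\<close> of degree 0, discreteness yields a minimal \<open>f\<close> in \<open>I\<close> with
  \<open>u\<^sub>\<sigma> |\<sigma>(f)| \<le> \<partial>\<^sub>F\<^bsup>1/n\<^esup>\<close>. Then 1 is minimal in \<open>J = f\<inverse> I\<close>, and \<open>D - d(J)\<close> is \<open>(f\<inverse>) + (\<O>, v)\<close> with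
  \<open>v\<^sub>\<sigma> = u\<^sub>\<sigma> |\<sigma>(f)| N(J)\<^bsup>1/n\<^esup>\<close>, where \<open>N(J) \<le> 1\<close> because \<open>1 \<in> J\<close>. As the \<open>log v\<^sub>\<sigma>\<close> have weighted sum 0 and
  are at most \<open>c = log \<partial>\<^sub>F / n\<close>, their weighted Euclidean norm is at most \<open>n c\<close>.

  The group of divisors needs ideals to be invertible: as there are finitely many ideal classes, some
  powers satisfy \<open>I\<^bsup>k\<^esup> = I\<^bsup>k\<^esup> B\<close> with \<open>B = g I\<^bsup>m\<^esup>\<close>, and Nakayama's lemma gives \<open>B = \<O>\<close>.
\<close>

section \<open>Algebraic integers\<close>

text \<open>The constant is a quotient of volumes: the real embedding matrix of an integral basis
  has determinant of absolute value \<open>2^(-r2) * sqrt |disc|\<close>, and the body with half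
  bounds \<open>c / 2\<close> has volume \<open>(pi/4)^r2\<close> times the product of the
  \<open>c^deg\<close>. The main obstacle is that the norm of an ideal is a number of cosets divided
  by that of an arbitrarily chosen denominator, while degrees need it to be multiplicative. That
  \<open>x \<O>\<close> has index equal to the absolute norm of \<open>x\<close> is drawn from
  Minkowski's theorem itself: it gives an inequality up to a constant, and the constant disappears
  on passing to powers of \<open>x\<close>. For products of ideals, one maximal ideal at a time is
  split off, which is where invertibility enters. The distance is a least element of a set of reals,
  so its existence has to be shown: only finitely many units give a value below a given bound. In
  (i) the principal divisor is that of the inverse of the minimal element, because the divisor of
  \<open>f\<close> carries the ideal generated by \<open>inverse f\<close>. In (ii) the vector
  \<open>u |f|\<close> is used as it stands, since only the ideal of a member of the set is
  prescribed.\<close>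

lemma eigenvalue_imp_monic_root:
  fixes h :: "'c::comm_ring_1 \<Rightarrow> 'a::field" and b :: "nat \<Rightarrow> 'a"
  assumes h: "comm_ring_hom h"
    and eq: "\<And>i. i < n \<Longrightarrow> x * b i = (\<Sum>j<n. h (c i j) * b j)"
    and nz: "\<exists>i<n. b i \<noteq> 0"
  shows "\<exists>p. poly (map_poly h p) x = 0 \<and> lead_coeff p = 1"
proof -
  \<comment> \<open>The coefficients stay over the base ring, so that the characteristic polynomial
    is formed there and only then mapped by \<open>h\<close>: integers as base give integrality,
    rationals give algebraicity.\<close>
  define A :: "'c mat" where "A = Matrix.mat n n (\<lambda>(i, j). c i j)"
  define A' :: "'a mat" where "A' = map_mat h A"
  define v :: "'a Matrix.vec" where "v = Matrix.vec n b"
  have A: "A \<in> carrier_mat n n" "A' \<in> carrier_mat n n" by (auto simp: A_def A'_def)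
  have v0: "v \<noteq> 0\<^sub>v n"
  proof
    assume "v = 0\<^sub>v n"
    then have "\<And>i. i < n \<Longrightarrow> vec_index v i = 0" by simp
    then show False using nz by (auto simp: v_def)
  qed
  have "A' *\<^sub>v v = x \<cdot>\<^sub>v v"
    by (rule eq_vecI) (auto simp: v_def A'_def A_def scalar_prod_def eq lessThan_atLeast0)
  then have "eigenvector A' v x"
    using A v0 by (auto simp: eigenvector_def v_def)
  then have "eigenvalue A' x" by (auto simp: eigenvalue_def)
  then have "poly (char_poly A') x = 0"
    using eigenvalue_root_char_poly[OF A(2)] by simp
  moreover have "char_poly A' = map_poly h (char_poly A)"
    unfolding A'_def by (rule comm_ring_hom.char_poly_hom[OF h A(1)])
  moreover have "lead_coeff (char_poly A) = 1"
    using degree_monic_char_poly[OF A(1)] by auto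
  ultimately show ?thesis by metis
qed

lemma algebraic_int_eigenvalue:
  fixes x :: "'a::field_char_0" and b :: "nat \<Rightarrow> 'a" and c :: "nat \<Rightarrow> nat \<Rightarrow> int"
  assumes "\<And>i. i < n \<Longrightarrow> x * b i = (\<Sum>j<n. of_int (c i j) * b j)" and "\<exists>i<n. b i \<noteq> 0"
  shows "algebraic_int x"
  using eigenvalue_imp_monic_root[OF of_int_hom.comm_ring_hom_axioms assms]
  by (auto simp: algebraic_int_altdef_ipoly)

interpretation int_mod: Modules.module "\<lambda>(k::int) (x::'a::field_char_0). of_int k * x"
  by unfold_locales (auto simp: algebra_simps)

lemma algebraic_int_span:
  fixes x :: "'a::field_char_0"
  assumes "finite B" and "\<And>b. b \<in> B \<Longrightarrow> x * b \<in> int_mod.span B" and "\<exists>b\<in>B. b \<noteq> 0"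
  shows "algebraic_int x"
proof -
  obtain h where h: "bij_betw h {..<card B} B"
    using ex_bij_betw_nat_finite[OF \<open>finite B\<close>] by (auto simp: lessThan_atLeast0)
  have "\<forall>b\<in>B. \<exists>u. x * b = (\<Sum>v\<in>B. of_int (u v) * v)"
    using assms(2) int_mod.span_finite[OF assms(1)] by fast
  then obtain u where u: "\<And>b. b \<in> B \<Longrightarrow> x * b = (\<Sum>v\<in>B. of_int (u b v) * v)" by metis
  show ?thesis
  proof (rule algebraic_int_eigenvalue[where n = "card B" and b = h and c = "\<lambda>i j. u (h i) (h j)"])
    fix i assume "i < card B"
    then have "h i \<in> B" using h by (auto simp: bij_betw_def)
    then show "x * h i = (\<Sum>j<card B. of_int (u (h i) (h j)) * h j)"
      using sum.reindex_bij_betw[OF h, of "\<lambda>v. of_int (u (h i) v) * v"] u by simp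
  next
    show "\<exists>i<card B. h i \<noteq> 0"
      using assms(3) h by (metis bij_betw_iff_bijections lessThan_iff)
  qed
qed

text \<open>Serves as a rewriting rule for the top power. The bound \<open>p > 0\<close> holds
  because a monic constant has no root, and it keeps 1 among the lower powers.\<close>

lemma algebraic_int_power_reduce:
  fixes x :: "'a::field_char_0"
  assumes "algebraic_int x"
  obtains p a where "p > 0" "x ^ p = (\<Sum>i<p. of_int (a i) * x ^ i)"
proof -
  obtain q where q: "poly (map_poly of_int q) x = 0" "lead_coeff q = 1"
    using assms by (auto simp: algebraic_int_altdef_ipoly)
  have "degree q \<noteq> 0"
  proof
    assume "degree q = 0"
    then obtain c where "q = [:c:]" by (rule degree_eq_zeroE)
    then show False using q by (simp add: map_poly_pCons)
  qed
  have deg: "degree (map_poly of_int q :: 'a poly) = degree q" by (rule degree_map_poly) auto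
  have "0 = (\<Sum>i\<le>degree q. of_int (coeff q i) * x ^ i)"
    using q(1) by (simp add: poly_altdef deg coeff_map_poly)
  also have "{..degree q} = insert (degree q) {..<degree q}" by auto
  finally have "x ^ degree q = (\<Sum>i<degree q. of_int (- coeff q i) * x ^ i)"
    using q(2) by (simp add: sum_negf eq_neg_iff_add_eq_0)
  with \<open>degree q \<noteq> 0\<close> show ?thesis
    by (intro that[of "degree q" "\<lambda>i. - coeff q i"]) auto
qed

text \<open>The monomials \<open>x ^ i * y ^ j\<close> below the two reducible powers span a
  finitely generated group that multiplication by \<open>x\<close> and by \<open>y\<close> maps to
  itself.\<close>

lemma algebraic_int_add_mult:
  fixes x y :: "'a::field_char_0"
  assumes "algebraic_int x" "algebraic_int y"
  shows "algebraic_int (x + y)" "algebraic_int (x * y)"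
proof -
  obtain p a where p: "p > 0" "x ^ p = (\<Sum>i<p. of_int (a i) * x ^ i)"
    using algebraic_int_power_reduce[OF assms(1)] .
  obtain q c where q: "q > 0" "y ^ q = (\<Sum>i<q. of_int (c i) * y ^ i)"
    using algebraic_int_power_reduce[OF assms(2)] .
  define B where "B = (\<lambda>(i, j). x ^ i * y ^ j) ` ({..<p} \<times> {..<q})"
  have inB: "x ^ i * y ^ j \<in> B" if "i < p" "j < q" for i j
    using that by (auto simp: B_def)
  have x1: "x * b \<in> int_mod.span B" if b: "b \<in> B" for b
  proof -
    obtain i j where ij: "b = x ^ i * y ^ j" "i < p" "j < q" using b by (auto simp: B_def)
    show ?thesis
    proof (cases "Suc i = p")
      case False
      then have "x ^ Suc i * y ^ j \<in> B" using ij by (intro inB) auto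
      then show ?thesis using ij by (intro int_mod.span_base) (auto simp: mult_ac)
    next
      case True
      then have "x * b = x ^ p * y ^ j" using ij by auto
      also have "\<dots> = (\<Sum>k<p. of_int (a k) * (x ^ k * y ^ j))"
        unfolding p(2) sum_distrib_right by (simp add: mult_ac)
      also have "\<dots> \<in> int_mod.span B"
        using ij by (intro int_mod.span_sum int_mod.span_scale int_mod.span_base inB) auto
      finally show ?thesis .
    qed
  qed
  have y1: "y * b \<in> int_mod.span B" if b: "b \<in> B" for b
  proof -
    obtain i j where ij: "b = x ^ i * y ^ j" "i < p" "j < q" using b by (auto simp: B_def)
    show ?thesis
    proof (cases "Suc j = q")
      case False
      then have "x ^ i * y ^ Suc j \<in> B" using ij by (intro inB) auto
      then show ?thesis using ij by (intro int_mod.span_base) (auto simp: mult_ac)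
    next
      case True
      then have "y * b = x ^ i * y ^ q" using ij by auto
      also have "\<dots> = (\<Sum>k<q. of_int (c k) * (x ^ i * y ^ k))"
        unfolding q(2) sum_distrib_left by (simp add: mult_ac)
      also have "\<dots> \<in> int_mod.span B"
        using ij by (intro int_mod.span_sum int_mod.span_scale int_mod.span_base inB) auto
      finally show ?thesis .
    qed
  qed
  \<comment> \<open>The product needs stability of the whole span, since \<open>y * b\<close> is in
    general no longer a monomial of \<open>B\<close>.\<close>
  have x2: "x * z \<in> int_mod.span B" if "z \<in> int_mod.span B" for z
    using that
  proof (induction rule: int_mod.span_induct_alt)
    case base
    then show ?case by (simp add: int_mod.span_zero)
  next
    case (step k b z)
    have "x * (of_int k * b + z) = of_int k * (x * b) + x * z" by (simp add: algebra_simps)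
    then show ?case using step x1 by (auto intro!: int_mod.span_add int_mod.span_scale)
  qed
  have "1 \<in> B" using inB[OF p(1) q(1)] by simp
  then have nz: "\<exists>b\<in>B. b \<noteq> 0" using zero_neq_one by metis
  have fin: "finite B" by (auto simp: B_def)
  show "algebraic_int (x + y)"
    by (rule algebraic_int_span[OF fin _ nz])
      (auto simp: distrib_right intro!: int_mod.span_add x1 y1)
  show "algebraic_int (x * y)"
    by (rule algebraic_int_span[OF fin _ nz]) (auto simp: mult.assoc intro!: x2 y1)
qed

lemma algebraic_int_sum:
  fixes f :: "'b \<Rightarrow> 'a::field_char_0"
  assumes "\<And>i. i \<in> A \<Longrightarrow> algebraic_int (f i)"
  shows "algebraic_int (sum f A)"
  using assms by (induction A rule: infinite_finite_induct) (simp_all add: algebraic_int_add_mult)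

lemma algebraic_int_prod:
  fixes f :: "'b \<Rightarrow> 'a::field_char_0"
  assumes "\<And>i. i \<in> A \<Longrightarrow> algebraic_int (f i)"
  shows "algebraic_int (prod f A)"
  using assms
  by (induction A rule: infinite_finite_induct)
    (simp_all add: algebraic_int_add_mult int_imp_algebraic_int)

text \<open>With \<open>l\<close> the leading coefficient of an integral annihilator
  \<open>p\<close> of degree \<open>d\<close>, the element \<open>l * x\<close> is a root of
  \<open>l^(d-1) * p(X / l)\<close>, which is monic with integral coefficients.\<close>

lemma algebraic_int_multiple:
  fixes x :: "'a::field_char_0"
  assumes "algebraic x"
  obtains k :: int where "k \<noteq> 0" "algebraic_int (of_int k * x)"
proof -
  obtain p where p: "poly (map_poly of_int p) x = 0" "p \<noteq> 0"
    using algebraicE'[OF assms] by blast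
  define d l where "d = degree p" and "l = lead_coeff p"
  have l: "l \<noteq> 0" using p by (auto simp: l_def)
  have deg: "degree (map_poly of_int p :: 'a poly) = d"
    unfolding d_def by (rule degree_map_poly) auto
  have dn0: "d \<noteq> 0"
  proof
    assume "d = 0"
    then obtain c where "p = [:c:]" unfolding d_def by (rule degree_eq_zeroE)
    then show False using p by (simp add: map_poly_pCons)
  qed
  have 0: "0 = (\<Sum>i\<le>d. of_int (coeff p i) * x ^ i)"
    using p(1) by (simp add: poly_altdef deg coeff_map_poly d_def)
  \<comment> \<open>The leading term is split off: at \<open>i = d\<close> the truncated exponent
    \<open>d - 1 - i\<close> is 0, and the formula would give \<open>l\<close> instead of 1.\<close>
  define q where "q = (\<Sum>i<d. monom (coeff p i * l ^ (d - 1 - i)) i) + monom 1 d"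
  have cq: "coeff q j = (if j < d then coeff p j * l ^ (d - 1 - j) else if j = d then 1 else 0)" for j
    by (auto simp: q_def coeff_sum)
  have dq: "degree q = d"
    by (rule antisym) (auto simp: cq intro!: degree_le le_degree)
  have dq': "degree (map_poly of_int q :: 'a poly) = d"
    unfolding dq[symmetric] by (rule degree_map_poly) auto
  have "poly (map_poly of_int q) (of_int l * x) = (\<Sum>i\<le>d. of_int (coeff q i) * (of_int l * x) ^ i)"
    by (simp add: poly_altdef dq' dq coeff_map_poly)
  also have "\<dots> = of_int (l ^ (d - 1)) * (\<Sum>i\<le>d. of_int (coeff p i) * x ^ i)"
    unfolding sum_distrib_left
  proof (rule sum.cong)
    fix i assume i: "i \<in> {..d}"
    show "of_int (coeff q i) * (of_int l * x) ^ i = of_int (l ^ (d - 1)) * (of_int (coeff p i) * x ^ i)"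
    proof (cases "i = d")
      case True
      have "(of_int l :: 'a) ^ d = of_int l ^ (d - 1) * of_int l"
        using dn0 by (metis power_minus_mult neq0_conv)
      then show ?thesis using True by (simp add: cq power_mult_distrib l_def d_def)
    next
      case False
      then have "d - 1 = (d - 1 - i) + i" using i by auto
      then have "(of_int l :: 'a) ^ (d - 1) = of_int l ^ (d - 1 - i) * of_int l ^ i"
        by (metis power_add)
      then show ?thesis using False i by (simp add: cq power_mult_distrib)
    qed
  qed simp
  also have "\<dots> = 0" using 0 by simp
  finally have "algebraic_int (of_int l * x)"
    unfolding algebraic_int_altdef_ipoly by (intro exI[of _ q]) (auto simp: dq cq)
  with l show ?thesis by (intro that)
qed

section \<open>Embeddings\<close>

interpretation rat_vs: Vector_Spaces.vector_space "\<lambda>(q::rat) (x::'a::field_char_0). of_rat q * x"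
  by unfold_locales (auto simp: algebra_simps of_rat_add of_rat_mult)

interpretation fun_vs: Vector_Spaces.vector_space "\<lambda>(c::complex) (f::'b \<Rightarrow> complex) x. c * f x"
  by unfold_locales (auto simp: algebra_simps fun_eq_iff)

lemma sum_fun_apply: "(\<Sum>i\<in>A. f i) x = (\<Sum>i\<in>A. f i x :: 'c::comm_monoid_add)"
  by (induction A rule: infinite_finite_induct) auto

lemma rat_basis_exists:
  obtains B :: "'a::number_field set" where "finite B" "card B = field_degree TYPE('a)"
    "rat_vs.independent B" "rat_vs.span B = UNIV"
proof -
  obtain S :: "'a set" where S: "finite S" "\<forall>x. \<exists>c :: 'a \<Rightarrow> rat. x = (\<Sum>b\<in>S. of_rat (c b) * b)"
    using finite_dim_over_rat by blast
  have sp: "rat_vs.span S = UNIV"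
    using S unfolding rat_vs.span_finite[OF S(1)] by blast
  obtain B where B: "B \<subseteq> (UNIV :: 'a set)" "rat_vs.independent B" "UNIV \<subseteq> rat_vs.span B"
    "card B = rat_vs.dim (UNIV :: 'a set)"
    using rat_vs.basis_exists .
  have "finite B"
    using rat_vs.independent_span_bound[OF S(1) B(2)] sp by auto
  with B show ?thesis by (intro that) (auto simp: field_degree_def)
qed

lemma field_degree_pos: "field_degree TYPE('a::number_field) > 0"
proof -
  obtain B :: "'a set" where B: "finite B" "card B = field_degree TYPE('a)"
    "rat_vs.independent B" "rat_vs.span B = UNIV" by (rule rat_basis_exists)
  have "B \<noteq> {}"
  proof
    assume "B = {}"
    then have "(1::'a) \<in> {0}" using B(4) by (simp only: rat_vs.span_empty UNIV_I)
    then show False by simp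
  qed
  then show ?thesis using B(1,2) by (metis card_gt_0_iff)
qed

lemma monic_rat_annihilator:
  fixes a :: "'a::number_field"
  shows "\<exists>p. poly (map_poly of_rat p) a = 0 \<and> lead_coeff p = (1::rat)"
proof -
  obtain B :: "'a set" where B: "finite B" "card B = field_degree TYPE('a)"
    "rat_vs.independent B" "rat_vs.span B = UNIV" by (rule rat_basis_exists)
  obtain h where h: "bij_betw h {..<card B} B"
    using ex_bij_betw_nat_finite[OF B(1)] by (auto simp: lessThan_atLeast0)
  have "\<forall>x::'a. \<exists>u. x = (\<Sum>v\<in>B. of_rat (u v) * v)"
    using B(4) unfolding rat_vs.span_finite[OF B(1)] by blast
  then obtain u where u: "\<And>x::'a. x = (\<Sum>v\<in>B. of_rat (u x v) * v)" by metis
  show ?thesis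
  proof (rule eigenvalue_imp_monic_root[where b = h and n = "card B" and
        c = "\<lambda>i j. u (a * h i) (h j)"])
    show "comm_ring_hom (of_rat :: rat \<Rightarrow> 'a)" by (rule of_rat_hom.comm_ring_hom_axioms)
    show "a * h i = (\<Sum>j<card B. of_rat (u (a * h i) (h j)) * h j)" for i
      using sum.reindex_bij_betw[OF h, of "\<lambda>v. of_rat (u (a * h i) v) * v"] u[of "a * h i"] by simp
    have "0 < card B" using B(2) field_degree_pos by metis
    moreover from this have "h 0 \<in> B" using h by (auto simp: bij_betw_def)
    then have "h 0 \<noteq> 0" using B(3) rat_vs.dependent_zero by metis
    ultimately show "\<exists>i<card B. h i \<noteq> 0" by blast
  qed
qed

lemma algebraic_number_field: "algebraic (a :: 'a::number_field)"
proof -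
  obtain p where p: "poly (map_poly of_rat p) a = 0" "lead_coeff p = (1::rat)"
    using monic_rat_annihilator by blast
  show ?thesis
    by (rule algebraicI'[of "map_poly of_rat p"]) (use p in \<open>auto simp: coeff_map_poly\<close>)
qed

text \<open>A rational polynomial of least degree annihilating \<open>a\<close> is coprime to its derivative.\<close>

lemma separable_annihilator:
  fixes a :: "'a::number_field"
  obtains p :: "rat poly" where "poly (map_poly of_rat p) a = 0"
    "rsquarefree (map_poly of_rat p :: complex poly)"
proof -
  interpret ra: map_poly_comm_ring_hom "of_rat :: rat \<Rightarrow> 'a" ..
  interpret rc: map_poly_comm_ring_hom "of_rat :: rat \<Rightarrow> complex" ..
  define A where "A = (\<lambda>p :: rat poly. p \<noteq> 0 \<and> poly (map_poly of_rat p) a = 0)"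
  have "\<exists>p. A p" using monic_rat_annihilator[of a] unfolding A_def by (metis leading_coeff_0_iff zero_neq_one)
  then obtain p where p: "A p" and min: "\<And>q. A q \<Longrightarrow> degree p \<le> degree q"
    using ex_has_least_nat[of A _ degree] by blast
  have degp: "degree p \<noteq> 0"
  proof
    assume "degree p = 0"
    then obtain c where "p = [:c:]" by (rule degree_eq_zeroE)
    then show False using p by (auto simp: A_def map_poly_pCons)
  qed
  define g where "g = gcd p (pderiv p)"
  obtain h where h: "p = g * h" unfolding g_def by (metis dvdE gcd_dvd1)
  obtain k where k: "pderiv p = g * k" unfolding g_def by (metis dvdE gcd_dvd2)
  have gh0: "g \<noteq> 0" "h \<noteq> 0" using p h by (auto simp: A_def)
  have "poly (map_poly of_rat g) a * poly (map_poly of_rat h) a = 0"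
    using p h by (simp add: A_def ra.hom_mult)
  \<comment> \<open>Otherwise \<open>pderiv p\<close>, of smaller degree, would annihilate
    \<open>a\<close>. So \<open>h\<close> annihilates \<open>a\<close>, and minimality of
    \<open>p\<close> forces \<open>g\<close> to be constant.\<close>
  moreover have "poly (map_poly of_rat g) a \<noteq> 0"
  proof
    assume "poly (map_poly of_rat g) a = 0"
    then have "poly (map_poly of_rat (pderiv p)) a = 0" using k by (simp add: ra.hom_mult)
    moreover have "pderiv p \<noteq> 0" using degp by (simp add: pderiv_eq_0_iff)
    ultimately have "degree p \<le> degree (pderiv p)" by (intro min) (auto simp: A_def)
    then show False using degp by (simp add: degree_pderiv)
  qed
  ultimately have "poly (map_poly of_rat h) a = 0" by auto
  then have "degree p \<le> degree h" using gh0 by (intro min) (auto simp: A_def)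
  moreover have "degree p = degree g + degree h" using gh0 by (simp add: h degree_mult_eq)
  ultimately have "degree g = 0" by simp
  then obtain c where c: "g = [:c:]" by (rule degree_eq_zeroE)
  with gh0 have c0: "c \<noteq> 0" by auto
  \<comment> \<open>The Bezout identity survives the passage to complex coefficients, so a common
    root of \<open>p\<close> and its derivative would be a root of the nonzero constant
    \<open>g\<close>.\<close>
  obtain u v where uv: "u * p + v * pderiv p = g"
    unfolding g_def using bezout_coefficients_fst_snd by blast
  have "rsquarefree (map_poly of_rat p :: complex poly)"
    unfolding rsquarefree_roots
  proof (intro allI notI, elim conjE)
    fix z :: complex
    assume z: "poly (map_poly of_rat p) z = 0" "poly (pderiv (map_poly of_rat p)) z = 0"
    have "map_poly of_rat u * map_poly of_rat p + map_poly of_rat v * map_poly of_rat (pderiv p)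
        = (map_poly of_rat g :: complex poly)"
      unfolding uv[symmetric] by (simp add: rc.hom_mult rc.hom_add)
    then have "poly (map_poly of_rat g) z = 0"
      using z by (metis (no_types, lifting) add_0 mult_zero_right of_rat_hom.map_poly_pderiv poly_add poly_mult)
    then show False using c c0 by (simp add: map_poly_pCons)
  qed
  with p show ?thesis by (intro that) (auto simp: A_def)
qed

section \<open>Simultaneous diagonalisation of the multiplication operators\<close>

definition rat_linear :: "('a::field_char_0 \<Rightarrow> complex) \<Rightarrow> bool" where
  "rat_linear \<phi> \<longleftrightarrow> (\<forall>x y. \<phi> (x + y) = \<phi> x + \<phi> y) \<and> (\<forall>q x. \<phi> (of_rat q * x) = of_rat q * \<phi> x)"

lemma rat_linear_sum:
  assumes "rat_linear \<phi>"
  shows "\<phi> (\<Sum>i\<in>A. of_rat (q i) * f i) = (\<Sum>i\<in>A. of_rat (q i) * \<phi> (f i))"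
proof -
  have "\<phi> (of_rat 0 * 0) = of_rat 0 * \<phi> 0" using assms unfolding rat_linear_def by blast
  then have "\<phi> 0 = 0" by simp
  then show ?thesis
    using assms by (induction A rule: infinite_finite_induct) (auto simp: rat_linear_def)
qed

lemma rat_linear_additive:
  fixes \<phi> :: "'a::field_char_0 \<Rightarrow> complex"
  assumes add: "\<And>x y. \<phi> (x + y) = \<phi> x + \<phi> y"
  shows "rat_linear \<phi>"
  unfolding rat_linear_def
proof (intro conjI allI add)
  have 0: "\<phi> 0 = 0" using add[of 0 0] by simp
  have nat: "\<phi> (of_nat n * x) = of_nat n * \<phi> x" for n x
    by (induction n) (auto simp: 0 add algebra_simps)
  have neg: "\<phi> (- x) = - \<phi> x" for x
    using add[of x "- x"] 0 by (simp add: minus_unique)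
  have int: "\<phi> (of_int n * x) = of_int n * \<phi> x" for n x
    by (cases n rule: int_cases2) (simp_all add: nat neg)
  fix q :: rat and x :: 'a
  obtain m n where q: "q = of_int m / of_int n" "n > 0"
    by (metis quotient_of_denom_pos quotient_of_div surj_pair)
  have "of_int n * \<phi> (of_rat q * x) = \<phi> (of_int n * (of_rat q * x))" by (rule int[symmetric])
  also have "of_int n * (of_rat q * x) = of_int m * x" using q by (simp add: of_rat_divide)
  also have "\<phi> (of_int m * x) = of_int n * (of_rat q * \<phi> x)"
    using q by (simp add: int of_rat_divide)
  finally show "\<phi> (of_rat q * x) = of_rat q * \<phi> x" using q by simp
qed

text \<open>This is \<open>q(T) \<phi>\<close> for the operator \<open>T\<close> that sends
  \<open>\<phi>\<close> to \<open>\<lambda>x. \<phi> (a * x)\<close>.\<close>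

definition poly_act :: "complex poly \<Rightarrow> 'a::field \<Rightarrow> ('a \<Rightarrow> complex) \<Rightarrow> 'a \<Rightarrow> complex" where
  "poly_act q a \<phi> x = (\<Sum>i\<le>degree q. coeff q i * \<phi> (a ^ i * x))"

lemma poly_act_linear_factor:
  "poly_act ([:-\<mu>, 1:] * q) a \<phi> = poly_act q a (\<lambda>x. \<phi> (a * x) - \<mu> * \<phi> x)"
proof
  fix x
  define r where "r = [:-\<mu>, 1:] * q"
  define N where "N = degree q"
  have c: "coeff r i = (case i of 0 \<Rightarrow> 0 | Suc j \<Rightarrow> coeff q j) - \<mu> * coeff q i" for i
    by (cases i) (auto simp: r_def coeff_pCons)
  have cN: "coeff q (Suc N) = 0" by (simp add: N_def coeff_eq_0)
  have "degree r \<le> Suc N"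
    using degree_mult_le[of "[:-\<mu>, 1:]" q] by (simp add: N_def r_def)
  then have "poly_act r a \<phi> x = (\<Sum>i\<le>Suc N. coeff r i * \<phi> (a ^ i * x))"
    unfolding poly_act_def by (intro sum.mono_neutral_left) (auto intro: coeff_eq_0)
  also have "\<dots> = (\<Sum>i\<le>Suc N. (case i of 0 \<Rightarrow> 0 | Suc j \<Rightarrow> coeff q j) * \<phi> (a ^ i * x)) -
      (\<Sum>i\<le>Suc N. \<mu> * coeff q i * \<phi> (a ^ i * x))"
    unfolding c by (simp add: algebra_simps sum_subtractf del: sum.atMost_Suc)
  also have "(\<Sum>i\<le>Suc N. (case i of 0 \<Rightarrow> 0 | Suc j \<Rightarrow> coeff q j) * \<phi> (a ^ i * x)) =
      (\<Sum>i\<le>N. coeff q i * \<phi> (a ^ Suc i * x))"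
    by (subst sum.atMost_Suc_shift) simp
  also have "(\<Sum>i\<le>Suc N. \<mu> * coeff q i * \<phi> (a ^ i * x)) = (\<Sum>i\<le>N. \<mu> * coeff q i * \<phi> (a ^ i * x))"
    by (simp add: cN)
  finally show "poly_act ([:-\<mu>, 1:] * q) a \<phi> x = poly_act q a (\<lambda>x. \<phi> (a * x) - \<mu> * \<phi> x) x"
    unfolding r_def[symmetric] unfolding poly_act_def N_def[symmetric]
    by (simp add: sum_subtractf[symmetric] algebra_simps)
qed

lemma poly_act_annihilator:
  fixes a :: "'a::field_char_0"
  assumes "rat_linear \<phi>" "poly (map_poly of_rat p) a = 0"
  shows "poly_act (map_poly of_rat p) a \<phi> = (\<lambda>x. 0)"
proof
  fix x
  have "degree (map_poly of_rat p :: complex poly) = degree p" by (rule degree_map_poly) auto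
  then have "poly_act (map_poly of_rat p) a \<phi> x = (\<Sum>i\<le>degree p. of_rat (coeff p i) * \<phi> (a ^ i * x))"
    by (simp add: poly_act_def coeff_map_poly)
  also have "\<dots> = \<phi> (\<Sum>i\<le>degree p. of_rat (coeff p i) * (a ^ i * x))"
    by (rule rat_linear_sum[OF assms(1), symmetric])
  also have "(\<Sum>i\<le>degree p. of_rat (coeff p i) * (a ^ i * x)) = poly (map_poly of_rat p) a * x"
    unfolding poly_altdef sum_distrib_right
    by (simp add: degree_map_poly[of "of_rat :: rat \<Rightarrow> 'a" p] coeff_map_poly mult_ac)
  also have "\<phi> \<dots> = 0" using rat_linear_sum[OF assms(1), of _ _ "{}"] assms(2) by simp
  finally show "poly_act (map_poly of_rat p) a \<phi> x = 0" .
qed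

text \<open>A vector annihilated by a product of distinct linear factors in an operator is a sum of
  eigenvectors. The invariant subspace \<open>W\<close> is carried along so that eigenvector
  conditions for other elements survive the decomposition.\<close>

lemma eigenvector_decomposition:
  assumes "finite R" and "fun_vs.subspace W" and closed: "\<And>\<psi>. \<psi> \<in> W \<Longrightarrow> (\<lambda>x. \<psi> (a * x)) \<in> W"
    and "\<phi> \<in> W" and "poly_act (\<Prod>\<mu>\<in>R. [:-\<mu>, 1:]) a \<phi> = (\<lambda>x. 0)"
  shows "\<phi> \<in> fun_vs.span {\<psi> \<in> W. \<exists>\<mu>\<in>R. \<forall>x. \<psi> (a * x) = \<mu> * \<psi> x}"
  using assms(1,4,5)
proof (induction R arbitrary: \<phi> rule: finite_induct)
  case empty
  then have 0: "\<phi> = 0" by (simp add: poly_act_def fun_eq_iff)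
  show ?case unfolding 0 by (rule fun_vs.span_zero)
next
  case (insert \<mu> R)
  let ?E = "\<lambda>R. {\<psi> \<in> W. \<exists>\<mu>\<in>R. \<forall>x. \<psi> (a * x) = \<mu> * \<psi> x}"
  \<comment> \<open>Here \<open>\<eta>\<close> is \<open>(T - \<mu>) \<phi>\<close> and is killed by
    the remaining factors. Once some \<open>\<theta>\<close> in the span of the other eigenspaces
    satisfies \<open>(T - \<mu>) \<theta> = \<eta>\<close>, the difference
    \<open>\<phi> - \<theta>\<close> is an eigenvector for \<open>\<mu>\<close>.\<close>
  define \<eta> where "\<eta> = (\<lambda>x. \<phi> (a * x) - \<mu> * \<phi> x)"
  have W: "fun_vs.subspace W" by fact
  have "(\<lambda>x. \<phi> (a * x)) - (\<lambda>x. \<mu> * \<phi> x) \<in> W"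
    by (intro fun_vs.subspace_diff[OF W] fun_vs.subspace_scale[OF W] closed insert.prems)
  then have \<eta>W: "\<eta> \<in> W" unfolding \<eta>_def by (simp add: fun_diff_def)
  have "poly_act (\<Prod>\<mu>\<in>R. [:-\<mu>, 1:]) a \<eta> = (\<lambda>x. 0)"
    using insert.prems(2) unfolding prod.insert[OF insert.hyps] poly_act_linear_factor \<eta>_def .
  then have "\<eta> \<in> fun_vs.span (?E R)" by (intro insert.IH \<eta>W)
  then have "\<exists>\<theta> \<in> fun_vs.span (?E R). \<theta> \<in> W \<and> (\<forall>x. \<theta> (a * x) - \<mu> * \<theta> x = \<eta> x)"
  proof (induction rule: fun_vs.span_induct_alt)
    case base
    show ?case
      by (intro bexI[of _ 0] conjI allI fun_vs.subspace_0[OF W] fun_vs.span_zero) simp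
  next
    case (step c \<psi> \<eta>')
    then obtain \<theta> where \<theta>: "\<theta> \<in> fun_vs.span (?E R)" "\<theta> \<in> W" "\<And>x. \<theta> (a * x) - \<mu> * \<theta> x = \<eta>' x"
      by blast
    obtain \<nu> where \<nu>: "\<psi> \<in> W" "\<nu> \<in> R" "\<And>x. \<psi> (a * x) = \<nu> * \<psi> x" using step by auto
    have ne: "\<nu> - \<mu> \<noteq> 0" using \<nu>(2) insert.hyps by auto
    \<comment> \<open>On the eigenvector \<open>\<psi>\<close> the operator \<open>T - \<mu>\<close>
      is multiplication by \<open>\<nu> - \<mu>\<close>, nonzero because \<open>\<mu>\<close> is not
      in \<open>R\<close>; dividing by it inverts the operator there.\<close>
    define d where "d = c / (\<nu> - \<mu>)"
    have d: "d * \<nu> - d * \<mu> = c" using ne by (simp add: d_def divide_simps) (simp add: algebra_simps)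
    show ?case
    proof (intro bexI[of _ "(\<lambda>x. d * \<psi> x) + \<theta>"] conjI allI)
      show "(\<lambda>x. d * \<psi> x) + \<theta> \<in> fun_vs.span (?E R)"
        by (intro fun_vs.span_add fun_vs.span_scale fun_vs.span_base[OF step(1)] \<theta>(1))
      show "(\<lambda>x. d * \<psi> x) + \<theta> \<in> W"
        using \<nu> \<theta> by (intro fun_vs.subspace_add[OF W] fun_vs.subspace_scale[OF W])
      fix x
      show "((\<lambda>x. d * \<psi> x) + \<theta>) (a * x) - \<mu> * ((\<lambda>x. d * \<psi> x) + \<theta>) x = ((\<lambda>x. c * \<psi> x) + \<eta>') x"
        using \<theta>(3)[of x] \<nu>(3)[of x] by (simp add: d[symmetric] algebra_simps)
    qed
  qed
  then obtain \<theta> where \<theta>: "\<theta> \<in> fun_vs.span (?E R)" "\<theta> \<in> W" "\<And>x. \<theta> (a * x) - \<mu> * \<theta> x = \<eta> x"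
    by blast
  have "\<phi> - \<theta> \<in> ?E (insert \<mu> R)"
  proof -
    have "(\<phi> - \<theta>) (a * x) = \<mu> * (\<phi> - \<theta>) x" for x
      using \<theta>(3)[of x] by (simp add: \<eta>_def algebra_simps)
    then show ?thesis using fun_vs.subspace_diff[OF W insert.prems(1) \<theta>(2)] by blast
  qed
  then have "\<phi> - \<theta> \<in> fun_vs.span (?E (insert \<mu> R))" by (rule fun_vs.span_base)
  moreover have "\<theta> \<in> fun_vs.span (?E (insert \<mu> R))"
    using fun_vs.span_mono[of "?E R" "?E (insert \<mu> R)"] \<theta>(1) by blast
  ultimately have "(\<phi> - \<theta>) + \<theta> \<in> fun_vs.span (?E (insert \<mu> R))" by (rule fun_vs.span_add)
  then show ?case by simp
qed

text \<open>The multiplications commute, so a new element \<open>a\<close> can be diagonalised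
  inside a joint eigenspace of the old ones; its annihilator has simple complex roots, which makes
  it diagonalisable.\<close>

lemma simultaneous_eigenvectors:
  fixes \<phi> :: "'a::number_field \<Rightarrow> complex"
  assumes "finite A" "rat_linear \<phi>"
  shows "\<phi> \<in> fun_vs.span {\<psi>. rat_linear \<psi> \<and> (\<forall>a\<in>A. \<exists>\<mu>. \<forall>x. \<psi> (a * x) = \<mu> * \<psi> x)}"
    (is "_ \<in> fun_vs.span (?E A)")
  using assms
proof (induction A rule: finite_induct)
  case empty
  then show ?case by (intro fun_vs.span_base) auto
next
  case (insert a A)
  have "?E A \<subseteq> fun_vs.span (?E (insert a A))"
  proof
    fix \<psi> assume \<psi>: "\<psi> \<in> ?E A"
    then obtain l where l: "\<And>b x. b \<in> A \<Longrightarrow> \<psi> (b * x) = l b * \<psi> x" by simp metis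
    \<comment> \<open>The functionals with the same eigenvalues on \<open>A\<close> as
      \<open>\<psi>\<close>. Composing with multiplication by \<open>a\<close> preserves
      them.\<close>
    define W where "W = {\<eta>. rat_linear \<eta> \<and> (\<forall>b\<in>A. \<forall>x. \<eta> (b * x) = l b * \<eta> x)}"
    obtain p where p: "poly (map_poly of_rat p) a = 0" "rsquarefree (map_poly of_rat p :: complex poly)"
      by (rule separable_annihilator)
    define q where "q = (map_poly of_rat p :: complex poly)"
    define R where "R = {z. poly q z = 0}"
    have q0: "q \<noteq> 0" using p(2) by (auto simp: q_def rsquarefree_def)
    have "smult (lead_coeff q) (\<Prod>\<mu>\<in>R. [:-\<mu>, 1:]) = q"
      unfolding R_def by (rule complex_poly_decompose_rsquarefree) (simp add: q_def p)
    then have "poly_act (smult (lead_coeff q) (\<Prod>\<mu>\<in>R. [:-\<mu>, 1:])) a \<psi> = (\<lambda>x. 0)"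
      using poly_act_annihilator[OF _ p(1), of \<psi>] \<psi> by (simp add: q_def)
    then have act: "poly_act (\<Prod>\<mu>\<in>R. [:-\<mu>, 1:]) a \<psi> = (\<lambda>x. 0)"
      using q0 by (simp add: poly_act_def fun_eq_iff mult.assoc sum_distrib_left[symmetric])
    have "\<psi> \<in> fun_vs.span {\<eta> \<in> W. \<exists>\<mu>\<in>R. \<forall>x. \<eta> (a * x) = \<mu> * \<eta> x}"
    proof (rule eigenvector_decomposition[OF _ _ _ _ act])
      show "finite R" unfolding R_def by (rule poly_roots_finite[OF q0])
      show "fun_vs.subspace W"
        by (rule fun_vs.subspaceI) (auto simp: W_def rat_linear_def algebra_simps)
      show "\<psi> \<in> W" using \<psi> l by (auto simp: W_def)
      show "(\<lambda>x. \<eta> (a * x)) \<in> W" if "\<eta> \<in> W" for \<eta>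
        using that by (auto simp: W_def rat_linear_def distrib_left mult.left_commute[of a])
    qed
    also have "\<dots> \<subseteq> fun_vs.span (?E (insert a A))"
      by (rule fun_vs.span_mono) (auto simp: W_def)
    finally show "\<psi> \<in> fun_vs.span (?E (insert a A))" .
  qed
  then have "fun_vs.span (?E A) \<subseteq> fun_vs.span (?E (insert a A))"
    by (intro fun_vs.span_minimal fun_vs.subspace_span)
  then show ?case using insert by blast
qed

lemma embeddingI:
  fixes \<sigma> :: "'a::number_field \<Rightarrow> complex"
  assumes "\<And>x y. \<sigma> (x + y) = \<sigma> x + \<sigma> y" "\<And>x y. \<sigma> (x * y) = \<sigma> x * \<sigma> y" "\<sigma> 1 = 1"
  shows "\<sigma> \<in> embeddings"
proof -
  have "\<sigma> 0 = 0" using assms(1)[of 0 0] by simp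
  then show ?thesis unfolding embeddings_def mem_Collect_eq by unfold_locales (use assms in auto)
qed

lemma embedding_simps:
  assumes "\<sigma> \<in> embeddings"
  shows "\<sigma> (x + y) = \<sigma> x + \<sigma> y" "\<sigma> (x * y) = \<sigma> x * \<sigma> y" "\<sigma> 1 = 1" "\<sigma> 0 = 0"
    "\<sigma> (x - y) = \<sigma> x - \<sigma> y" "\<sigma> (- x) = - \<sigma> x" "\<sigma> (inverse x) = inverse (\<sigma> x)" "\<sigma> x = 0 \<longleftrightarrow> x = 0"
proof -
  interpret field_hom \<sigma> using assms by (simp add: embeddings_def)
  show "\<sigma> (x + y) = \<sigma> x + \<sigma> y" "\<sigma> (x * y) = \<sigma> x * \<sigma> y" "\<sigma> 1 = 1" "\<sigma> 0 = 0"
    "\<sigma> (x - y) = \<sigma> x - \<sigma> y" "\<sigma> (- x) = - \<sigma> x" "\<sigma> (inverse x) = inverse (\<sigma> x)" "\<sigma> x = 0 \<longleftrightarrow> x = 0"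
    by (simp_all add: hom_distribs)
qed

lemma embedding_rat_linear: "\<sigma> \<in> embeddings \<Longrightarrow> rat_linear \<sigma>"
  by (intro rat_linear_additive embedding_simps)

text \<open>A joint eigenvector for a rational basis is, by linearity, one for every element, so
  \<open>\<psi> (x * y)\<close> is \<open>\<psi> y\<close> times a factor depending on
  \<open>x\<close> alone. Divided by \<open>\<psi> 1\<close> it becomes multiplicative; if
  \<open>\<psi> 1 = 0\<close> it vanishes.\<close>

lemma embeddings_span:
  fixes \<phi> :: "'a::number_field \<Rightarrow> complex"
  assumes "rat_linear \<phi>"
  shows "\<phi> \<in> fun_vs.span embeddings"
proof -
  obtain B :: "'a set" where B: "finite B" "card B = field_degree TYPE('a)"
    "rat_vs.independent B" "rat_vs.span B = UNIV" by (rule rat_basis_exists)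
  have "{\<psi>. rat_linear \<psi> \<and> (\<forall>a\<in>B. \<exists>\<mu>. \<forall>x. \<psi> (a * x) = \<mu> * \<psi> x)} \<subseteq> fun_vs.span embeddings"
  proof safe
    fix \<psi> :: "'a \<Rightarrow> complex"
    assume \<psi>: "rat_linear \<psi>" "\<forall>a\<in>B. \<exists>\<mu>. \<forall>x. \<psi> (a * x) = \<mu> * \<psi> x"
    then obtain l where l: "\<And>b x. b \<in> B \<Longrightarrow> \<psi> (b * x) = l b * \<psi> x" by metis
    have ex: "\<exists>\<mu>. \<forall>x. \<psi> (a * x) = \<mu> * \<psi> x" for a
    proof -
      have "a \<in> rat_vs.span B" using B(4) by simp
      then obtain c where c: "a = (\<Sum>b\<in>B. of_rat (c b) * b)"
        unfolding rat_vs.span_finite[OF B(1)] by blast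
      have "\<psi> (a * x) = (\<Sum>b\<in>B. of_rat (c b) * l b) * \<psi> x" for x
        using rat_linear_sum[OF \<psi>(1), of c "\<lambda>b. b * x" B] l
        by (simp add: c sum_distrib_right mult.assoc)
      then show ?thesis by blast
    qed
    show "\<psi> \<in> fun_vs.span embeddings"
    proof (cases "\<psi> 1 = 0")
      case True
      have "\<psi> a = 0" for a using ex[of a] True by (metis mult.right_neutral mult_zero_right)
      then have 0: "\<psi> = 0" by (simp add: fun_eq_iff)
      show ?thesis unfolding 0 by (rule fun_vs.span_zero)
    next
      case False
      have "(\<lambda>x. \<psi> x / \<psi> 1) \<in> embeddings"
      proof (rule embeddingI)
        fix x y
        show "\<psi> (x + y) / \<psi> 1 = \<psi> x / \<psi> 1 + \<psi> y / \<psi> 1"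
          using \<psi>(1) by (simp add: rat_linear_def add_divide_distrib)
        obtain \<mu> where \<mu>: "\<And>y. \<psi> (x * y) = \<mu> * \<psi> y" using ex[of x] by blast
        show "\<psi> (x * y) / \<psi> 1 = \<psi> x / \<psi> 1 * (\<psi> y / \<psi> 1)"
          using \<mu>[of y] \<mu>[of 1] False by simp
      qed (use False in auto)
      then have "(\<lambda>x. \<psi> 1 * (\<psi> x / \<psi> 1)) \<in> fun_vs.span embeddings"
        by (intro fun_vs.span_scale fun_vs.span_base)
      then show ?thesis using False by simp
    qed
  qed
  then show ?thesis
    using simultaneous_eigenvectors[OF B(1) assms] fun_vs.span_minimal fun_vs.subspace_span by blast
qed

text \<open>Dedekind's independence of characters, by eliminating one embedding from the
  relation.\<close>

lemma embeddings_independent: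
  assumes "finite S" "S \<subseteq> embeddings" "\<And>x. (\<Sum>\<sigma>\<in>S. u \<sigma> * \<sigma> x) = 0" "\<sigma> \<in> S"
  shows "u \<sigma> = 0"
  using assms
proof (induction S arbitrary: u \<sigma> rule: finite_induct)
  case (insert \<tau> S)
  have *: "u \<sigma> = 0" if \<sigma>: "\<sigma> \<in> S" for \<sigma>
  proof -
    \<comment> \<open>Substituting \<open>y * x\<close> into the relation and subtracting
      \<open>\<tau> y\<close> times the relation removes the term of \<open>\<tau>\<close>.\<close>
    have "u \<sigma> * (\<sigma> y - \<tau> y) = 0" for y
    proof (rule insert.IH[OF _ _ \<sigma>, of "\<lambda>\<sigma>. u \<sigma> * (\<sigma> y - \<tau> y)"])
      show "S \<subseteq> embeddings" using insert by auto
      fix x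
      have "(\<Sum>\<sigma>\<in>S. u \<sigma> * (\<sigma> y - \<tau> y) * \<sigma> x) = (\<Sum>\<sigma>\<in>insert \<tau> S. u \<sigma> * (\<sigma> y - \<tau> y) * \<sigma> x)"
        using insert.hyps by simp
      also have "\<dots> = (\<Sum>\<sigma>\<in>insert \<tau> S. u \<sigma> * \<sigma> (y * x)) - \<tau> y * (\<Sum>\<sigma>\<in>insert \<tau> S. u \<sigma> * \<sigma> x)"
        unfolding sum_distrib_left sum_subtractf[symmetric]
        using insert.prems(1) by (intro sum.cong) (auto simp: embedding_simps algebra_simps)
      also have "\<dots> = 0" using insert.prems(2) by simp
      finally show "(\<Sum>\<sigma>\<in>S. u \<sigma> * (\<sigma> y - \<tau> y) * \<sigma> x) = 0" .
    qed
    moreover have "\<exists>y. \<sigma> y \<noteq> \<tau> y" using \<sigma> insert.hyps by (metis ext)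
    ultimately show ?thesis by (metis mult_eq_0_iff right_minus_eq)
  qed
  have "(\<Sum>\<sigma>\<in>insert \<tau> S. u \<sigma> * \<sigma> 1) = u \<tau> * \<tau> 1" using insert.hyps * by simp
  then have "u \<tau> = 0" using insert.prems by (simp add: embedding_simps)
  with * insert.prems show ?case by auto
qed simp

lemma embeddings_independent': "fun_vs.independent (embeddings :: ('a::number_field \<Rightarrow> complex) set)"
  unfolding fun_vs.independent_explicit_finite_subsets
proof (intro allI impI ballI)
  fix S :: "('a \<Rightarrow> complex) set" and u \<sigma>
  assume *: "S \<subseteq> embeddings" "finite S" "(\<Sum>\<sigma>\<in>S. (\<lambda>x. u \<sigma> * \<sigma> x)) = 0" "\<sigma> \<in> S"
  have "(\<Sum>\<sigma>\<in>S. u \<sigma> * \<sigma> x) = 0" for x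
    using fun_cong[OF *(3), of x] by (simp add: sum_fun_apply)
  then show "u \<sigma> = 0" using embeddings_independent *(1,2,4) by blast
qed

text \<open>The embeddings form a basis of the complex space of rational-linear maps into the
  complex numbers. The coordinate functionals \<open>d b\<close> of a rational basis form another
  one, with as many elements as the degree.\<close>

lemma card_embeddings:
  "finite (embeddings :: ('a::number_field \<Rightarrow> complex) set)"
  "card (embeddings :: ('a \<Rightarrow> complex) set) = field_degree TYPE('a)"
proof -
  obtain B :: "'a set" where B: "finite B" "card B = field_degree TYPE('a)"
    "rat_vs.independent B" "rat_vs.span B = UNIV" by (rule rat_basis_exists)
  define d :: "'a \<Rightarrow> 'a \<Rightarrow> complex" where "d b x = of_rat (rat_vs.representation B x b)" for b x
  have rep: "x = (\<Sum>b\<in>B. of_rat (rat_vs.representation B x b) * b)" for x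
    using rat_vs.sum_representation_eq[OF B(3), of x B] B(1,4) by simp
  have dB: "d b b' = (if b = b' then 1 else 0)" if "b \<in> B" "b' \<in> B" for b b'
    using rat_vs.representation_basis[OF B(3) that(2)] by (simp add: d_def)
  have lin: "rat_linear (d b)" for b
    using rat_vs.representation_add[OF B(3)] rat_vs.representation_scale[OF B(3)] B(4)
    by (simp add: rat_linear_def d_def of_rat_add of_rat_mult)
  have sp: "\<phi> \<in> fun_vs.span (d ` B)" if "rat_linear \<phi>" for \<phi>
  proof -
    have "\<phi> = (\<Sum>b\<in>B. (\<lambda>x. \<phi> b * d b x))"
    proof
      fix x
      have "\<phi> x = \<phi> (\<Sum>b\<in>B. of_rat (rat_vs.representation B x b) * b)" using rep by simp
      also have "\<dots> = (\<Sum>b\<in>B. d b x * \<phi> b)"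
        unfolding rat_linear_sum[OF that] by (simp add: d_def)
      finally show "\<phi> x = (\<Sum>b\<in>B. (\<lambda>x. \<phi> b * d b x)) x" by (simp add: sum_fun_apply mult.commute)
    qed
    also have "\<dots> \<in> fun_vs.span (d ` B)"
      by (intro fun_vs.span_sum fun_vs.span_scale fun_vs.span_base) auto
    finally show ?thesis .
  qed
  have inj: "inj_on d B"
    by (rule inj_onI) (metis dB zero_neq_one)
  have "fun_vs.independent (d ` B)"
    unfolding fun_vs.independent_explicit_finite_subsets
  proof (intro allI impI ballI)
    fix S :: "('a \<Rightarrow> complex) set" and u s
    assume *: "S \<subseteq> d ` B" "finite S" "(\<Sum>v\<in>S. (\<lambda>x. u v * v x)) = 0" "s \<in> S"
    then obtain b where b: "b \<in> B" "s = d b" by auto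
    have "0 = (\<Sum>v\<in>S. u v * v b)" using fun_cong[OF *(3), of b] by (simp add: sum_fun_apply)
    also have "\<dots> = (\<Sum>v\<in>S. if v = s then u s else 0)"
      using *(1) b dB by (intro sum.cong refl) (smt (verit) image_iff mult_cancel_left1 mult_zero_right subset_iff)
    also have "\<dots> = u s" using * by simp
    finally show "u s = 0" by simp
  qed
  moreover have fin: "finite (d ` B)" using B by simp
  have bound: "finite (embeddings :: ('a \<Rightarrow> complex) set) \<and> card (embeddings :: ('a \<Rightarrow> complex) set) \<le> card (d ` B)"
    using sp embedding_rat_linear
    by (intro fun_vs.independent_span_bound fin embeddings_independent') auto
  ultimately have "card (d ` B) \<le> card (embeddings :: ('a \<Rightarrow> complex) set)"
    using lin embeddings_span by (intro conjunct2[OF fun_vs.independent_span_bound]) auto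
  then show "finite (embeddings :: ('a \<Rightarrow> complex) set)"
    "card (embeddings :: ('a \<Rightarrow> complex) set) = field_degree TYPE('a)"
    using bound card_image[OF inj] B(2) by auto
qed

text \<open>Turns the embeddings into a finite type, so that they can index the coordinates of
  vectors and matrices.\<close>

typedef (overloaded) 'a emb = "embeddings :: ('a::number_field \<Rightarrow> complex) set"
proof -
  have "card (embeddings :: ('a \<Rightarrow> complex) set) \<noteq> 0"
    using card_embeddings(2)[where 'a = 'a] field_degree_pos[where 'a = 'a] by simp
  then show ?thesis by (metis card.empty equals0I)
qed

instance emb :: (number_field) finite
proof
  have "bij_betw Abs_emb (embeddings :: ('a \<Rightarrow> complex) set) UNIV"
    by (rule bij_betw_byWitness[where f' = Rep_emb])
      (auto simp: Rep_emb Abs_emb_inverse Rep_emb_inverse)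
  then show "finite (UNIV :: 'a emb set)" using card_embeddings(1) bij_betw_finite by blast
qed

lemma bij_betw_Rep_emb: "bij_betw Rep_emb UNIV (embeddings :: ('a::number_field \<Rightarrow> complex) set)"
  by (rule bij_betw_byWitness[where f' = Abs_emb])
    (auto simp: Rep_emb Abs_emb_inverse Rep_emb_inverse)

lemma card_emb: "CARD('a::number_field emb) = field_degree TYPE('a)"
  using bij_betw_same_card[OF bij_betw_Rep_emb[where 'a = 'a]] card_embeddings(2)[where 'a = 'a] by simp

no_notation Matrix.vec_index (infixl "$" 100)
no_notation Matrix.scalar_prod (infix "\<bullet>" 70)

section \<open>Integral bases\<close>

text \<open>The discriminant is stated with a matrix indexed by numbers, the linear algebra here
  with matrices indexed by a type. Transport of permutations along \<open>e\<close> preserves signs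
  and matches the products.\<close>

lemma det_mat_eq_det:
  fixes A :: "'c::comm_ring_1^'n^'n"
  assumes e: "bij_betw e {..<n} (UNIV :: 'n set)"
  shows "Determinant.det (Matrix.mat n n (\<lambda>(i, j). A $ e i $ e j)) = Determinants.det A"
proof -
  let ?I = "{0..<n}"
  have inj: "inj_on e ?I" and ran: "e ` ?I = UNIV"
    using e by (auto simp: bij_betw_def lessThan_atLeast0)
  let ?m = "map_permutation ?I e"
  let ?e' = "inv_into ?I e"
  have e': "bij_betw ?e' UNIV ?I"
    using bij_betw_inv_into[OF e] by (simp add: lessThan_atLeast0)
  have e0: "bij_betw e ?I UNIV" using e by (simp add: lessThan_atLeast0)
  have "Determinants.det A = (\<Sum>p\<in>{p. p permutes (UNIV :: 'n set)}. of_int (sign p) * (\<Prod>i\<in>UNIV. A $ i $ p i))"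
    by (simp add: Determinants.det_def)
  also have "\<dots> = (\<Sum>p\<in>{p. p permutes ?I}. of_int (sign (?m p)) * (\<Prod>i\<in>UNIV. A $ i $ ?m p i))"
  proof -
    have 1: "?m (map_permutation UNIV ?e' p) = p" if "p permutes UNIV" for p
      using that e' inj ran
      by (intro map_permutation_compose_inv[where A = UNIV and B = ?I])
        (auto simp: bij_betw_def f_inv_into_f)
    have 2: "map_permutation UNIV ?e' (?m p) = p" if "p permutes ?I" for p
      using that e0 inj
      by (intro map_permutation_compose_inv[where A = ?I and B = UNIV]) auto
    show ?thesis
      by (rule sum.reindex_bij_witness[where i = ?m and j = "map_permutation UNIV ?e'"])
        (auto simp: 1 2 map_permutation_permutes[OF e'] map_permutation_permutes[OF e0])
  qed
  also have "\<dots> = (\<Sum>p\<in>{p. p permutes ?I}. signof p * (\<Prod>i = 0..<n. A $ e i $ e (p i)))"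
  proof (rule sum.cong, goal_cases)
    case (2 p)
    then have p: "p permutes ?I" by simp
    have "sign (?m p) = sign p" by (rule sign_map_permutation[OF inj p]) simp
    moreover have "(\<Prod>i\<in>UNIV. A $ i $ ?m p i) = (\<Prod>i\<in>?I. A $ e i $ ?m p (e i))"
      unfolding ran[symmetric] by (rule prod.reindex[OF inj, unfolded o_def])
    moreover have "\<dots> = (\<Prod>i\<in>?I. A $ e i $ e (p i))"
      by (intro prod.cong refl) (simp add: map_permutation_apply[OF inj])
    ultimately show ?case by simp
  qed simp
  also have "\<dots> = Determinant.det (Matrix.mat n n (\<lambda>(i, j). A $ e i $ e j))"
    unfolding det_def'[OF mat_carrier]
    by (intro sum.cong refl arg_cong2[of _ _ _ _ "(*)"] prod.cong)
      (auto dest!: permutes_in_image[THEN iffD2, rotated])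
  finally show ?thesis ..
qed

lemma Rep_emb_simps [simp]:
  fixes \<sigma> :: "'a::number_field emb"
  shows "Rep_emb \<sigma> (x + y) = Rep_emb \<sigma> x + Rep_emb \<sigma> y"
    "Rep_emb \<sigma> (x * y) = Rep_emb \<sigma> x * Rep_emb \<sigma> y" "Rep_emb \<sigma> 1 = 1" "Rep_emb \<sigma> 0 = 0"
    "Rep_emb \<sigma> (x - y) = Rep_emb \<sigma> x - Rep_emb \<sigma> y" "Rep_emb \<sigma> (- x) = - Rep_emb \<sigma> x"
    "Rep_emb \<sigma> (inverse x) = inverse (Rep_emb \<sigma> x)" "Rep_emb \<sigma> x = 0 \<longleftrightarrow> x = 0"
  using embedding_simps[OF Rep_emb[of \<sigma>]] by auto

lemma Rep_emb_rat_linear: "rat_linear (Rep_emb \<sigma>)"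
  by (rule embedding_rat_linear[OF Rep_emb])

lemma Rep_emb_rat_sum: "Rep_emb \<sigma> (\<Sum>i\<in>A. of_rat (q i) * f i) = (\<Sum>i\<in>A. of_rat (q i) * Rep_emb \<sigma> (f i))"
  by (rule rat_linear_sum[OF Rep_emb_rat_linear])

lemma Rep_emb_of_rat [simp]: "Rep_emb \<sigma> (of_rat q) = of_rat q"
  using Rep_emb_rat_sum[of \<sigma> "\<lambda>_. q" "\<lambda>_. 1" "{()}"] by simp

lemma Rep_emb_of_int [simp]: "Rep_emb \<sigma> (of_int k) = of_int k"
  using Rep_emb_of_rat[of \<sigma> "of_int k"] by simp

lemma Rep_emb_power [simp]: "Rep_emb \<sigma> (x ^ k) = Rep_emb \<sigma> x ^ k"
  by (induction k) auto

lemma Rep_emb_int_sum: "Rep_emb \<sigma> (\<Sum>i\<in>A. of_int (q i) * f i) = (\<Sum>i\<in>A. of_int (q i) * Rep_emb \<sigma> (f i))"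
  using Rep_emb_rat_sum[of \<sigma> "\<lambda>i. of_int (q i)" f A] by simp

lemma sum_embeddings: "(\<Sum>\<sigma>\<in>embeddings. f \<sigma>) = (\<Sum>\<sigma>\<in>UNIV. f (Rep_emb (\<sigma> :: 'a::number_field emb)))"
  using sum.reindex_bij_betw[OF bij_betw_Rep_emb] by metis

lemma det_nz_imp_ker_trivial:
  fixes A :: "'c::field^'n^'n"
  shows "Determinants.det A \<noteq> 0 \<Longrightarrow> A *v x = 0 \<Longrightarrow> x = 0"
  by (metis invertible_det_nz invertible_left_inverse matrix_left_invertible_ker)

definition emb_matrix :: "('a::number_field emb \<Rightarrow> 'a) \<Rightarrow> complex^'a emb^'a emb" where
  "emb_matrix b = (\<chi> j \<sigma>. Rep_emb \<sigma> (b j))"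

text \<open>A kernel vector is a linear relation between the embeddings that holds on the
  \<open>b j\<close>, hence on the whole field, and embeddings are independent.\<close>

lemma det_emb_matrix_spanning:
  fixes b :: "'a::number_field emb \<Rightarrow> 'a"
  assumes span: "\<And>x. \<exists>q. x = (\<Sum>j\<in>UNIV. of_rat (q j) * b j)"
  shows "Determinants.det (emb_matrix b) \<noteq> 0"
proof -
  have "c = 0" if c: "emb_matrix b *v c = 0" for c
  proof -
    have cb: "(\<Sum>\<sigma>\<in>UNIV. c $ \<sigma> * Rep_emb \<sigma> (b j)) = 0" for j
      using arg_cong[OF c, of "\<lambda>v. v $ j"]
      by (simp add: matrix_vector_mult_def emb_matrix_def mult.commute)
    have "(\<Sum>\<sigma>\<in>embeddings. c $ Abs_emb \<sigma> * \<sigma> x) = 0" for x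
    proof -
      obtain q where q: "x = (\<Sum>j\<in>UNIV. of_rat (q j) * b j)" using span by blast
      have "(\<Sum>\<sigma>\<in>embeddings. c $ Abs_emb \<sigma> * \<sigma> x) = (\<Sum>\<sigma>\<in>UNIV. \<Sum>j\<in>UNIV. of_rat (q j) * (c $ \<sigma> * Rep_emb \<sigma> (b j)))"
        unfolding sum_embeddings q Rep_emb_rat_sum
        by (simp add: Rep_emb_inverse sum_distrib_left mult_ac)
      also have "\<dots> = (\<Sum>j\<in>UNIV. of_rat (q j) * (\<Sum>\<sigma>\<in>UNIV. c $ \<sigma> * Rep_emb \<sigma> (b j)))"
        by (subst sum.swap) (simp add: sum_distrib_left)
      finally show ?thesis by (simp add: cb)
    qed
    then have "c $ Abs_emb \<sigma> = 0" if "\<sigma> \<in> embeddings" for \<sigma>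
      using embeddings_independent[OF card_embeddings(1) subset_refl _ that, of "\<lambda>\<sigma>. c $ Abs_emb \<sigma>"] by simp
    then have "c $ \<sigma> = 0" for \<sigma> using Rep_emb[of \<sigma>] by (metis Rep_emb_inverse)
    then show "c = 0" by (simp add: vec_eq_iff)
  qed
  then show ?thesis
    using matrix_left_invertible_ker[of "emb_matrix b"] by (auto simp: invertible_det_nz[symmetric] invertible_left_inverse)
qed

text \<open>Applying all embeddings to a rational relation gives a kernel vector of the transposed
  matrix, so the \<open>b j\<close> are independent. There are as many of them as the degree, so
  they also span.\<close>

lemma spanning_of_det_emb_matrix:
  fixes b :: "'a::number_field emb \<Rightarrow> 'a"
  assumes det: "Determinants.det (emb_matrix b) \<noteq> 0"
  shows "\<exists>q. x = (\<Sum>j\<in>UNIV. of_rat (q j) * b j)"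
    and "(\<Sum>j\<in>UNIV. of_rat (q j) * b j) = 0 \<Longrightarrow> q j = 0"
proof -
  have indep: "q j = 0" if q: "(\<Sum>j\<in>UNIV. of_rat (q j) * b j) = 0" for q j
  proof -
    define c :: "complex^'a emb" where "c = (\<chi> j. of_rat (q j))"
    have "(transpose (emb_matrix b) *v c) $ \<sigma> = 0" for \<sigma>
      using arg_cong[OF q, of "Rep_emb \<sigma>"] unfolding Rep_emb_rat_sum
      by (simp add: matrix_vector_mult_def emb_matrix_def c_def transpose_def mult.commute)
    then have "transpose (emb_matrix b) *v c = 0" by (simp add: vec_eq_iff)
    moreover have "Determinants.det (transpose (emb_matrix b)) \<noteq> 0"
      using det by (simp add: Determinants.det_transpose)
    ultimately have "c = 0" by (rule det_nz_imp_ker_trivial[rotated])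
    then have "c $ j = 0" by simp
    then show ?thesis by (simp add: c_def)
  qed
  then show "(\<Sum>j\<in>UNIV. of_rat (q j) * b j) = 0 \<Longrightarrow> q j = 0" .
  have inj: "inj b"
  proof (rule injI, rule ccontr)
    fix i j assume ij: "b i = b j" "i \<noteq> j"
    define q :: "'a emb \<Rightarrow> rat" where "q k = (if k = i then 1 else if k = j then -1 else 0)" for k
    have "(\<Sum>k\<in>UNIV. of_rat (q k) * b k) = (\<Sum>k\<in>UNIV. (if k = i then b i else 0) - (if k = j then b j else 0))"
      using ij(2) by (intro sum.cong) (auto simp: q_def of_rat_minus)
    also have "\<dots> = 0" using ij(1) by (simp add: sum_subtractf)
    finally have "q i = 0" by (rule indep)
    then show False by (simp add: q_def)
  qed
  have ind: "rat_vs.independent (range b)"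
    unfolding rat_vs.independent_explicit_finite_subsets
  proof (intro allI impI ballI)
    fix S u v assume S: "S \<subseteq> range b" "finite S" "(\<Sum>v\<in>S. of_rat (u v) * v) = 0" "v \<in> S"
    obtain j where j: "v = b j" using S by auto
    define q where "q k = (if b k \<in> S then u (b k) else 0)" for k
    have "(\<Sum>k\<in>UNIV. of_rat (q k) * b k) = (\<Sum>v\<in>range b. of_rat (if v \<in> S then u v else 0) * v)"
      unfolding sum.reindex[OF inj] by (simp add: q_def)
    also have "\<dots> = (\<Sum>v\<in>S. of_rat (u v) * v)"
      using S by (intro sum.mono_neutral_cong_right) auto
    finally have "q j = 0" using S indep by simp
    then show "u v = 0" using S j by (simp add: q_def)
  qed
  obtain B :: "'a set" where B: "finite B" "card B = field_degree TYPE('a)"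
    "rat_vs.independent B" "rat_vs.span B = UNIV" by (rule rat_basis_exists)
  have cb: "card (range b) = field_degree TYPE('a)"
    using card_image[OF inj] by (simp add: card_emb)
  have "x \<in> rat_vs.span (range b)"
  proof (rule ccontr)
    assume x: "x \<notin> rat_vs.span (range b)"
    then have "x \<notin> range b" by (rule contrapos_nn[OF _ rat_vs.span_base])
    have "rat_vs.independent (insert x (range b))" by (rule rat_vs.independent_insertI[OF x ind])
    then have "card (insert x (range b)) \<le> card B"
      using rat_vs.independent_span_bound[OF B(1)] B(4) by auto
    then show False using \<open>x \<notin> range b\<close> B(2) cb by simp
  qed
  then obtain u where "x = (\<Sum>v\<in>range b. of_rat (u v) * v)"
    using rat_vs.span_finite[of "range b"] by auto
  then have "x = (\<Sum>j\<in>UNIV. of_rat (u (b j)) * b j)"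
    unfolding sum.reindex[OF inj] by simp
  then show "\<exists>q. x = (\<Sum>j\<in>UNIV. of_rat (q j) * b j)" by (rule exI[where x = "\<lambda>j. u (b j)"])
qed

lemma rat_basis_emb:
  obtains b :: "'a::number_field emb \<Rightarrow> 'a" where "\<forall>x. \<exists>q. x = (\<Sum>j\<in>UNIV. of_rat (q j) * b j)"
proof -
  obtain B :: "'a set" where B: "finite B" "card B = field_degree TYPE('a)"
    "rat_vs.independent B" "rat_vs.span B = UNIV" by (rule rat_basis_exists)
  have "card (UNIV :: 'a emb set) = card B" by (simp add: B(2) card_emb)
  then obtain b :: "'a emb \<Rightarrow> 'a" where b: "bij_betw b UNIV B"
    using finite_same_card_bij[of "UNIV :: 'a emb set" B] B(1) by auto
  show ?thesis
  proof (rule that[of b], rule allI)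
    fix x :: 'a
    have "x \<in> rat_vs.span B" using B(4) by simp
    then obtain u where "x = (\<Sum>v\<in>B. of_rat (u v) * v)" using rat_vs.span_finite[OF B(1)] by auto
    then show "\<exists>q. x = (\<Sum>j\<in>UNIV. of_rat (q j) * b j)"
      using sum.reindex_bij_betw[OF b, of "\<lambda>v. of_rat (u v) * v"] by metis
  qed
qed

section \<open>Traces and norms as rational numbers and integers\<close>

lemma det_Rats: "(\<And>i j. A $ i $ j \<in> \<rat>) \<Longrightarrow> Determinants.det (A :: 'c::field_char_0^'n^'n) \<in> \<rat>"
  unfolding Determinants.det_def by (intro Rats_sum Rats_mult Rats_prod) auto

lemma det_Ints: "(\<And>i j. A $ i $ j \<in> \<int>) \<Longrightarrow> Determinants.det (A :: 'c::comm_ring_1^'n^'n) \<in> \<int>"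
  unfolding Determinants.det_def by (intro Ints_sum Ints_mult Ints_prod) auto

text \<open>The embeddings diagonalise multiplication by \<open>x\<close>: its rational matrix
  \<open>M\<close> satisfies \<open>M W = W D\<close> with \<open>D\<close> the diagonal matrix of
  conjugates, so trace and determinant of \<open>M\<close> are the sum and product of the
  conjugates.\<close>

lemma trace_norm_Rats:
  fixes x :: "'a::number_field"
  shows "(\<Sum>\<sigma>\<in>UNIV. Rep_emb (\<sigma> :: 'a emb) x) \<in> \<rat>" "(\<Prod>\<sigma>\<in>UNIV. Rep_emb (\<sigma> :: 'a emb) x) \<in> \<rat>"
proof -
  obtain b :: "'a emb \<Rightarrow> 'a" where b: "\<forall>x. \<exists>q. x = (\<Sum>j\<in>UNIV. of_rat (q j) * b j)"
    by (rule rat_basis_emb)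
  then have "\<forall>i. \<exists>q. x * b i = (\<Sum>j\<in>UNIV. of_rat (q j) * b j)" by blast
  then obtain q where q: "\<And>i. x * b i = (\<Sum>j\<in>UNIV. of_rat (q i j) * b j)" by metis
  define W where "W = emb_matrix b"
  define M :: "complex^'a emb^'a emb" where "M = (\<chi> i j. of_rat (q i j))"
  define D :: "complex^'a emb^'a emb" where "D = (\<chi> \<sigma> \<tau>. if \<sigma> = \<tau> then Rep_emb \<sigma> x else 0)"
  have W: "Determinants.det W \<noteq> 0" unfolding W_def by (rule det_emb_matrix_spanning[OF b[rule_format]])
  have "(M ** W) $ i $ \<sigma> = (W ** D) $ i $ \<sigma>" for i \<sigma>
  proof -
    have "(M ** W) $ i $ \<sigma> = Rep_emb \<sigma> (x * b i)"
      unfolding q Rep_emb_rat_sum by (simp add: matrix_matrix_mult_def M_def W_def emb_matrix_def)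
    also have "\<dots> = (\<Sum>\<tau>\<in>UNIV. if \<tau> = \<sigma> then Rep_emb \<sigma> (b i) * Rep_emb \<sigma> x else 0)"
      by (simp add: mult.commute)
    also have "\<dots> = (W ** D) $ i $ \<sigma>"
      by (simp add: matrix_matrix_mult_def D_def W_def emb_matrix_def if_distrib[of "\<lambda>y. _ * y"] cong: if_cong)
    finally show ?thesis .
  qed
  then have MW: "M ** W = W ** D" by (simp add: vec_eq_iff)
  have detD: "Determinants.det D = (\<Prod>\<sigma>\<in>UNIV. Rep_emb \<sigma> x)"
    by (subst Determinants.det_diagonal) (auto simp: D_def)
  have "Determinants.det M * Determinants.det W = Determinants.det W * Determinants.det D"
    using arg_cong[OF MW, of Determinants.det] by (simp add: Determinants.det_mul)
  then have "Determinants.det M = (\<Prod>\<sigma>\<in>UNIV. Rep_emb \<sigma> x)" using W detD by simp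
  moreover have "Determinants.det M \<in> \<rat>" by (rule det_Rats) (simp add: M_def)
  ultimately show "(\<Prod>\<sigma>\<in>UNIV. Rep_emb (\<sigma> :: 'a emb) x) \<in> \<rat>" by simp
  obtain V where V: "W ** V = mat 1" "V ** W = mat 1"
    using W by (auto simp: invertible_det_nz[symmetric] invertible_def)
  have "Determinants.trace M = Determinants.trace (M ** (W ** V))" by (simp add: V)
  also have "\<dots> = Determinants.trace (W ** (D ** V))" by (simp add: matrix_mul_assoc MW)
  also have "\<dots> = Determinants.trace (D ** V ** W)" by (rule trace_mul_sym)
  also have "\<dots> = Determinants.trace D" by (simp add: matrix_mul_assoc[symmetric] V)
  finally have "(\<Sum>\<sigma>\<in>UNIV. Rep_emb (\<sigma> :: 'a emb) x) = (\<Sum>i\<in>UNIV. of_rat (q i i))"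
    by (simp add: Determinants.trace_def D_def M_def)
  also have "\<dots> \<in> \<rat>" by (intro Rats_sum) auto
  finally show "(\<Sum>\<sigma>\<in>UNIV. Rep_emb (\<sigma> :: 'a emb) x) \<in> \<rat>" .
qed

text \<open>An embedding fixes integers, so the image satisfies the same integral relation; its
  powers form an eigenvector of the companion matrix.\<close>

lemma algebraic_int_Rep_emb:
  assumes "algebraic_int x"
  shows "algebraic_int (Rep_emb \<sigma> x)"
proof -
  obtain p a where p: "p > 0" "x ^ p = (\<Sum>i<p. of_int (a i) * x ^ i)"
    using algebraic_int_power_reduce[OF assms] .
  have "Rep_emb \<sigma> x ^ p = (\<Sum>i<p. of_int (a i) * Rep_emb \<sigma> x ^ i)"
    using arg_cong[OF p(2), of "Rep_emb \<sigma>"] by (simp add: Rep_emb_int_sum)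
  then have top: "Rep_emb \<sigma> x * Rep_emb \<sigma> x ^ i = (\<Sum>j<p. of_int (a j) * Rep_emb \<sigma> x ^ j)" if "Suc i = p" for i
    using that by (metis power_Suc)
  have low: "Rep_emb \<sigma> x * Rep_emb \<sigma> x ^ i = (\<Sum>j<p. of_int (if j = Suc i then 1 else 0) * Rep_emb \<sigma> x ^ j)"
    if "Suc i < p" for i
  proof -
    have "(\<Sum>j<p. of_int (if j = Suc i then 1 else 0) * Rep_emb \<sigma> x ^ j) =
        (\<Sum>j<p. if j = Suc i then Rep_emb \<sigma> x ^ j else 0)" by (intro sum.cong) auto
    then show ?thesis using that by simp
  qed
  show ?thesis
  proof (rule algebraic_int_eigenvalue[where n = p and b = "\<lambda>i. Rep_emb \<sigma> x ^ i" and
          c = "\<lambda>i j. if Suc i < p then (if j = Suc i then 1 else 0) else a j"])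
    fix i assume "i < p"
    then consider "Suc i < p" | "Suc i = p" by linarith
    then show "Rep_emb \<sigma> x * Rep_emb \<sigma> x ^ i = (\<Sum>j<p. of_int (if Suc i < p then (if j = Suc i then 1 else 0)
        else a j) * Rep_emb \<sigma> x ^ j)"
      using low top by cases (simp_all del: of_int_1 of_int_0)
  next
    show "\<exists>i<p. Rep_emb \<sigma> x ^ i \<noteq> 0" using p(1) by (intro exI[of _ 0]) simp
  qed
qed

lemma trace_norm_Ints:
  fixes x :: "'a::number_field"
  assumes "algebraic_int x"
  shows "(\<Sum>\<sigma>\<in>UNIV. Rep_emb (\<sigma> :: 'a emb) x) \<in> \<int>" "(\<Prod>\<sigma>\<in>UNIV. Rep_emb (\<sigma> :: 'a emb) x) \<in> \<int>"
  by (intro rational_algebraic_int_is_int trace_norm_Rats algebraic_int_sum algebraic_int_prod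
      algebraic_int_Rep_emb assms)+

text \<open>The square is the determinant of the matrix of traces of
  \<open>b i * b j\<close>.\<close>

lemma det_emb_matrix_sqr_Ints:
  assumes "\<And>j. algebraic_int (b j)"
  shows "(Determinants.det (emb_matrix b))\<^sup>2 \<in> \<int>"
proof -
  have "(Determinants.det (emb_matrix b))\<^sup>2 = Determinants.det (emb_matrix b ** transpose (emb_matrix b))"
    by (simp add: Determinants.det_mul Determinants.det_transpose power2_eq_square)
  also have "\<dots> \<in> \<int>"
  proof (rule det_Ints)
    fix i j
    have "(emb_matrix b ** transpose (emb_matrix b)) $ i $ j = (\<Sum>\<sigma>\<in>UNIV. Rep_emb \<sigma> (b i * b j))"
      by (simp add: matrix_matrix_mult_def emb_matrix_def transpose_def)
    also have "\<dots> \<in> \<int>" by (intro trace_norm_Ints algebraic_int_add_mult assms)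
    finally show "(emb_matrix b ** transpose (emb_matrix b)) $ i $ j \<in> \<int>" .
  qed
  finally show ?thesis .
qed

text \<open>An integral basis is an integral tuple with the least nonzero determinant: reducing one
  coordinate modulo 1 would make the determinant smaller.\<close>

lemma integral_emb_basis_exists:
  obtains b :: "'a::number_field emb \<Rightarrow> 'a" where "Determinants.det (emb_matrix b) \<noteq> 0"
    "ring_of_integers = {\<Sum>j\<in>UNIV. of_int (c j) * b j | c. True}"
proof -
  define P where "P b \<longleftrightarrow> (\<forall>j. algebraic_int (b j)) \<and> Determinants.det (emb_matrix b) \<noteq> 0"
    for b :: "'a emb \<Rightarrow> 'a"
  \<comment> \<open>The floor loses nothing on integral tuples, where the squared modulus is an
    integer; it only makes this a natural number that can be minimised.\<close>
  define m where "m b = nat \<lfloor>(cmod (Determinants.det (emb_matrix b)))\<^sup>2\<rfloor>" for b :: "'a emb \<Rightarrow> 'a"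
  have m: "real (m b) = (cmod (Determinants.det (emb_matrix b)))\<^sup>2" if "P b" for b
  proof -
    have "(Determinants.det (emb_matrix b))\<^sup>2 \<in> \<int>"
      using that by (intro det_emb_matrix_sqr_Ints) (auto simp: P_def)
    then obtain k where "(Determinants.det (emb_matrix b))\<^sup>2 = of_int k" by (auto elim: Ints_cases)
    then have "(cmod (Determinants.det (emb_matrix b)))\<^sup>2 = \<bar>of_int k\<bar>"
      by (metis norm_of_int norm_power)
    then show ?thesis by (simp add: m_def)
  qed
  obtain b0 :: "'a emb \<Rightarrow> 'a" where b0: "\<forall>x. \<exists>q. x = (\<Sum>j\<in>UNIV. of_rat (q j) * b0 j)"
    by (rule rat_basis_emb)
  have "\<forall>j. \<exists>k::int. k \<noteq> 0 \<and> algebraic_int (of_int k * b0 j)"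
    using algebraic_int_multiple[OF algebraic_number_field] by metis
  then obtain d :: "'a emb \<Rightarrow> int" where d: "\<And>j. d j \<noteq> 0" "\<And>j. algebraic_int (of_int (d j) * b0 j)"
    by metis
  have "P (\<lambda>j. of_int (d j) * b0 j)"
    unfolding P_def
  proof (intro conjI allI d det_emb_matrix_spanning)
    fix x :: 'a
    obtain q where "x = (\<Sum>j\<in>UNIV. of_rat (q j) * b0 j)" using b0 by blast
    also have "\<dots> = (\<Sum>j\<in>UNIV. of_rat (q j / of_int (d j)) * (of_int (d j) * b0 j))"
      using d(1) by (intro sum.cong) (auto simp: of_rat_divide)
    finally show "\<exists>q. x = (\<Sum>j\<in>UNIV. of_rat (q j) * (of_int (d j) * b0 j))"
      by (rule exI[where x = "\<lambda>j. q j / of_int (d j)"])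
  qed
  then obtain b where b: "P b" and min: "\<And>b'. P b' \<Longrightarrow> m b \<le> m b'"
    using ex_has_least_nat[of P _ m] by blast
  have det: "Determinants.det (emb_matrix b) \<noteq> 0" using b by (simp add: P_def)
  have "ring_of_integers = {\<Sum>j\<in>UNIV. of_int (c j) * b j | c. True}"
  proof (intro equalityI subsetI)
    fix x assume "x \<in> {\<Sum>j\<in>UNIV. of_int (c j) * b j | c. True}"
    then obtain c where x: "x = (\<Sum>j\<in>UNIV. of_int (c j) * b j)" by blast
    show "x \<in> ring_of_integers"
      unfolding ring_of_integers_def x mem_Collect_eq
      using b by (intro algebraic_int_sum algebraic_int_add_mult) (auto simp: P_def int_imp_algebraic_int)
  next
    fix x :: 'a assume "x \<in> ring_of_integers"
    then have x: "algebraic_int x" by (simp add: ring_of_integers_def)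
    obtain q where q: "x = (\<Sum>j\<in>UNIV. of_rat (q j) * b j)"
      using spanning_of_det_emb_matrix(1)[OF det] by blast
    have "q k \<in> \<int>" for k
    proof (rule ccontr)
      assume "q k \<notin> \<int>"
      then have fr: "frac (q k) > 0" "frac (q k) < 1" by (auto simp: frac_gt_0_iff frac_lt_1)
      define q' where "q' = q(k := frac (q k))"
      define b' where "b' = b(k := x - of_int \<lfloor>q k\<rfloor> * b k)"
      have "b' k = (\<Sum>j\<in>UNIV. of_rat (q j) * b j - (if j = k then of_int \<lfloor>q k\<rfloor> * b k else 0))"
        by (simp add: b'_def q sum_subtractf)
      also have "\<dots> = (\<Sum>j\<in>UNIV. of_rat (q' j) * b j)"
        by (intro sum.cong) (auto simp: q'_def frac_def of_rat_diff algebra_simps)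
      finally have b'k: "b' k = (\<Sum>j\<in>UNIV. of_rat (q' j) * b j)" .
      \<comment> \<open>Row \<open>k\<close> is replaced by the combination of rows with
        coefficients \<open>q'\<close>. By Cramer's rule the determinant is multiplied by the
        fractional part of \<open>q k\<close>, which lies strictly between 0 and 1.\<close>
      have "emb_matrix b' = (\<chi> i. if i = k then (\<Sum>j\<in>UNIV. (\<chi> j. of_rat (q' j)) $ j *s row j (emb_matrix b))
          else row i (emb_matrix b))"
        using b'k by (auto simp: vec_eq_iff emb_matrix_def row_def Rep_emb_rat_sum b'_def)
      then have "Determinants.det (emb_matrix b') = of_rat (q' k) * Determinants.det (emb_matrix b)"
        by (simp add: cramer_lemma_transpose)
      then have det': "Determinants.det (emb_matrix b') = of_rat (frac (q k)) * Determinants.det (emb_matrix b)"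
        by (simp add: q'_def)
      have "algebraic_int (b' j)" for j
        using b x unfolding b'_def P_def
        by (auto simp: diff_conv_add_uminus int_imp_algebraic_int simp del: add_uminus_conv_diff
            intro!: algebraic_int_add_mult)
      moreover have "Determinants.det (emb_matrix b') \<noteq> 0" using det det' fr by simp
      ultimately have "P b'" by (simp add: P_def)
      have nrm: "cmod (of_rat r) = \<bar>of_rat r\<bar>" for r
      proof -
        obtain u v where "r = of_int u / of_int v" "v > 0"
          by (metis quotient_of_denom_pos quotient_of_div surj_pair)
        then show ?thesis by (simp add: of_rat_divide norm_divide)
      qed
      define t :: real where "t = of_rat (frac (q k))"
      have "0 < t" "t < 1" using fr by (simp_all add: t_def)
      then have "\<bar>t\<bar>\<^sup>2 < 1" by (simp add: power_less_one_iff)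
      then have "real (m b') < real (m b)"
        unfolding m[OF b] m[OF \<open>P b'\<close>] det' norm_mult power_mult_distrib nrm t_def[symmetric]
        using det by simp
      then show False using min[OF \<open>P b'\<close>] by simp
    qed
    then have "\<forall>k. \<exists>z. q k = of_int z" by (auto elim: Ints_cases)
    then obtain c where "\<And>k. q k = of_int (c k)" by metis
    then show "x \<in> {\<Sum>j\<in>UNIV. of_int (c j) * b j | c. True}" using q by auto
  qed
  with det show ?thesis by (rule that)
qed

text \<open>The determinant of this basis is the one that enters the discriminant.\<close>

lemma discriminant_basis:
  obtains b :: "'a::number_field emb \<Rightarrow> 'a" where "Determinants.det (emb_matrix b) \<noteq> 0"
    "ring_of_integers = {\<Sum>j\<in>UNIV. of_int (c j) * b j | c. True}"
    "sqrt (cmod (discriminant TYPE('a))) = cmod (Determinants.det (emb_matrix b))"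
proof -
  define n where "n = field_degree TYPE('a)"
  define \<omega> where "\<omega> = (SOME \<omega> :: nat \<Rightarrow> 'a. integral_basis \<omega>)"
  define \<sigma> where "\<sigma> = (SOME \<sigma> :: nat \<Rightarrow> 'a \<Rightarrow> complex. bij_betw \<sigma> {..<n} embeddings)"
  have "\<exists>\<sigma> :: nat \<Rightarrow> 'a \<Rightarrow> complex. bij_betw \<sigma> {..<n} embeddings"
    using ex_bij_betw_nat_finite[OF card_embeddings(1)] by (simp add: card_embeddings n_def lessThan_atLeast0)
  then have \<sigma>: "bij_betw \<sigma> {..<n} embeddings" unfolding \<sigma>_def by (rule someI_ex)
  define e where "e = Abs_emb \<circ> \<sigma>"
  have "bij_betw Abs_emb (embeddings :: ('a \<Rightarrow> complex) set) UNIV"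
    by (rule bij_betw_byWitness[where f' = Rep_emb])
      (auto simp: Rep_emb Abs_emb_inverse Rep_emb_inverse)
  then have e: "bij_betw e {..<n} UNIV" unfolding e_def by (rule bij_betw_trans[OF \<sigma>])
  have Rep_e: "Rep_emb (e i) = \<sigma> i" if "i < n" for i
    using bij_betwE[OF \<sigma>] that by (simp add: e_def Abs_emb_inverse)
  have sum_e: "(\<Sum>i<n. f (e i)) = sum f UNIV" for f :: "'a emb \<Rightarrow> 'a"
    by (rule sum.reindex_bij_betw[OF e])
  \<comment> \<open>The tuple \<open>b0\<close> shows that integral bases exist, so that the choice
    \<open>\<omega>\<close> inside the discriminant is one. The final \<open>b\<close> is
    \<open>\<omega>\<close> itself, reindexed along \<open>e\<close>.\<close>
  obtain b0 :: "'a emb \<Rightarrow> 'a" where b0: "Determinants.det (emb_matrix b0) \<noteq> 0"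
    "ring_of_integers = {\<Sum>j\<in>UNIV. of_int (c j) * b0 j | c. True}"
    by (rule integral_emb_basis_exists)
  have cv: "\<exists>c'. (\<Sum>j\<in>UNIV. of_int (c j) * b j) = (\<Sum>i<n. of_int (c' i) * b (e i))" for c and b :: "'a emb \<Rightarrow> 'a"
    using sum_e[of "\<lambda>j. of_int (c j) * b j"] by (intro exI[of _ "c \<circ> e"]) simp
  have cv': "(\<Sum>i<n. of_int (c i) * b (e i)) = (\<Sum>j\<in>UNIV. of_int (c (inv_into {..<n} e j)) * b j)"
    for c and b :: "'a emb \<Rightarrow> 'a"
    unfolding sum_e[symmetric] using e by (intro sum.cong) (auto simp: bij_betw_def)
  have coords: "{\<Sum>j\<in>UNIV. of_int (c j) * b j | c. True} = {\<Sum>i<n. of_int (c i) * b (e i) | c. True}"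
    for b :: "'a emb \<Rightarrow> 'a"
  proof (intro equalityI subsetI)
    fix x assume "x \<in> {\<Sum>j\<in>UNIV. of_int (c j) * b j | c. True}"
    then obtain c where "x = (\<Sum>j\<in>UNIV. of_int (c j) * b j)" by blast
    then show "x \<in> {\<Sum>i<n. of_int (c i) * b (e i) | c. True}" using cv[of c b] by simp
  next
    fix x assume "x \<in> {\<Sum>i<n. of_int (c i) * b (e i) | c. True}"
    then obtain c where "x = (\<Sum>i<n. of_int (c i) * b (e i))" by blast
    then show "x \<in> {\<Sum>j\<in>UNIV. of_int (c j) * b j | c. True}"
      unfolding cv' by (intro CollectI exI[of _ "\<lambda>j. c (inv_into {..<n} e j)"]) simp
  qed
  have "integral_basis (\<lambda>i. b0 (e i))"
    unfolding integral_basis_def n_def[symmetric]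
  proof (intro conjI allI impI)
    show "ring_of_integers = {\<Sum>i<n. of_int (c i) * b0 (e i) | c. True}"
      unfolding b0(2) by (rule coords)
    fix c i assume c: "(\<Sum>i<n. of_int (c i) * b0 (e i)) = 0" and i: "i < n"
    have "(\<Sum>j\<in>UNIV. of_rat (of_int (c (inv_into {..<n} e j))) * b0 j) = 0"
      using c unfolding cv' by simp
    from spanning_of_det_emb_matrix(2)[OF b0(1) this, of "e i"] show "c i = 0"
      using e i by (simp add: bij_betw_def)
  qed
  then have \<omega>: "integral_basis \<omega>" unfolding \<omega>_def by (rule someI[where P = integral_basis])
  define b where "b j = \<omega> (inv_into {..<n} e j)" for j
  have be: "b (e i) = \<omega> i" if "i < n" for i using e that by (simp add: b_def bij_betw_def)
  have O: "ring_of_integers = {\<Sum>j\<in>UNIV. of_int (c j) * b j | c. True}"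
  proof -
    have "ring_of_integers = {\<Sum>i<n. of_int (c i) * b (e i) | c. True}"
      using \<omega> be unfolding integral_basis_def n_def[symmetric] by simp
    then show ?thesis by (simp only: coords)
  qed
  \<comment> \<open>Every element has a nonzero integer multiple in the ring of integers, so
    integral coordinates yield rational ones for the whole field.\<close>
  have "Determinants.det (emb_matrix b) \<noteq> 0"
  proof (rule det_emb_matrix_spanning)
    fix x :: 'a
    obtain k :: int where k: "k \<noteq> 0" "algebraic_int (of_int k * x)"
      using algebraic_int_multiple[OF algebraic_number_field] by blast
    then have "of_int k * x \<in> {\<Sum>j\<in>UNIV. of_int (c j) * b j | c. True}"
      unfolding O[symmetric] by (simp add: ring_of_integers_def)
    then obtain c where c: "of_int k * x = (\<Sum>j\<in>UNIV. of_int (c j) * b j)" by blast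
    have "x = of_int k * x / of_int k" using k by simp
    also have "\<dots> = (\<Sum>j\<in>UNIV. of_rat (of_int (c j) / of_int k) * b j)"
      unfolding c sum_divide_distrib by (simp add: of_rat_divide)
    finally show "\<exists>q. x = (\<Sum>j\<in>UNIV. of_rat (q j) * b j)"
      by (rule exI[where x = "\<lambda>j. of_int (c j) / of_int k"])
  qed
  moreover have "sqrt (cmod (discriminant TYPE('a))) = cmod (Determinants.det (emb_matrix b))"
  proof -
    have "Determinant.det (Matrix.mat n n (\<lambda>(i, j). \<sigma> i (\<omega> j))) =
        Determinant.det (Matrix.mat n n (\<lambda>(i, j). transpose (emb_matrix b) $ e i $ e j))"
      by (intro arg_cong[of _ _ Determinant.det] eq_matI)
        (auto simp: transpose_def emb_matrix_def Rep_e be)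
    also have "\<dots> = Determinants.det (emb_matrix b)"
      by (simp add: det_mat_eq_det[OF e] Determinants.det_transpose)
    finally have "discriminant TYPE('a) = (Determinants.det (emb_matrix b))\<^sup>2"
      unfolding discriminant_def Let_def n_def[symmetric] \<omega>_def[symmetric] \<sigma>_def[symmetric] by simp
    then show ?thesis by (simp add: norm_power)
  qed
  ultimately show ?thesis using O by (intro that)
qed

section \<open>Volumes\<close>

lemma Basis_real_vec: "(Basis :: (real^'n) set) = range (\<lambda>i. axis i 1)"
  by (auto simp: Basis_vec_def)

lemma prod_Basis_real_vec: "(\<Prod>b\<in>Basis. (x :: real^'n) \<bullet> b) = (\<Prod>i\<in>UNIV. x $ i)"
proof -
  have inj: "inj (\<lambda>i :: 'n. axis i (1::real))" by (auto simp: inj_on_def axis_eq_axis)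
  show ?thesis unfolding Basis_real_vec prod.reindex[OF inj] by (simp add: inner_axis)
qed

text \<open>The coordinates \<open>r p\<close> for \<open>p \<in> K\<close> and \<open>s p\<close> for \<open>p \<in> C\<close> exhaust the index type; those at
  \<open>p \<in> C\<close> are the real and imaginary part of one complex coordinate.\<close>

lemma emeasure_polydisc:
  fixes r s :: "'p \<Rightarrow> 'n::finite" and c :: "'p \<Rightarrow> real"
  assumes K: "finite K" "C \<subseteq> K" and inj: "inj_on r K" "inj_on s C"
    and part: "r ` K \<inter> s ` C = {}" "r ` K \<union> s ` C = UNIV"
    and c: "\<And>p. p \<in> K \<Longrightarrow> c p > 0"
  defines "S \<equiv> {y :: real^'n. (\<forall>p\<in>K - C. \<bar>y $ r p\<bar> < c p) \<and> (\<forall>p\<in>C. (y $ r p)\<^sup>2 + (y $ s p)\<^sup>2 < (c p)\<^sup>2)}"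
  shows "S \<in> sets borel" "emeasure lborel S = ennreal ((\<Prod>p\<in>K - C. 2 * c p) * (\<Prod>p\<in>C. pi * (c p)\<^sup>2))"
proof -
  \<comment> \<open>A real prime gets Lebesgue measure on the real axis inside the complex plane.
    All factors then live on one type, as \<open>PiM\<close> requires.\<close>
  define M :: "'p \<Rightarrow> complex measure" where
    "M p = (if p \<in> C then lborel else distr (lborel :: real measure) borel complex_of_real)" for p
  have sets_M [measurable_cong, simp]: "sets (M p) = sets borel" for p by (simp add: M_def)
  have space_M [simp]: "space (M p) = UNIV" for p by (simp add: M_def)
  have em_real: "emeasure (M p) A = emeasure lborel (complex_of_real -` A)" if "p \<notin> C" "A \<in> sets borel" for p A
    using that by (simp add: M_def emeasure_distr)
  have sf: "sigma_finite_measure (M p)" for p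
  proof (cases "p \<in> C")
    case True
    then show ?thesis using lborel.sigma_finite_measure_axioms by (simp add: M_def)
  next
    case False
    have "(\<Union>n::nat. ball (0::complex) (real n)) = UNIV"
      by (auto simp: reals_Archimedean2)
    moreover have "emeasure (M p) (ball 0 (real n)) \<noteq> \<infinity>" for n
    proof -
      have "complex_of_real -` ball 0 (real n) = ball 0 (real n)" by auto
      then show ?thesis using em_real[OF False, of "ball 0 (real n)"] emeasure_lborel_ball_finite[of "0::real" "real n"]
        by auto
    qed
    ultimately show ?thesis
      by (intro sigma_finite_measure.intro exI[of _ "range (\<lambda>n::nat. ball 0 (real n))"]) auto
  qed
  interpret product_sigma_finite M by (rule product_sigma_finite.intro) (rule sf)
  define \<Phi> :: "('p \<Rightarrow> complex) \<Rightarrow> real^'n" where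
    "\<Phi> z = (\<chi> i. if i \<in> r ` K then Re (z (inv_into K r i)) else Im (z (inv_into C s i)))" for z
  have \<Phi>r: "\<Phi> z $ r p = Re (z p)" if "p \<in> K" for z p
    using that inj by (simp add: \<Phi>_def)
  have \<Phi>s: "\<Phi> z $ s p = Im (z p)" if "p \<in> C" for z p
    using that inj part(1) by (auto simp: \<Phi>_def)
  have all: "(\<forall>i. P i) \<longleftrightarrow> (\<forall>p\<in>K. P (r p)) \<and> (\<forall>p\<in>C. P (s p))" for P
    using part(2) by (metis UNIV_I UnE imageE)
  have meas: "\<Phi> \<in> measurable (PiM K M) borel"
    unfolding borel_measurable_euclidean_space[of \<Phi>] Basis_real_vec
  proof safe
    fix i
    show "(\<lambda>z. \<Phi> z \<bullet> axis i 1) \<in> borel_measurable (Pi\<^sub>M K M)"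
    proof (cases "i \<in> r ` K")
      case True
      then obtain p where p: "p \<in> K" "i = r p" by auto
      have [measurable]: "(\<lambda>z. z p) \<in> measurable (PiM K M) borel"
        using measurable_component_singleton[OF p(1), of M] measurable_cong_sets[OF refl sets_M] by blast
      show ?thesis by (simp add: inner_axis p \<Phi>r)
    next
      case False
      then obtain p where p: "p \<in> C" "i = s p" using part(2) by blast
      have [measurable]: "(\<lambda>z. z p) \<in> measurable (PiM K M) borel"
        using measurable_component_singleton[of p K M] p K measurable_cong_sets[OF refl sets_M] by blast
      show ?thesis by (simp add: inner_axis p \<Phi>s)
    qed
  qed
  have vol: "emeasure (distr (PiM K M) borel \<Phi>) T = (\<Prod>p\<in>K - C. emeasure lborel (complex_of_real -` B p)) *
      (\<Prod>p\<in>C. emeasure lborel (B p))"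
    if T: "T \<in> sets borel" and B: "\<And>p. p \<in> K \<Longrightarrow> B p \<in> sets borel"
      and mem: "\<And>z. \<Phi> z \<in> T \<longleftrightarrow> (\<forall>p\<in>K. z p \<in> B p)" for T B
  proof -
    have "\<Phi> -` T \<inter> space (PiM K M) = Pi\<^sub>E K B"
      using mem by (auto simp: space_PiM PiE_def Pi_def)
    then have "emeasure (distr (PiM K M) borel \<Phi>) T = (\<Prod>p\<in>K. emeasure (M p) (B p))"
      using T meas B K(1) by (simp add: emeasure_distr emeasure_PiM)
    also have "\<dots> = (\<Prod>p\<in>K - C. emeasure (M p) (B p)) * (\<Prod>p\<in>C. emeasure (M p) (B p))"
      using K by (intro prod.subset_diff) auto
    also have "(\<Prod>p\<in>K - C. emeasure (M p) (B p)) = (\<Prod>p\<in>K - C. emeasure lborel (complex_of_real -` B p))"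
      using B by (intro prod.cong) (auto simp: em_real)
    also have "(\<Prod>p\<in>C. emeasure (M p) (B p)) = (\<Prod>p\<in>C. emeasure lborel (B p))"
      by (intro prod.cong) (auto simp: M_def)
    finally show ?thesis .
  qed
  \<comment> \<open>Lebesgue measure is determined by its values on boxes, and a box pulls back
    under \<open>\<Phi>\<close> to a product of intervals and rectangles. In the same way
    \<open>S\<close> then pulls back to a product of intervals and discs.\<close>
  have lb: "lborel = distr (PiM K M) borel \<Phi>"
  proof (rule lborel_eqI)
    fix l u :: "real^'n" assume "\<And>b. b \<in> Basis \<Longrightarrow> l \<bullet> b \<le> u \<bullet> b"
    then have "l \<bullet> axis i 1 \<le> u \<bullet> axis i 1" for i by (simp add: Basis_real_vec)
    then have le: "l $ i \<le> u $ i" for i by (simp add: inner_axis)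
    define B where "B p = (if p \<in> C then box (Complex (l $ r p) (l $ s p)) (Complex (u $ r p) (u $ s p))
        else Re -` {l $ r p <..< u $ r p})" for p
    have "emeasure (distr (PiM K M) borel \<Phi>) (box l u) =
        (\<Prod>p\<in>K - C. emeasure lborel (complex_of_real -` B p)) * (\<Prod>p\<in>C. emeasure lborel (B p))"
    proof (rule vol)
      show "B p \<in> sets borel" for p
        unfolding B_def by (auto intro!: borel_open open_vimage continuous_intros)
      show "\<Phi> z \<in> box l u \<longleftrightarrow> (\<forall>p\<in>K. z p \<in> B p)" for z
        unfolding mem_box_cart all using K(2)
        by (auto simp: \<Phi>r \<Phi>s B_def in_box_complex_iff subset_iff)
    qed simp
    also have "(\<Prod>p\<in>K - C. emeasure lborel (complex_of_real -` B p)) = (\<Prod>p\<in>K - C. ennreal (u $ r p - l $ r p))"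
    proof (intro prod.cong refl)
      fix p assume "p \<in> K - C"
      then have "complex_of_real -` B p = {l $ r p <..< u $ r p}" by (auto simp: B_def)
      then show "emeasure lborel (complex_of_real -` B p) = ennreal (u $ r p - l $ r p)" using le by simp
    qed
    also have "(\<Prod>p\<in>C. emeasure lborel (B p)) = (\<Prod>p\<in>C. ennreal ((u $ r p - l $ r p) * (u $ s p - l $ s p)))"
    proof (intro prod.cong refl)
      fix p assume "p \<in> C"
      then show "emeasure lborel (B p) = ennreal ((u $ r p - l $ r p) * (u $ s p - l $ s p))"
        using le by (simp add: B_def emeasure_lborel_box_eq Basis_complex_def inner_complex_def)
    qed
    also have "(\<Prod>p\<in>K - C. ennreal (u $ r p - l $ r p)) * (\<Prod>p\<in>C. ennreal ((u $ r p - l $ r p) * (u $ s p - l $ s p))) =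
        ennreal ((\<Prod>p\<in>K - C. u $ r p - l $ r p) * (\<Prod>p\<in>C. (u $ r p - l $ r p) * (u $ s p - l $ s p)))"
      using le by (subst (1 2) prod_ennreal) (auto simp: ennreal_mult[symmetric] prod_nonneg)
    also have "(\<Prod>p\<in>K - C. u $ r p - l $ r p) * (\<Prod>p\<in>C. (u $ r p - l $ r p) * (u $ s p - l $ s p)) =
        (\<Prod>p\<in>K. u $ r p - l $ r p) * (\<Prod>p\<in>C. u $ s p - l $ s p)"
      unfolding prod.distrib using prod.subset_diff[OF K(2,1), of "\<lambda>p. u $ r p - l $ r p"] by (simp add: mult.assoc)
    also have "\<dots> = (\<Prod>i\<in>r ` K. (u - l) $ i) * (\<Prod>i\<in>s ` C. (u - l) $ i)"
      using inj by (simp add: prod.reindex)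
    also have "\<dots> = (\<Prod>i\<in>r ` K \<union> s ` C. (u - l) $ i)"
      using K part by (intro prod.union_disjoint[symmetric]) (auto dest: finite_subset)
    also have "\<dots> = (\<Prod>b\<in>Basis. (u - l) \<bullet> b)" by (simp only: part prod_Basis_real_vec)
    finally show "emeasure (distr (PiM K M) borel \<Phi>) (box l u) = ennreal (\<Prod>b\<in>Basis. (u - l) \<bullet> b)" .
  qed simp
  have op: "open S"
  proof -
    have "S = (\<Inter>p\<in>K - C. {y. \<bar>y $ r p\<bar> < c p}) \<inter> (\<Inter>p\<in>C. {y. (y $ r p)\<^sup>2 + (y $ s p)\<^sup>2 < (c p)\<^sup>2})"
      by (auto simp: S_def)
    then show ?thesis
      using K by (auto intro!: open_Int open_INT open_Collect_less continuous_intros dest: finite_subset)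
  qed
  then show S: "S \<in> sets borel" by simp
  define B where "B p = (if p \<in> C then ball 0 (c p) else Re -` {- c p <..< c p})" for p
  have "emeasure lborel S = (\<Prod>p\<in>K - C. emeasure lborel (complex_of_real -` B p)) * (\<Prod>p\<in>C. emeasure lborel (B p))"
    unfolding lb
  proof (rule vol[OF S])
    show "B p \<in> sets borel" for p
      unfolding B_def by (auto intro!: borel_open open_vimage continuous_intros)
    fix z
    have *: "z p \<in> B p \<longleftrightarrow> (Re (z p))\<^sup>2 + (Im (z p))\<^sup>2 < (c p)\<^sup>2" if "p \<in> C" for p
    proof -
      have "c p > 0" using that K c by auto
      then have "cmod (z p) < c p \<longleftrightarrow> (cmod (z p))\<^sup>2 < (c p)\<^sup>2" by (auto intro: power_strict_mono dest: power_less_imp_less_base)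
      then show ?thesis using that by (simp add: B_def cmod_power2)
    qed
    have **: "z p \<in> B p \<longleftrightarrow> \<bar>Re (z p)\<bar> < c p" if "p \<in> K - C" for p
      using that by (auto simp: B_def)
    show "\<Phi> z \<in> S \<longleftrightarrow> (\<forall>p\<in>K. z p \<in> B p)"
    proof -
      have "\<Phi> z \<in> S \<longleftrightarrow> (\<forall>p\<in>K - C. \<bar>Re (z p)\<bar> < c p) \<and> (\<forall>p\<in>C. (Re (z p))\<^sup>2 + (Im (z p))\<^sup>2 < (c p)\<^sup>2)"
        using K(2) by (auto simp: S_def \<Phi>r \<Phi>s subset_iff)
      also have "\<dots> \<longleftrightarrow> (\<forall>p\<in>K - C. z p \<in> B p) \<and> (\<forall>p\<in>C. z p \<in> B p)"
        by (simp add: * **)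
      finally show ?thesis using K(2) by blast
    qed
  qed
  also have "(\<Prod>p\<in>K - C. emeasure lborel (complex_of_real -` B p)) = (\<Prod>p\<in>K - C. ennreal (2 * c p))"
  proof (intro prod.cong refl)
    fix p assume p: "p \<in> K - C"
    then have "complex_of_real -` B p = {- c p <..< c p}" by (auto simp: B_def)
    then show "emeasure lborel (complex_of_real -` B p) = ennreal (2 * c p)" using c[of p] p by simp
  qed
  also have "(\<Prod>p\<in>C. emeasure lborel (B p)) = (\<Prod>p\<in>C. ennreal (pi * (c p)\<^sup>2))"
  proof (intro prod.cong refl)
    fix p assume p: "p \<in> C"
    then have "c p \<ge> 0" using c[of p] K by auto
    with p show "emeasure lborel (B p) = ennreal (pi * (c p)\<^sup>2)"
      by (simp add: B_def emeasure_ball unit_ball_vol_2)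
  qed
  also have "(\<Prod>p\<in>K - C. ennreal (2 * c p)) * (\<Prod>p\<in>C. ennreal (pi * (c p)\<^sup>2)) =
      ennreal ((\<Prod>p\<in>K - C. 2 * c p) * (\<Prod>p\<in>C. pi * (c p)\<^sup>2))"
    using less_imp_le[OF c] K(2) by (subst (1 2) prod_ennreal) (auto intro!: ennreal_mult[symmetric] prod_nonneg)
  finally show "emeasure lborel S = ennreal ((\<Prod>p\<in>K - C. 2 * c p) * (\<Prod>p\<in>C. pi * (c p)\<^sup>2))" .
qed

text \<open>With \<open>L\<close> the real embedding matrix of an integral basis, this moves a body
  into the coordinates of that basis, in which the ring of integers is the integer lattice.\<close>

lemma emeasure_linear_preimage:
  fixes L :: "real^'n::{finite,wellorder}^'n::{finite,wellorder}"
  assumes L: "Determinants.det L \<noteq> 0" and T: "T \<in> sets borel" "emeasure lborel T = ennreal v" "v \<ge> 0"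
  shows "{y. L *v y \<in> T} \<in> sets borel" "emeasure lborel {y. L *v y \<in> T} = ennreal (v / \<bar>Determinants.det L\<bar>)"
proof -
  obtain L' where L': "L ** L' = mat 1" "L' ** L = mat 1"
    using L by (auto simp: invertible_det_nz[symmetric] invertible_def)
  have "continuous_on UNIV ((*v) L)" by (rule linear_continuous_on) (simp add: matrix_vector_mul_bounded_linear)
  then have "(*v) L \<in> borel_measurable borel" by (rule borel_measurable_continuous_onI)
  from measurable_sets[OF this T(1)] show S: "{y. L *v y \<in> T} \<in> sets borel" by (simp add: vimage_def)
  have eq: "{y. L *v y \<in> T} = (*v) L' ` T"
  proof (intro equalityI subsetI)
    fix y assume "y \<in> {y. L *v y \<in> T}"
    then show "y \<in> (*v) L' ` T"
      by (intro image_eqI[of _ _ "L *v y"]) (auto simp: matrix_vector_mul_assoc L')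
  qed (auto simp: matrix_vector_mul_assoc L')
  have Tm: "T \<in> lmeasurable"
    using T by (intro fmeasurableI) auto
  have mT: "measure lebesgue T = v"
    using T by (simp add: measure_def)
  have lin: "linear ((*v) L')" by simp
  have "Determinants.det L * Determinants.det L' = 1"
    using arg_cong[OF L'(1), of Determinants.det] by (simp add: Determinants.det_mul)
  then have d: "Determinants.det L' = 1 / Determinants.det L" using L by (simp add: field_simps)
  have "(*v) L' ` T \<in> lmeasurable" by (rule measurable_linear_image[OF lin Tm])
  then have "emeasure lebesgue ((*v) L' ` T) = ennreal (measure lebesgue ((*v) L' ` T))"
    by (intro emeasure_eq_measure2) (auto simp: fmeasurable_def)
  also have "measure lebesgue ((*v) L' ` T) = v / \<bar>Determinants.det L\<bar>"
    using measure_linear_image[OF lin Tm] by (simp add: mT d matrix_of_matrix_vector_mul)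
  finally show "emeasure lborel {y. L *v y \<in> T} = ennreal (v / \<bar>Determinants.det L\<bar>)"
    using S by (simp add: eq)
qed

definition vec_of_int :: "int^'n \<Rightarrow> real^'n" where
  "vec_of_int z = (\<chi> i. of_int (z $ i))"

lemma vec_of_int_nth [simp]: "vec_of_int z $ i = of_int (z $ i)"
  by (simp add: vec_of_int_def)

text \<open>Blichfeldt's principle for the sublattice of \<open>\<int>\<^sup>n\<close> whose cosets are the fibres of the
  colouring \<open>\<kappa>\<close>.\<close>

lemma blichfeldt:
  fixes S :: "(real^'n) set" and \<kappa> :: "int^'n \<Rightarrow> 'k"
  assumes K: "finite K" "range \<kappa> \<subseteq> K" and S: "S \<in> sets borel" and big: "emeasure lborel S > of_nat (card K)"
  obtains x y z z' where "x \<in> S" "y \<in> S" "z \<noteq> z'" "\<kappa> z = \<kappa> z'" "x - y = vec_of_int z - vec_of_int z'"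
proof (rule ccontr)
  assume contra: "\<not> thesis"
  note obtained = that
  have no: False if "y + vec_of_int z \<in> S" "y + vec_of_int z' \<in> S" "z \<noteq> z'" "\<kappa> z = \<kappa> z'" for y z z'
    using contra that obtained[of "y + vec_of_int z" "y + vec_of_int z'" z z'] by simp
  define Q where "Q = {x :: real^'n. \<forall>i. 0 \<le> x $ i \<and> x $ i < 1}"
  have "Q = (\<Inter>i. {x. 0 \<le> x $ i} \<inter> {x. x $ i < 1})" by (auto simp: Q_def)
  also have "\<dots> \<in> sets borel"
    by (intro sets.countable_INT'' sets.Int borel_closed borel_open closed_Collect_le open_Collect_less
        continuous_intros) auto
  finally have Q: "Q \<in> sets borel" .
  have "emeasure lborel Q \<le> emeasure lborel (cbox (0 :: real^'n) 1)"
    by (intro emeasure_mono) (auto simp: Q_def mem_box_cart less_imp_le)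
  also have "\<dots> = ennreal (\<Prod>b\<in>Basis. (1 :: real^'n) \<bullet> b)"
    by (subst emeasure_lborel_cbox) (auto simp: Basis_real_vec inner_axis)
  also have "\<dots> = 1" by (simp add: prod_Basis_real_vec)
  finally have Q1: "emeasure lborel Q \<le> 1" .
  \<comment> \<open>\<open>A z\<close> is the part of \<open>S\<close> in the unit cell at
    \<open>z\<close>, and \<open>B z\<close> is the same piece moved back to the cell
    \<open>Q\<close> at the origin.\<close>
  define A where "A z = {x \<in> S. x - vec_of_int z \<in> Q}" for z
  define B where "B z = {y \<in> Q. y + vec_of_int z \<in> S}" for z
  have tr: "(\<lambda>x. x + a) -` T \<in> sets borel" if "T \<in> sets borel" for a :: "real^'n" and T
  proof -
    have "(\<lambda>x. x + a) \<in> borel_measurable borel"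
      by (intro borel_measurable_continuous_onI continuous_intros)
    from measurable_sets[OF this that] show ?thesis by simp
  qed
  have Am: "A z \<in> sets borel" for z
  proof -
    have "A z = S \<inter> (\<lambda>x. x + (- vec_of_int z)) -` Q" by (auto simp: A_def)
    then show ?thesis using sets.Int[OF S tr[OF Q, of "- vec_of_int z"]] by simp
  qed
  have Bm: "B z \<in> sets borel" for z
  proof -
    have "B z = Q \<inter> (\<lambda>x. x + vec_of_int z) -` S" by (auto simp: B_def)
    then show ?thesis using sets.Int[OF Q tr[OF S, of "vec_of_int z"]] by simp
  qed
  have AB: "emeasure lborel (A z) = emeasure lborel (B z)" for z
  proof -
    have "emeasure lborel (A z) = emeasure (distr lborel borel ((+) (vec_of_int z))) (A z)"
      by (simp add: lborel_distr_plus)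
    also have "\<dots> = emeasure lborel ((+) (vec_of_int z) -` A z)"
      using Am by (subst emeasure_distr) auto
    also have "(+) (vec_of_int z) -` A z = B z" by (auto simp: A_def B_def add.commute)
    finally show ?thesis .
  qed
  \<comment> \<open>Within a fibre the moved pieces are disjoint, since a common point of two of
    them would give \<open>x\<close> and \<open>y\<close> as required. So each colour accounts for
    at most one unit of the volume of \<open>S\<close>.\<close>
  have fib: "emeasure lborel (\<Union>z\<in>{z. \<kappa> z = k}. A z) \<le> 1" for k
  proof -
    let ?Z = "{z. \<kappa> z = k}"
    have "emeasure lborel (\<Union>z\<in>?Z. A z) = (\<integral>\<^sup>+z. emeasure lborel (A z) \<partial>count_space ?Z)"
    proof (rule emeasure_UN_countable)
      show "disjoint_family_on A ?Z"
      proof (unfold disjoint_family_on_def, intro ballI impI, rule ccontr)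
        fix z z' assume "z \<noteq> z'" "A z \<inter> A z' \<noteq> {}"
        then obtain x where x: "x - vec_of_int z \<in> Q" "x - vec_of_int z' \<in> Q" by (auto simp: A_def)
        have "z $ i = z' $ i" for i
        proof -
          have "0 \<le> x $ i - of_int (z $ i)" "x $ i - of_int (z $ i) < 1"
            "0 \<le> x $ i - of_int (z' $ i)" "x $ i - of_int (z' $ i) < 1"
            using x by (auto simp: Q_def)
          then show ?thesis by linarith
        qed
        with \<open>z \<noteq> z'\<close> show False by (simp add: vec_eq_iff)
      qed
    qed (auto simp: Am)
    also have "\<dots> = (\<integral>\<^sup>+z. emeasure lborel (B z) \<partial>count_space ?Z)" by (simp add: AB)
    also have "\<dots> = emeasure lborel (\<Union>z\<in>?Z. B z)"
    proof (rule emeasure_UN_countable[symmetric])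
      show "disjoint_family_on B ?Z"
        unfolding disjoint_family_on_def using no by (auto simp: B_def)
    qed (auto simp: Bm)
    also have "\<dots> \<le> emeasure lborel Q"
      using Q by (intro emeasure_mono) (auto simp: B_def)
    finally show ?thesis using Q1 by simp
  qed
  have un: "(\<Union>z\<in>Z. A z) \<in> sets borel" for Z by (intro sets.countable_UN'') (auto simp: Am)
  have "S \<subseteq> (\<Union>k\<in>K. \<Union>z\<in>{z. \<kappa> z = k}. A z)"
  proof
    fix x assume x: "x \<in> S"
    define z where "z = (\<chi> i. \<lfloor>x $ i\<rfloor>)"
    have "x \<in> A z" using x by (auto simp: A_def Q_def z_def) linarith
    then show "x \<in> (\<Union>k\<in>K. \<Union>z\<in>{z. \<kappa> z = k}. A z)" using K(2) by auto
  qed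
  then have "emeasure lborel S \<le> emeasure lborel (\<Union>k\<in>K. \<Union>z\<in>{z. \<kappa> z = k}. A z)"
    using un K(1) by (intro emeasure_mono) auto
  also have "\<dots> \<le> (\<Sum>k\<in>K. emeasure lborel (\<Union>z\<in>{z. \<kappa> z = k}. A z))"
    using un K(1) by (intro emeasure_subadditive_finite) auto
  also have "\<dots> \<le> (\<Sum>k\<in>K. 1)" by (intro sum_mono fib)
  finally show False using big by simp
qed

section \<open>Infinite primes\<close>

text \<open>The change of variables formula of HOL-Analysis asks for a well-ordered index type.\<close>

definition emb_code :: "'a::number_field emb \<Rightarrow> nat" where
  "emb_code = (SOME f. inj f)"

lemma inj_emb_code: "inj (emb_code :: 'a::number_field emb \<Rightarrow> nat)"
proof -
  have "\<exists>f :: 'a emb \<Rightarrow> nat. inj f"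
    using finite_imp_inj_to_nat_seg[of "UNIV :: 'a emb set"] by auto
  then show ?thesis unfolding emb_code_def by (rule someI_ex)
qed

instantiation emb :: (number_field) wellorder
begin

definition less_eq_emb :: "'a emb \<Rightarrow> 'a emb \<Rightarrow> bool" where
  "less_eq_emb x y \<longleftrightarrow> emb_code x \<le> emb_code y"

definition less_emb :: "'a emb \<Rightarrow> 'a emb \<Rightarrow> bool" where
  "less_emb x y \<longleftrightarrow> emb_code x < emb_code y"

instance
proof
  fix P :: "'a emb \<Rightarrow> bool" and a :: "'a emb"
  assume step: "\<And>x. (\<And>y. y < x \<Longrightarrow> P y) \<Longrightarrow> P x"
  show "P a"
  proof (induction a rule: measure_induct_rule[of emb_code])
    case (less x)
    show ?case by (rule step) (rule less, simp add: less_emb_def)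
  qed
next
  fix x y :: "'a emb"
  assume "x \<le> y" "y \<le> x"
  then have "emb_code x = emb_code y" by (simp add: less_eq_emb_def)
  then show "x = y" by (simp add: inj_eq[OF inj_emb_code])
qed (auto simp: less_eq_emb_def less_emb_def)

end

definition prime_rep :: "'a::number_field infinite_prime \<Rightarrow> 'a emb" where
  "prime_rep P = Abs_emb (SOME \<sigma>. \<sigma> \<in> P)"

text \<open>At a real prime this is \<open>prime_rep P\<close> again; at a complex prime it is the
  second embedding of the class.\<close>

definition prime_conj :: "'a::number_field infinite_prime \<Rightarrow> 'a emb" where
  "prime_conj P = Abs_emb (cnj \<circ> Rep_emb (prime_rep P))"

definition complex_primes :: "'a::number_field infinite_prime set" where
  "complex_primes = {P \<in> infinite_primes. prime_deg P = 2}"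

lemma cnj_embedding: "\<sigma> \<in> embeddings \<Longrightarrow> cnj \<circ> \<sigma> \<in> embeddings"
  by (rule embeddingI) (auto simp: embedding_simps)

lemma cnj_cnj_embedding: "cnj \<circ> (cnj \<circ> \<sigma>) = \<sigma>"
  by (simp add: fun_eq_iff)

lemma infinite_primes_altdef:
  "(infinite_primes :: 'a::number_field infinite_prime set) = (\<lambda>\<sigma>. {\<sigma>, cnj \<circ> \<sigma>}) ` embeddings"
proof -
  let ?R = "{(\<sigma> :: 'a \<Rightarrow> complex, \<tau>). \<sigma> \<in> embeddings \<and> \<tau> \<in> embeddings \<and> (\<tau> = \<sigma> \<or> \<tau> = cnj \<circ> \<sigma>)}"
  have "?R `` {\<sigma>} = {\<sigma>, cnj \<circ> \<sigma>}" if "\<sigma> \<in> embeddings" for \<sigma>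
    using that cnj_embedding[OF that] by auto
  then have "(\<lambda>\<sigma>. ?R `` {\<sigma>}) ` embeddings = (\<lambda>\<sigma>. {\<sigma>, cnj \<circ> \<sigma>}) ` embeddings"
    by (intro image_cong) auto
  moreover have "embeddings // ?R = (\<lambda>\<sigma>. ?R `` {\<sigma>}) ` embeddings" unfolding quotient_def by blast
  ultimately show ?thesis unfolding infinite_primes_def by (simp only:)
qed

lemma infinite_prime_eq:
  assumes "P \<in> infinite_primes" "\<sigma> \<in> P"
  shows "P = {\<sigma>, cnj \<circ> \<sigma>}" "\<sigma> \<in> embeddings"
proof -
  obtain \<tau> where \<tau>: "\<tau> \<in> embeddings" "P = {\<tau>, cnj \<circ> \<tau>}" using assms(1) by (auto simp: infinite_primes_altdef)
  then show "P = {\<sigma>, cnj \<circ> \<sigma>}" using assms(2) cnj_cnj_embedding[of \<tau>] by auto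
  show "\<sigma> \<in> embeddings" using \<tau> assms(2) cnj_embedding by auto
qed

lemma Rep_prime_rep:
  assumes "P \<in> infinite_primes"
  shows "Rep_emb (prime_rep P) \<in> P" "Rep_emb (prime_rep P) = (SOME \<sigma>. \<sigma> \<in> P)"
proof -
  have "\<exists>\<sigma>. \<sigma> \<in> P" using assms by (auto simp: infinite_primes_altdef)
  then have *: "(SOME \<sigma>. \<sigma> \<in> P) \<in> P" by (rule someI_ex)
  then have "(SOME \<sigma>. \<sigma> \<in> P) \<in> embeddings" using infinite_prime_eq(2)[OF assms] by blast
  then show "Rep_emb (prime_rep P) = (SOME \<sigma>. \<sigma> \<in> P)" by (simp add: prime_rep_def Abs_emb_inverse)
  with * show "Rep_emb (prime_rep P) \<in> P" by simp
qed

lemma Rep_prime_conj: "Rep_emb (prime_conj P) = cnj \<circ> Rep_emb (prime_rep P)"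
  by (simp add: prime_conj_def Abs_emb_inverse cnj_embedding Rep_emb)

lemma prime_eq: "P \<in> infinite_primes \<Longrightarrow> P = {Rep_emb (prime_rep P), Rep_emb (prime_conj P)}"
  using infinite_prime_eq(1)[OF _ Rep_prime_rep(1)] by (simp add: Rep_prime_conj)

lemma prime_deg_eq_1_iff:
  assumes "P \<in> infinite_primes"
  shows "prime_deg P = 1 \<longleftrightarrow> prime_conj P = prime_rep P"
proof -
  have eq: "cnj z = z \<longleftrightarrow> z \<in> \<real>" for z by (auto simp: complex_is_Real_iff complex_eq_iff)
  have "prime_deg P = 1 \<longleftrightarrow> (\<forall>\<sigma>\<in>P. range \<sigma> \<subseteq> \<real>)" by (simp add: prime_deg_def)
  also have "\<dots> \<longleftrightarrow> (\<forall>x. Rep_emb (prime_rep P) x \<in> \<real>)"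
    by (subst prime_eq[OF assms]) (simp add: Rep_prime_conj image_subset_iff complex_is_Real_iff)
  also have "\<dots> \<longleftrightarrow> Rep_emb (prime_conj P) = Rep_emb (prime_rep P)"
    by (simp add: Rep_prime_conj fun_eq_iff eq)
  also have "\<dots> \<longleftrightarrow> prime_conj P = prime_rep P" by (rule Rep_emb_inject)
  finally show ?thesis .
qed

lemma prime_deg_cases: "prime_deg P = 1 \<or> prime_deg P = 2"
  by (simp add: prime_deg_def)

text \<open>The clauses are, in this order, the hypotheses of \<open>emeasure_polydisc\<close> on
  its index sets: representatives of all primes and conjugates at the complex ones exhaust the
  embeddings without repetition.\<close>

lemma infinite_primes_index:
  shows "finite (infinite_primes :: 'a::number_field infinite_prime set)"
    and "complex_primes \<subseteq> (infinite_primes :: 'a infinite_prime set)"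
    and "inj_on prime_rep (infinite_primes :: 'a infinite_prime set)"
    and "inj_on prime_conj (complex_primes :: 'a infinite_prime set)"
    and "prime_rep ` (infinite_primes :: 'a infinite_prime set) \<inter> prime_conj ` complex_primes = {}"
    and "prime_rep ` (infinite_primes :: 'a infinite_prime set) \<union> prime_conj ` complex_primes = UNIV"
proof -
  show "finite (infinite_primes :: 'a infinite_prime set)"
    by (simp add: infinite_primes_altdef card_embeddings)
  show sub: "complex_primes \<subseteq> (infinite_primes :: 'a infinite_prime set)" by (auto simp: complex_primes_def)
  have same: "P = Q" if "P \<in> infinite_primes" "Q \<in> infinite_primes" "\<sigma> \<in> P" "\<sigma> \<in> Q" for P Q :: "'a infinite_prime" and \<sigma>
    using infinite_prime_eq(1)[OF that(1,3)] infinite_prime_eq(1)[OF that(2,4)] by simp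
  have r: "Rep_emb (prime_rep P) \<in> P" and c: "Rep_emb (prime_conj P) \<in> P" if "P \<in> infinite_primes" for P :: "'a infinite_prime"
    using prime_eq[OF that] by auto
  show "inj_on prime_rep (infinite_primes :: 'a infinite_prime set)"
    by (rule inj_onI) (metis r same)
  show "inj_on prime_conj (complex_primes :: 'a infinite_prime set)"
    by (rule inj_onI) (metis c same sub subsetD)
  show "prime_rep ` (infinite_primes :: 'a infinite_prime set) \<inter> prime_conj ` complex_primes = {}"
  proof (rule ccontr)
    assume "prime_rep ` (infinite_primes :: 'a infinite_prime set) \<inter> prime_conj ` complex_primes \<noteq> {}"
    then obtain P Q :: "'a infinite_prime" where PQ: "P \<in> infinite_primes" "Q \<in> complex_primes" "prime_rep P = prime_conj Q" by auto
    then have "P = Q" using same[OF PQ(1) _ r[OF PQ(1)], of Q] c[of Q] sub by auto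
    then have "prime_deg Q = 1" using PQ sub prime_deg_eq_1_iff[of Q] by auto
    then show False using PQ by (simp add: complex_primes_def)
  qed
  show "prime_rep ` (infinite_primes :: 'a infinite_prime set) \<union> prime_conj ` complex_primes = UNIV"
  proof (intro equalityI subsetI UNIV_I)
    fix \<sigma> :: "'a emb"
    define P where "P = {Rep_emb \<sigma>, cnj \<circ> Rep_emb \<sigma>}"
    have P: "P \<in> infinite_primes" using Rep_emb[of \<sigma>] by (auto simp: P_def infinite_primes_altdef)
    have "Rep_emb \<sigma> \<in> P" by (simp add: P_def)
    then have "Rep_emb \<sigma> \<in> {Rep_emb (prime_rep P), Rep_emb (prime_conj P)}"
      by (subst prime_eq[OF P, symmetric])
    then have "\<sigma> = prime_rep P \<or> \<sigma> = prime_conj P" by (auto simp: Rep_emb_inject)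
    moreover have "prime_conj P \<in> prime_rep ` infinite_primes \<union> prime_conj ` complex_primes"
      using P prime_deg_cases[of P] prime_deg_eq_1_iff[OF P] by (auto simp: complex_primes_def)
    ultimately show "\<sigma> \<in> prime_rep ` infinite_primes \<union> prime_conj ` complex_primes" using P by auto
  qed
qed

lemma sum_emb_primes:
  fixes f :: "'a::number_field emb \<Rightarrow> 'c::comm_monoid_add"
  shows "(\<Sum>\<sigma>\<in>UNIV. f \<sigma>) = (\<Sum>P\<in>infinite_primes. f (prime_rep P)) + (\<Sum>P\<in>complex_primes. f (prime_conj P))"
proof -
  have "(\<Sum>\<sigma>\<in>UNIV. f \<sigma>) = sum f (prime_rep ` infinite_primes) + sum f (prime_conj ` complex_primes)"
    unfolding infinite_primes_index(6)[symmetric] using infinite_primes_index[where 'a = 'a]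
    by (intro sum.union_disjoint) (auto dest: finite_subset)
  then show ?thesis using infinite_primes_index(3,4)[where 'a = 'a] by (simp add: sum.reindex)
qed

lemma prod_emb_primes:
  fixes f :: "'a::number_field emb \<Rightarrow> 'c::comm_monoid_mult"
  shows "(\<Prod>\<sigma>\<in>UNIV. f \<sigma>) = (\<Prod>P\<in>infinite_primes. f (prime_rep P)) * (\<Prod>P\<in>complex_primes. f (prime_conj P))"
proof -
  have "(\<Prod>\<sigma>\<in>UNIV. f \<sigma>) = prod f (prime_rep ` infinite_primes) * prod f (prime_conj ` complex_primes)"
    unfolding infinite_primes_index(6)[symmetric] using infinite_primes_index[where 'a = 'a]
    by (intro prod.union_disjoint) (auto dest: finite_subset)
  then show ?thesis using infinite_primes_index(3,4)[where 'a = 'a] by (simp add: prod.reindex)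
qed

lemma sum_prime_split:
  "(\<Sum>P\<in>infinite_primes. f P) = (\<Sum>P\<in>infinite_primes - complex_primes. f P) + (\<Sum>P\<in>complex_primes. f P)"
  for f :: "'a::number_field infinite_prime \<Rightarrow> 'c::comm_monoid_add"
  by (rule sum.subset_diff[OF infinite_primes_index(2,1)])

lemma prod_prime_split:
  "(\<Prod>P\<in>infinite_primes. f P) = (\<Prod>P\<in>infinite_primes - complex_primes. f P) * (\<Prod>P\<in>complex_primes. f P)"
  for f :: "'a::number_field infinite_prime \<Rightarrow> 'c::comm_monoid_mult"
  by (rule prod.subset_diff[OF infinite_primes_index(2,1)])

lemma prime_deg_real: "P \<in> infinite_primes - complex_primes \<Longrightarrow> prime_deg P = 1"
  using prime_deg_cases[of P] by (auto simp: complex_primes_def)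

lemma prime_deg_complex: "P \<in> complex_primes \<Longrightarrow> prime_deg P = 2"
  by (auto simp: complex_primes_def)

lemma sum_prime_deg: "(\<Sum>P\<in>infinite_primes. prime_deg (P :: 'a::number_field infinite_prime)) = field_degree TYPE('a)"
proof -
  have "field_degree TYPE('a) = (\<Sum>\<sigma>\<in>(UNIV :: 'a emb set). 1)" by (simp add: card_emb)
  also have "\<dots> = (\<Sum>P\<in>infinite_primes - complex_primes. prime_deg (P :: 'a infinite_prime)) +
      (\<Sum>P\<in>complex_primes. prime_deg (P :: 'a infinite_prime))"
    unfolding sum_emb_primes sum_prime_split[of "\<lambda>_. 1"]
    by (simp add: prime_deg_real prime_deg_complex)
  finally show ?thesis by (simp only: sum_prime_split)
qed

lemma prod_prime_deg:
  fixes g :: "'a::number_field infinite_prime \<Rightarrow> 'c::comm_monoid_mult"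
  shows "(\<Prod>P\<in>infinite_primes. g P ^ prime_deg P) =
    (\<Prod>P\<in>infinite_primes - complex_primes. g P) * (\<Prod>P\<in>complex_primes. (g P)\<^sup>2)"
  unfolding prod_prime_split[of "\<lambda>P. g P ^ prime_deg P"]
  by (intro arg_cong2[of _ _ _ _ "(*)"] prod.cong) (auto simp: prime_deg_real prime_deg_complex)

lemma prime_abs_rep: "P \<in> infinite_primes \<Longrightarrow> prime_abs P x = cmod (Rep_emb (prime_rep P) x)"
  by (simp add: prime_abs_def Rep_prime_rep(2))

lemma prime_abs_simps:
  assumes "P \<in> infinite_primes"
  shows "prime_abs P (x * y) = prime_abs P x * prime_abs P y" "prime_abs P 1 = 1" "prime_abs P 0 = 0"
    "prime_abs P (inverse x) = inverse (prime_abs P x)" "prime_abs P x = 0 \<longleftrightarrow> x = 0"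
    "prime_abs P x \<ge> 0" "prime_abs P (of_int k) = \<bar>of_int k\<bar>" "prime_abs P x > 0 \<longleftrightarrow> x \<noteq> 0"
  using assms by (simp_all add: prime_abs_rep norm_mult norm_inverse)

lemma norm_emb_prime_abs:
  fixes x :: "'a::number_field"
  shows "cmod (\<Prod>\<sigma>\<in>UNIV. Rep_emb (\<sigma> :: 'a emb) x) = (\<Prod>P\<in>infinite_primes. prime_abs P x ^ prime_deg P)"
proof -
  have "cmod (\<Prod>\<sigma>\<in>UNIV. Rep_emb (\<sigma> :: 'a emb) x) = (\<Prod>\<sigma>\<in>UNIV. cmod (Rep_emb (\<sigma> :: 'a emb) x))"
    by (rule prod_norm[symmetric])
  also have "\<dots> = (\<Prod>P\<in>infinite_primes. prime_abs P x) * (\<Prod>P\<in>complex_primes. prime_abs P x)"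
    unfolding prod_emb_primes using infinite_primes_index(2)
    by (intro arg_cong2[of _ _ _ _ "(*)"] prod.cong) (auto simp: prime_abs_rep Rep_prime_conj)
  finally show ?thesis
    unfolding prod_prime_deg prod_prime_split[of "\<lambda>P. prime_abs P x"] power2_eq_square prod.distrib
    by (simp add: mult_ac)
qed

text \<open>The product is the absolute value of the field norm, a nonzero rational integer.\<close>

lemma prod_prime_abs_ge_1:
  fixes x :: "'a::number_field"
  assumes "x \<in> ring_of_integers" "x \<noteq> 0"
  shows "(\<Prod>P\<in>infinite_primes. prime_abs P x ^ prime_deg P) \<ge> 1"
proof -
  have "(\<Prod>\<sigma>\<in>UNIV. Rep_emb (\<sigma> :: 'a emb) x) \<in> \<int>"
    using assms by (intro trace_norm_Ints) (auto simp: ring_of_integers_def)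
  then obtain k where k: "(\<Prod>\<sigma>\<in>UNIV. Rep_emb (\<sigma> :: 'a emb) x) = of_int k" by (auto elim: Ints_cases)
  moreover have "(\<Prod>\<sigma>\<in>UNIV. Rep_emb (\<sigma> :: 'a emb) x) \<noteq> 0" using assms by simp
  ultimately have "cmod (\<Prod>\<sigma>\<in>UNIV. Rep_emb (\<sigma> :: 'a emb) x) \<ge> 1" by auto
  then show ?thesis by (simp only: norm_emb_prime_abs)
qed

section \<open>The Minkowski embedding\<close>

text \<open>The columns are the Minkowski embeddings of the \<open>b j\<close> in real coordinates.
  The row of a conjugate embedding holds the imaginary part taken there, that is, minus the one at
  the representative.\<close>

definition mink_matrix :: "('a::number_field emb \<Rightarrow> 'a) \<Rightarrow> real^'a emb^'a emb" where
  "mink_matrix b = (\<chi> \<sigma> j. if \<sigma> \<in> prime_rep ` infinite_primes then Re (Rep_emb \<sigma> (b j)) else Im (Rep_emb \<sigma> (b j)))"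

lemma mink_matrix_rep: "P \<in> infinite_primes \<Longrightarrow> mink_matrix b $ prime_rep P $ j = Re (Rep_emb (prime_rep P) (b j))"
  by (simp add: mink_matrix_def)

lemma mink_matrix_conj: "P \<in> complex_primes \<Longrightarrow> mink_matrix b $ prime_conj P $ j = - Im (Rep_emb (prime_rep P) (b j))"
  using infinite_primes_index(5) by (auto simp: mink_matrix_def Rep_prime_conj)

lemma det_cnj: "Determinants.det (\<chi> i j. cnj (A $ i $ j)) = cnj (Determinants.det (A :: complex^'n^'n))"
  by (simp add: Determinants.det_def)

lemma det_of_real: "Determinants.det (\<chi> i j. complex_of_real (A $ i $ j)) = of_real (Determinants.det (A :: real^'n^'n))"
  by (simp add: Determinants.det_def)

text \<open>Both sides of the Gram matrix identity below compute \<open>\<Sum>\<^sub>\<sigma> \<sigma>(b\<^sub>j) cnj (\<sigma>(b\<^sub>k))\<close>.\<close>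

lemma det_mink_matrix:
  fixes b :: "'a::number_field emb \<Rightarrow> 'a"
  shows "cmod (Determinants.det (emb_matrix b)) =
    2 ^ num_complex_primes TYPE('a) * \<bar>Determinants.det (mink_matrix b)\<bar>"
proof -
  \<comment> \<open>The weight 2 on both coordinates of a complex prime comes from
    \<open>z cnj w + cnj z w = 2 (Re z Re w + Im z Im w)\<close>; it produces the power of 2 in the
    statement.\<close>
  define d :: "'a emb \<Rightarrow> real" where
    "d \<sigma> = (if \<sigma> \<in> prime_rep ` (infinite_primes - complex_primes) then 1 else 2)" for \<sigma>
  have rep_real: "prime_rep P \<in> prime_rep ` (infinite_primes - complex_primes) \<longleftrightarrow> P \<notin> complex_primes"
    if "P \<in> infinite_primes" for P :: "'a infinite_prime"
    using that infinite_primes_index(3) by (auto simp: inj_on_def)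
  have conj_real: "prime_conj P \<notin> prime_rep ` (infinite_primes - complex_primes)"
    if "P \<in> complex_primes" for P :: "'a infinite_prime"
    using that infinite_primes_index(5) by blast
  have d_real: "d (prime_rep P) = 1" if "P \<in> infinite_primes - complex_primes" for P :: "'a infinite_prime"
    using that by (auto simp: d_def)
  have d_complex: "d (prime_rep P) = 2" if "P \<in> complex_primes" for P :: "'a infinite_prime"
    using that rep_real[of P] infinite_primes_index(2) by (auto simp: d_def)
  have d_conj: "d (prime_conj P) = 2" if "P \<in> complex_primes" for P :: "'a infinite_prime"
    using conj_real[OF that] by (simp add: d_def)
  define L where "L = mink_matrix b"
  define W where "W = emb_matrix b"
  define Wc :: "complex^'a emb^'a emb" where "Wc = (\<chi> i j. cnj (W $ i $ j))"
  define D :: "real^'a emb^'a emb" where "D = (\<chi> \<sigma> \<tau>. if \<sigma> = \<tau> then d \<sigma> else 0)"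
  define G where "G = transpose L ** (D ** L)"
  have cplx: "finite (complex_primes :: 'a infinite_prime set)"
    using infinite_primes_index(1,2) by (rule finite_subset[rotated])
  have detD: "Determinants.det D = 4 ^ num_complex_primes TYPE('a)"
  proof -
    have "Determinants.det D = (\<Prod>\<sigma>\<in>UNIV. d \<sigma>)"
      by (subst Determinants.det_diagonal) (auto simp: D_def)
    also have "\<dots> = (\<Prod>P\<in>infinite_primes - complex_primes. d (prime_rep (P :: 'a infinite_prime))) *
        (\<Prod>P\<in>complex_primes. d (prime_rep (P :: 'a infinite_prime))) *
        (\<Prod>P\<in>complex_primes. d (prime_conj (P :: 'a infinite_prime)))"
      unfolding prod_emb_primes prod_prime_split[of "\<lambda>P. d (prime_rep P)"] ..
    also have "(\<Prod>P\<in>infinite_primes - complex_primes. d (prime_rep (P :: 'a infinite_prime))) = 1"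
      by (intro prod.neutral) (auto simp: d_real)
    also have "(\<Prod>P\<in>complex_primes. d (prime_rep (P :: 'a infinite_prime))) = (\<Prod>P\<in>(complex_primes :: 'a infinite_prime set). 2)"
      by (intro prod.cong) (auto simp: d_complex)
    also have "(\<Prod>P\<in>complex_primes. d (prime_conj (P :: 'a infinite_prime))) = (\<Prod>P\<in>(complex_primes :: 'a infinite_prime set). 2)"
      by (intro prod.cong) (auto simp: d_conj)
    finally show ?thesis
      by (simp add: num_complex_primes_def complex_primes_def power_mult_distrib[symmetric])
  qed
  have "(W ** transpose Wc) $ j $ k = complex_of_real (G $ j $ k)" for j k
  proof -
    define z w where "z P = Rep_emb (prime_rep P) (b j)" and "w P = Rep_emb (prime_rep P) (b k)" for P
    have "G $ j $ k = (\<Sum>\<sigma>\<in>UNIV. L $ \<sigma> $ j * (\<Sum>\<tau>\<in>UNIV. (if \<sigma> = \<tau> then d \<sigma> else 0) * L $ \<tau> $ k))"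
      by (simp add: G_def D_def matrix_matrix_mult_def transpose_def)
    also have "\<dots> = (\<Sum>\<sigma>\<in>UNIV. d \<sigma> * (L $ \<sigma> $ j * L $ \<sigma> $ k))"
      by (intro sum.cong refl) (simp add: if_distrib[of "\<lambda>y. y * _"] cong: if_cong; simp add: mult_ac)
    also have "\<dots> = (\<Sum>P\<in>infinite_primes - complex_primes. Re (z P) * Re (w P)) +
        (\<Sum>P\<in>complex_primes. 2 * (Re (z P) * Re (w P))) + (\<Sum>P\<in>complex_primes. 2 * (Im (z P) * Im (w P)))"
      unfolding sum_emb_primes sum_prime_split[of "\<lambda>P. d (prime_rep P) * (L $ prime_rep P $ j * L $ prime_rep P $ k)"]
      using subsetD[OF infinite_primes_index(2)[where 'a = 'a]]
      by (intro arg_cong2[of _ _ _ _ "(+)"] sum.cong refl)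
        (simp_all add: d_real d_complex d_conj L_def mink_matrix_rep mink_matrix_conj z_def w_def)
    finally have G: "complex_of_real (G $ j $ k) = (\<Sum>P\<in>infinite_primes - complex_primes. of_real (Re (z P) * Re (w P))) +
        (\<Sum>P\<in>complex_primes. of_real (2 * (Re (z P) * Re (w P)) + 2 * (Im (z P) * Im (w P))))"
      by (simp add: sum.distrib)
    have "(W ** transpose Wc) $ j $ k = (\<Sum>\<sigma>\<in>UNIV. Rep_emb \<sigma> (b j) * cnj (Rep_emb \<sigma> (b k)))"
      by (simp add: W_def Wc_def emb_matrix_def matrix_matrix_mult_def transpose_def)
    also have "\<dots> = (\<Sum>P\<in>infinite_primes - complex_primes. z P * cnj (w P)) +
        (\<Sum>P\<in>complex_primes. z P * cnj (w P) + cnj (z P) * w P)"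
      unfolding sum_emb_primes sum_prime_split[of "\<lambda>P. Rep_emb (prime_rep P) (b j) * cnj (Rep_emb (prime_rep P) (b k))"]
      by (simp add: z_def w_def Rep_prime_conj sum.distrib add.assoc)
    also have "(\<Sum>P\<in>infinite_primes - complex_primes. z P * cnj (w P)) =
        (\<Sum>P\<in>infinite_primes - complex_primes. of_real (Re (z P) * Re (w P)))"
    proof (intro sum.cong refl)
      fix P :: "'a infinite_prime" assume P: "P \<in> infinite_primes - complex_primes"
      then have "prime_conj P = prime_rep P" using prime_deg_eq_1_iff[of P] prime_deg_real[OF P] by simp
      then have "cnj \<circ> Rep_emb (prime_rep P) = Rep_emb (prime_rep P)" by (metis Rep_prime_conj)
      then have "cnj (Rep_emb (prime_rep P) x) = Rep_emb (prime_rep P) x" for x by (metis comp_apply)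
      then have "cnj (z P) = z P" "cnj (w P) = w P" by (auto simp: z_def w_def)
      then show "z P * cnj (w P) = of_real (Re (z P) * Re (w P))" by (auto simp: complex_eq_iff)
    qed
    also have "(\<Sum>P\<in>complex_primes. z P * cnj (w P) + cnj (z P) * w P) =
        (\<Sum>P\<in>complex_primes. of_real (2 * (Re (z P) * Re (w P)) + 2 * (Im (z P) * Im (w P))))"
      by (intro sum.cong refl) (auto simp: complex_eq_iff)
    finally show ?thesis using G by simp
  qed
  then have eq: "W ** transpose Wc = (\<chi> j k. complex_of_real (G $ j $ k))" by (simp add: vec_eq_iff)
  have "Determinants.det W * cnj (Determinants.det W) = of_real (Determinants.det G)"
    using arg_cong[OF eq, of Determinants.det]
    by (simp add: Determinants.det_mul Determinants.det_transpose det_of_real Wc_def det_cnj)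
  also have "Determinants.det G = 4 ^ num_complex_primes TYPE('a) * (Determinants.det L)\<^sup>2"
    by (simp add: G_def Determinants.det_mul Determinants.det_transpose detD power2_eq_square)
  also have "(4::real) ^ num_complex_primes TYPE('a) = (2 ^ num_complex_primes TYPE('a))\<^sup>2"
    by (simp add: power2_eq_square power_mult_distrib[symmetric])
  finally have "Determinants.det W * cnj (Determinants.det W) =
      complex_of_real ((2 ^ num_complex_primes TYPE('a) * \<bar>Determinants.det L\<bar>)\<^sup>2)"
    by (simp add: power_mult_distrib)
  then have "complex_of_real ((cmod (Determinants.det W))\<^sup>2) =
      complex_of_real ((2 ^ num_complex_primes TYPE('a) * \<bar>Determinants.det L\<bar>)\<^sup>2)"
    by (simp only: complex_norm_square)
  then have "(cmod (Determinants.det W))\<^sup>2 = (2 ^ num_complex_primes TYPE('a) * \<bar>Determinants.det L\<bar>)\<^sup>2"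
    by (simp only: of_real_eq_iff)
  then show ?thesis unfolding W_def L_def by (rule power2_eq_imp_eq) auto
qed

section \<open>Minkowski's theorem for subgroups of the ring of integers\<close>

definition index :: "'a::ab_group_add set \<Rightarrow> 'a set \<Rightarrow> nat" where
  "index A B = card (A // {(x, y). x \<in> A \<and> y \<in> A \<and> x - y \<in> B})"

lemma del_const_pos: "del_const TYPE('a::number_field) > 0"
proof -
  obtain b :: "'a emb \<Rightarrow> 'a" where "Determinants.det (emb_matrix b) \<noteq> 0"
    "sqrt (cmod (discriminant TYPE('a))) = cmod (Determinants.det (emb_matrix b))"
    by (rule discriminant_basis)
  then show ?thesis by (simp add: del_const_def)
qed

text \<open>Blichfeldt's principle for a body of half size, with integral coordinate vectors
  coloured by their coset modulo \<open>J\<close>. The colouring accounts for the sublattice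
  \<open>J\<close>, at the price of one unit of volume per coset.\<close>

lemma minkowski:
  fixes J :: "'a::number_field set" and c :: "'a infinite_prime \<Rightarrow> real"
  assumes J: "0 \<in> J" "\<And>x y. x \<in> J \<Longrightarrow> y \<in> J \<Longrightarrow> x - y \<in> J"
    and fin: "finite (ring_of_integers // {(x, y). x \<in> ring_of_integers \<and> y \<in> ring_of_integers \<and> x - y \<in> J})"
    and c: "\<And>P. P \<in> infinite_primes \<Longrightarrow> c P > 0"
    and big: "(\<Prod>P\<in>infinite_primes. c P ^ prime_deg P) > del_const TYPE('a) * index ring_of_integers J"
  obtains f where "f \<in> J" "f \<noteq> 0" "\<And>P. P \<in> infinite_primes \<Longrightarrow> prime_abs P f < c P"
proof -
  define R where "R = {(x, y). x \<in> ring_of_integers \<and> y \<in> ring_of_integers \<and> x - y \<in> J}"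
  let ?K = "infinite_primes :: 'a infinite_prime set" and ?C = "complex_primes :: 'a infinite_prime set"
  obtain b :: "'a emb \<Rightarrow> 'a" where b: "Determinants.det (emb_matrix b) \<noteq> 0"
    "ring_of_integers = {\<Sum>j\<in>UNIV. of_int (c j) * b j | c. True}"
    "sqrt (cmod (discriminant TYPE('a))) = cmod (Determinants.det (emb_matrix b))"
    by (rule discriminant_basis)
  define \<iota> where "\<iota> z = (\<Sum>j\<in>UNIV. of_int (z $ j) * b j)" for z :: "int^'a emb"
  have \<iota>O: "\<iota> z \<in> ring_of_integers" for z unfolding b(2) \<iota>_def by blast
  define L where "L = mink_matrix b"
  define r2 where "r2 = num_complex_primes TYPE('a)"
  have detL: "Determinants.det L \<noteq> 0" using b(1) det_mink_matrix[of b] by (auto simp: L_def)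
  \<comment> \<open>The factor 2 per complex prime between \<open>sqrt |disc|\<close> and the real
    determinant turns \<open>2 / pi\<close> into \<open>4 / pi\<close>, which cancels against the
    area \<open>pi / 4 * c\<^sup>2\<close> of a disc of radius \<open>c / 2\<close>.\<close>
  have dc: "del_const TYPE('a) = (4 / pi) ^ r2 * \<bar>Determinants.det L\<bar>"
    using b(3) det_mink_matrix[of b]
    by (simp add: del_const_def r2_def L_def power_mult_distrib[symmetric] mult.assoc[symmetric])
  \<comment> \<open>Half radii, so that the difference of two points of the body obeys the bounds
    \<open>c P\<close>.\<close>
  define T where "T = {y :: real^'a emb. (\<forall>P\<in>?K - ?C. \<bar>y $ prime_rep P\<bar> < c P / 2) \<and>
      (\<forall>P\<in>?C. (y $ prime_rep P)\<^sup>2 + (y $ prime_conj P)\<^sup>2 < (c P / 2)\<^sup>2)}"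
  define v where "v = (\<Prod>P\<in>?K - ?C. 2 * (c P / 2)) * (\<Prod>P\<in>?C. pi * (c P / 2)\<^sup>2)"
  have T: "T \<in> sets borel" "emeasure lborel T = ennreal v"
    unfolding T_def v_def using c
    by (intro emeasure_polydisc[OF infinite_primes_index, where c = "\<lambda>P. c P / 2"]; simp)+
  have veq: "v = (\<Prod>P\<in>?K. c P ^ prime_deg P) * (pi / 4) ^ r2"
    unfolding v_def prod_prime_deg
    by (simp add: r2_def num_complex_primes_def complex_primes_def[symmetric] power_divide prod.distrib prod_dividef)
  have "v \<ge> 0" unfolding v_def using c infinite_primes_index(2)
    by (intro mult_nonneg_nonneg prod_nonneg) (auto simp: less_imp_le)
  define S where "S = {y. L *v y \<in> T}"
  have S: "S \<in> sets borel" "emeasure lborel S = ennreal (v / \<bar>Determinants.det L\<bar>)"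
    using emeasure_linear_preimage[OF detL T \<open>v \<ge> 0\<close>] by (auto simp: S_def)
  have "v / \<bar>Determinants.det L\<bar> = (\<Prod>P\<in>?K. c P ^ prime_deg P) / del_const TYPE('a)"
    unfolding veq dc by (simp add: power_divide field_simps)
  also have "\<dots> > index ring_of_integers J"
    using big del_const_pos[where 'a = 'a] by (simp add: field_simps)
  finally have "emeasure lborel S > of_nat (index ring_of_integers J)"
    unfolding S(2) ennreal_of_nat_eq_real_of_nat by (subst ennreal_less_iff) auto
  then have big': "emeasure lborel S > of_nat (card (ring_of_integers // R))" by (simp add: index_def R_def)
  define \<kappa> where "\<kappa> z = R `` {\<iota> z}" for z
  have ran: "range \<kappa> \<subseteq> ring_of_integers // R" using \<iota>O by (auto simp: \<kappa>_def quotient_def)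
  have fin': "finite (ring_of_integers // R)" using fin by (simp add: R_def)
  obtain x y z z' where xy: "x \<in> S" "y \<in> S" "z \<noteq> z'" "\<kappa> z = \<kappa> z'" "x - y = vec_of_int z - vec_of_int z'"
    by (rule blichfeldt[OF fin' ran S(1) big'])
  define f where "f = \<iota> z - \<iota> z'"
  have "\<iota> z' \<in> R `` {\<iota> z'}" using \<iota>O J by (auto simp: R_def)
  then have "\<iota> z' \<in> R `` {\<iota> z}" using xy(4) by (simp add: \<kappa>_def)
  then have fJ: "f \<in> J" by (auto simp: R_def f_def)
  have f_eq: "f = (\<Sum>j\<in>UNIV. of_rat (of_int (z $ j - z' $ j)) * b j)"
    by (simp add: f_def \<iota>_def sum_subtractf[symmetric] left_diff_distrib of_rat_diff)
  have f0: "f \<noteq> 0"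
  proof
    assume "f = 0"
    then have "z $ j - z' $ j = 0" for j
      using spanning_of_det_emb_matrix(2)[OF b(1), of "\<lambda>j. of_int (z $ j - z' $ j)" j] f_eq by simp
    then show False using xy(3) by (simp add: vec_eq_iff)
  qed
  have Rf: "Rep_emb \<sigma> f = (\<Sum>j\<in>UNIV. of_real (of_int (z $ j) - of_int (z' $ j)) * Rep_emb \<sigma> (b j))" for \<sigma>
    unfolding f_eq Rep_emb_rat_sum by (simp add: of_rat_diff)
  have Lxy: "(L *v (x - y)) $ \<sigma> = (\<Sum>j\<in>UNIV. (of_int (z $ j) - of_int (z' $ j)) * L $ \<sigma> $ j)" for \<sigma>
    unfolding xy(5) by (simp add: matrix_vector_mult_def mult.commute)
  have Lr: "Re (Rep_emb (prime_rep P) f) = (L *v x) $ prime_rep P - (L *v y) $ prime_rep P" if "P \<in> ?K" for P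
    using that Lxy[of "prime_rep P"]
    by (simp add: Rf L_def mink_matrix_rep matrix_vector_mult_diff_distrib)
  have Lc: "- Im (Rep_emb (prime_rep P) f) = (L *v x) $ prime_conj P - (L *v y) $ prime_conj P" if "P \<in> ?C" for P
    using that Lxy[of "prime_conj P"]
    by (simp add: Rf L_def mink_matrix_conj matrix_vector_mult_diff_distrib sum_negf)
  have "prime_abs P f < c P" if P: "P \<in> ?K" for P
  proof (cases "P \<in> ?C")
    case False
    then have P': "P \<in> ?K - ?C" using P by simp
    then have "prime_conj P = prime_rep P" using prime_deg_eq_1_iff[of P] prime_deg_real[OF P'] by simp
    then have "cnj (Rep_emb (prime_rep P) f) = Rep_emb (prime_rep P) f" by (metis Rep_prime_conj comp_apply)
    then have "Im (Rep_emb (prime_rep P) f) = 0" by (simp add: complex_eq_iff)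
    then have "prime_abs P f = \<bar>(L *v x) $ prime_rep P - (L *v y) $ prime_rep P\<bar>"
      using P by (simp add: prime_abs_rep cmod_def Lr[symmetric])
    moreover have "\<bar>(L *v x) $ prime_rep P\<bar> < c P / 2" "\<bar>(L *v y) $ prime_rep P\<bar> < c P / 2"
      using xy(1,2) P' by (auto simp: S_def T_def)
    ultimately show ?thesis by linarith
  next
    case True
    define p q where "p = Complex ((L *v x) $ prime_rep P) ((L *v x) $ prime_conj P)"
      and "q = Complex ((L *v y) $ prime_rep P) ((L *v y) $ prime_conj P)"
    have "c P > 0" using c P by simp
    have pq: "(cmod p)\<^sup>2 < (c P / 2)\<^sup>2" "(cmod q)\<^sup>2 < (c P / 2)\<^sup>2"
      using xy(1,2) True by (auto simp: S_def T_def p_def q_def cmod_power2)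
    have "cmod p < c P / 2" "cmod q < c P / 2"
      using power2_less_imp_less[OF pq(1)] power2_less_imp_less[OF pq(2)] \<open>c P > 0\<close> by simp_all
    moreover have "Rep_emb (prime_rep P) f = cnj (p - q)"
      using Lr[OF P] Lc[OF True] by (simp add: complex_eq_iff p_def q_def)
    then have "prime_abs P f = cmod (p - q)" using P by (simp add: prime_abs_rep del: complex_cnj_diff)
    moreover have "cmod (p - q) \<le> cmod p + cmod q" by (rule norm_triangle_ineq4)
    ultimately show ?thesis by linarith
  qed
  then show ?thesis using fJ f0 by (intro that)
qed

text \<open>The inverse of the embedding matrix expresses integral coordinates through the
  conjugates, so bounded conjugates leave finitely many coordinate vectors.\<close>

lemma finite_bounded_integers:
  fixes c :: real
  shows "finite {x :: 'a::number_field. x \<in> ring_of_integers \<and> (\<forall>P\<in>infinite_primes. prime_abs P x \<le> c)}"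
proof -
  obtain b :: "'a emb \<Rightarrow> 'a" where b: "Determinants.det (emb_matrix b) \<noteq> 0"
    "ring_of_integers = {\<Sum>j\<in>UNIV. of_int (c j) * b j | c. True}"
    by (rule integral_emb_basis_exists)
  define W where "W = transpose (emb_matrix b)"
  have "Determinants.det W \<noteq> 0" using b(1) by (simp add: W_def Determinants.det_transpose)
  then obtain V where V: "V ** W = mat 1" by (auto simp: invertible_det_nz[symmetric] invertible_left_inverse)
  define N where "N = \<lceil>(\<Sum>i\<in>UNIV. \<Sum>\<sigma>\<in>UNIV. cmod (V $ i $ \<sigma>)) * \<bar>c\<bar>\<rceil>"
  define F where "F = (\<Pi>\<^sub>E j\<in>(UNIV :: 'a emb set). {- N..N})"
  have "finite F" by (simp add: F_def finite_PiE)
  moreover have "{x :: 'a. x \<in> ring_of_integers \<and> (\<forall>P\<in>infinite_primes. prime_abs P x \<le> c)} \<subseteq>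
      (\<lambda>k. \<Sum>j\<in>UNIV. of_int (k j) * b j) ` F"
  proof safe
    fix x :: 'a assume "x \<in> ring_of_integers" and bd: "\<forall>P\<in>infinite_primes. prime_abs P x \<le> c"
    then obtain k where k: "x = (\<Sum>j\<in>UNIV. of_int (k j) * b j)" using b(2) by blast
    have bd': "cmod (Rep_emb \<sigma> x) \<le> \<bar>c\<bar>" for \<sigma>
    proof -
      have "\<sigma> \<in> prime_rep ` infinite_primes \<union> prime_conj ` complex_primes" using infinite_primes_index(6) by blast
      then obtain P where P: "P \<in> infinite_primes" "\<sigma> = prime_rep P \<or> \<sigma> = prime_conj P"
        using infinite_primes_index(2) by blast
      then have "cmod (Rep_emb \<sigma> x) = prime_abs P x" by (auto simp: prime_abs_rep Rep_prime_conj)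
      then show ?thesis using bd P(1) by force
    qed
    define kv :: "complex^'a emb" where "kv = (\<chi> j. of_int (k j))"
    have Wk: "W *v kv = (\<chi> \<sigma>. Rep_emb \<sigma> x)"
      unfolding k Rep_emb_int_sum
      by (simp add: vec_eq_iff matrix_vector_mult_def W_def kv_def transpose_def emb_matrix_def mult.commute)
    have "k i \<in> {- N..N}" for i
    proof -
      have "kv = V *v (W *v kv)" by (simp add: matrix_vector_mul_assoc V)
      then have "kv $ i = (V *v (\<chi> \<sigma>. Rep_emb \<sigma> x)) $ i" by (simp add: Wk)
      then have "of_int (k i) = (\<Sum>\<sigma>\<in>UNIV. V $ i $ \<sigma> * Rep_emb \<sigma> x)"
        by (simp add: kv_def matrix_vector_mult_def)
      then have "cmod (of_int (k i)) \<le> (\<Sum>\<sigma>\<in>UNIV. cmod (V $ i $ \<sigma> * Rep_emb \<sigma> x))"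
        by (simp only: norm_sum)
      also have "\<dots> \<le> (\<Sum>\<sigma>\<in>UNIV. cmod (V $ i $ \<sigma>) * \<bar>c\<bar>)"
        unfolding norm_mult by (intro sum_mono mult_left_mono bd') auto
      also have "\<dots> = (\<Sum>\<sigma>\<in>UNIV. cmod (V $ i $ \<sigma>)) * \<bar>c\<bar>" by (simp add: sum_distrib_right)
      also have "(\<Sum>\<sigma>\<in>UNIV. cmod (V $ i $ \<sigma>)) \<le> (\<Sum>i\<in>UNIV. \<Sum>\<sigma>\<in>UNIV. cmod (V $ i $ \<sigma>))"
        by (rule member_le_sum) (auto intro: sum_nonneg)
      finally have "\<bar>of_int (k i)\<bar> \<le> (\<Sum>i\<in>UNIV. \<Sum>\<sigma>\<in>UNIV. cmod (V $ i $ \<sigma>)) * \<bar>c\<bar>"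
        by (simp add: mult_right_mono)
      then have "\<bar>k i\<bar> \<le> N" unfolding N_def by linarith
      then show ?thesis by auto
    qed
    then show "x \<in> (\<lambda>k. \<Sum>j\<in>UNIV. of_int (k j) * b j) ` F"
      using k by (intro image_eqI[where x = k]) (auto simp: F_def)
  qed
  ultimately show ?thesis by (rule finite_surj)
qed

section \<open>Indices of subgroups\<close>

definition subgrp :: "'a::ab_group_add set \<Rightarrow> bool" where
  "subgrp A \<longleftrightarrow> 0 \<in> A \<and> (\<forall>x\<in>A. \<forall>y\<in>A. x - y \<in> A)"

lemma subgrpD: "subgrp A \<Longrightarrow> 0 \<in> A" "subgrp A \<Longrightarrow> x \<in> A \<Longrightarrow> y \<in> A \<Longrightarrow> x - y \<in> A"
  by (auto simp: subgrp_def)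

lemma subgrp_uminus: "subgrp A \<Longrightarrow> x \<in> A \<Longrightarrow> - x \<in> A"
  using subgrpD(2)[of A 0 x] subgrpD(1)[of A] by simp

lemma subgrp_add: "subgrp A \<Longrightarrow> x \<in> A \<Longrightarrow> y \<in> A \<Longrightarrow> x + y \<in> A"
  using subgrpD(2)[of A x "- y"] subgrp_uminus[of A y] by simp

definition transversal :: "'a::ab_group_add set \<Rightarrow> 'a set \<Rightarrow> 'a set \<Rightarrow> bool" where
  "transversal A B T \<longleftrightarrow> T \<subseteq> A \<and> (\<forall>x\<in>A. \<exists>!t. t \<in> T \<and> x - t \<in> B)"

lemma transversal_unique:
  assumes "transversal A B T" "x \<in> A" "t \<in> T" "x - t \<in> B" "t' \<in> T" "x - t' \<in> B"
  shows "t = t'"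
  using assms unfolding transversal_def by blast

text \<open>Infinite quotients are included, both cardinalities then being 0. Hence
  \<open>index A B > 0\<close> carries the finiteness of the quotient.\<close>

lemma index_transversal:
  assumes B: "subgrp B" and T: "transversal A B T"
  shows "index A B = card T"
proof -
  define R where "R = {(x, y). x \<in> A \<and> y \<in> A \<and> x - y \<in> B}"
  have TA: "T \<subseteq> A" using T by (simp add: transversal_def)
  have "bij_betw (\<lambda>t. R `` {t}) T (A // R)"
    unfolding bij_betw_def
  proof (intro conjI inj_onI equalityI subsetI)
    fix s t assume st: "s \<in> T" "t \<in> T" "R `` {s} = R `` {t}"
    have "s \<in> R `` {s}" using st TA B by (auto simp: R_def subgrp_def)
    then have "t - s \<in> B" using st(3) by (auto simp: R_def)
    then show "s = t"
      using transversal_unique[OF T, of t s t] st TA subgrpD(1)[OF B] by auto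
  next
    fix X assume "X \<in> (\<lambda>t. R `` {t}) ` T"
    then show "X \<in> A // R" using TA by (auto simp: quotient_def)
  next
    fix X assume "X \<in> A // R"
    then obtain x where x: "x \<in> A" "X = R `` {x}" by (auto simp: quotient_def)
    then obtain t where t: "t \<in> T" "x - t \<in> B" using T unfolding transversal_def by blast
    have "x - y \<in> B \<longleftrightarrow> t - y \<in> B" for y
      using subgrpD(2)[OF B, of "x - y" "x - t"] subgrp_add[OF B, of "t - y" "x - t"] t(2) by auto
    then have "R `` {x} = R `` {t}" using x t TA by (auto simp: R_def)
    then show "X \<in> (\<lambda>t. R `` {t}) ` T" using x t by auto
  qed
  then show ?thesis unfolding index_def R_def[symmetric] by (simp add: bij_betw_same_card)
qed

lemma transversal_exists:
  assumes B: "subgrp B"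
  obtains T where "transversal A B T"
proof -
  define r where "r x = (SOME y. y \<in> A \<and> x - y \<in> B)" for x
  have r: "r x \<in> A \<and> x - r x \<in> B" if "x \<in> A" for x
    unfolding r_def by (rule someI[of _ x]) (use that B in \<open>auto simp: subgrp_def\<close>)
  have "transversal A B (r ` A)"
    unfolding transversal_def
  proof (intro conjI ballI)
    show "r ` A \<subseteq> A" using r by blast
    fix x assume x: "x \<in> A"
    show "\<exists>!t. t \<in> r ` A \<and> x - t \<in> B"
    proof (rule ex1I[of _ "r x"])
      show "r x \<in> r ` A \<and> x - r x \<in> B" using r x by blast
      fix t assume t: "t \<in> r ` A \<and> x - t \<in> B"
      then obtain z where z: "z \<in> A" "t = r z" by blast
      have "x - t \<in> B" "z - t \<in> B" using t z r[OF z(1)] by auto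
      from subgrpD(2)[OF B this] have xz: "x - z \<in> B" by simp
      have "x - y \<in> B \<longleftrightarrow> z - y \<in> B" for y
        using subgrpD(2)[OF B, of "x - y" "x - z"] subgrp_add[OF B, of "z - y" "x - z"] xz by auto
      then have "r x = r z" by (simp add: r_def)
      with z show "t = r x" by simp
    qed
  qed
  then show ?thesis by (rule that)
qed

text \<open>Sums of representatives for the two steps represent \<open>A\<close> modulo
  \<open>C\<close>. With infinite indices counted as 0, a positive index on the left makes both
  factors positive, which is how finiteness is passed on later.\<close>

lemma index_mult:
  assumes "subgrp B" "subgrp C" "C \<subseteq> B" "B \<subseteq> A" and A: "subgrp A"
  shows "index A C = index A B * index B C"
proof -
  obtain S where S: "transversal A B S" using transversal_exists[OF assms(1)] .
  obtain T where T: "transversal B C T" using transversal_exists[OF assms(2)] .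
  have sub: "S \<subseteq> A" "T \<subseteq> B" using S T by (auto simp: transversal_def)
  let ?f = "\<lambda>(s, t). s + t"
  have uniq: "s = s' \<and> t = t'" if "s \<in> S" "t \<in> T" "s' \<in> S" "t' \<in> T" "(s + t) - (s' + t') \<in> C" for s t s' t'
  proof -
    have st: "s + t \<in> A" using that sub assms by (intro subgrp_add) auto
    have "(s + t) - (s' + t') + t' \<in> B" using that sub assms by (intro subgrp_add[OF assms(1)]) auto
    then have "s = s'"
      using that sub by (intro transversal_unique[OF S st, of s s']) (auto simp: algebra_simps)
    then show ?thesis
      using that sub subgrpD(1)[OF assms(2)] transversal_unique[OF T, of t t t'] by auto
  qed
  have "transversal A C (?f ` (S \<times> T))"
    unfolding transversal_def
  proof (intro conjI ballI)
    show "?f ` (S \<times> T) \<subseteq> A" using sub assms by (auto intro!: subgrp_add)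
    fix x assume x: "x \<in> A"
    obtain s where s: "s \<in> S" "x - s \<in> B" using S x unfolding transversal_def by blast
    obtain t where t: "t \<in> T" "x - s - t \<in> C" using T s unfolding transversal_def by blast
    show "\<exists>!u. u \<in> ?f ` (S \<times> T) \<and> x - u \<in> C"
    proof (rule ex1I[of _ "s + t"])
      show "s + t \<in> ?f ` (S \<times> T) \<and> x - (s + t) \<in> C" using s t by (auto simp: algebra_simps)
      fix u assume u: "u \<in> ?f ` (S \<times> T) \<and> x - u \<in> C"
      then obtain s' t' where st': "u = s' + t'" "s' \<in> S" "t' \<in> T" by auto
      have "(x - u) - (x - s - t) \<in> C" using u t subgrpD(2)[OF assms(2), of "x - u" "x - s - t"] by blast
      then have "(s + t) - (s' + t') \<in> C" by (simp add: st' algebra_simps)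
      then show "u = s + t" using uniq[of s t s' t'] s t st' by simp
    qed
  qed
  moreover have "inj_on ?f (S \<times> T)"
  proof (rule inj_onI)
    fix p q assume pq: "p \<in> S \<times> T" "q \<in> S \<times> T" "?f p = ?f q"
    obtain s t s' t' where "p = (s, t)" "q = (s', t')" by (cases p, cases q)
    then show "p = q" using uniq[of s t s' t'] pq subgrpD(1)[OF assms(2)] by auto
  qed
  ultimately show ?thesis
    using index_transversal[OF assms(2)] index_transversal[OF assms(1) S] index_transversal[OF assms(2) T]
    by (simp add: card_image card_cartesian_product)
qed

abbreviation scale :: "'a::field \<Rightarrow> 'a set \<Rightarrow> 'a set" where
  "scale x A \<equiv> (*) x ` A"

lemma mem_scale_iff: "x \<noteq> 0 \<Longrightarrow> y \<in> scale x A \<longleftrightarrow> y / x \<in> A"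
  by (auto simp: image_iff) (metis nonzero_mult_div_cancel_left times_divide_eq_right)

lemma scale_scale: "scale x (scale y A) = scale (x * y) A"
  by (auto simp: image_iff mult.assoc)

lemma scale_inverse: "x \<noteq> 0 \<Longrightarrow> scale x (scale (inverse x) A) = A" "x \<noteq> 0 \<Longrightarrow> scale (inverse x) (scale x A) = A"
  by (simp_all add: image_image mult.assoc[symmetric])

lemma subgrp_scale:
  assumes "subgrp A"
  shows "subgrp (scale x A)"
  unfolding subgrp_def
proof (intro conjI ballI)
  show "0 \<in> scale x A" using subgrpD(1)[OF assms] by (intro image_eqI[of _ _ 0]) auto
  fix y z assume "y \<in> scale x A" "z \<in> scale x A"
  then obtain a b where "y = x * a" "z = x * b" "a \<in> A" "b \<in> A" by blast
  then show "y - z \<in> scale x A"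
    using subgrpD(2)[OF assms] by (intro image_eqI[of _ _ "a - b"]) (auto simp: right_diff_distrib)
qed

lemma index_scale:
  assumes "subgrp B" "x \<noteq> 0"
  shows "index (scale x A) (scale x B) = index A B"
proof -
  obtain T where T: "transversal A B T" using transversal_exists[OF assms(1)] .
  have "transversal (scale x A) (scale x B) (scale x T)"
    unfolding transversal_def
  proof (intro conjI ballI)
    show "scale x T \<subseteq> scale x A" using T by (auto simp: transversal_def)
    fix y assume "y \<in> scale x A"
    then obtain a where a: "a \<in> A" "y = x * a" by blast
    have *: "y - x * t \<in> scale x B \<longleftrightarrow> a - t \<in> B" for t
      using assms(2) by (simp add: mem_scale_iff a diff_divide_distrib)
    obtain t where t: "t \<in> T" "a - t \<in> B" using T a unfolding transversal_def by blast
    show "\<exists>!u. u \<in> scale x T \<and> y - u \<in> scale x B"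
      by (rule ex1I[of _ "x * t"]) (use t * transversal_unique[OF T a(1)] in auto)
  qed
  moreover have "inj_on ((*) x) T" using assms(2) by (auto simp: inj_on_def)
  ultimately show ?thesis
    using index_transversal[OF subgrp_scale[OF assms(1)]] index_transversal[OF assms(1) T]
    by (metis card_image)
qed

lemma index_self: "subgrp A \<Longrightarrow> index A A = 1"
proof -
  assume A: "subgrp A"
  have "transversal A A {0}" using A by (auto simp: transversal_def subgrp_def)
  from index_transversal[OF A this] show ?thesis by simp
qed

lemma index_1_imp_eq:
  assumes "subgrp A" "subgrp B" "B \<subseteq> A" "index A B = 1"
  shows "A = B"
proof (intro equalityI assms(3) subsetI)
  fix x assume x: "x \<in> A"
  obtain T where T: "transversal A B T" using transversal_exists[OF assms(2)] .
  have "card T = 1" using index_transversal[OF assms(2) T] assms(4) by simp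
  then obtain t where t: "T = {t}" by (auto simp: card_Suc_eq numeral_eq_Suc)
  have "x - t \<in> B" "0 - t \<in> B"
    using T x subgrpD(1)[OF assms(1)] unfolding transversal_def t by blast+
  then have "(x - t) - (0 - t) \<in> B" by (rule subgrpD(2)[OF assms(2)])
  then show "x \<in> B" by simp
qed

text \<open>By pigeonhole on the multiples of \<open>x\<close>.\<close>

lemma fact_index_mult_mem:
  fixes A B :: "'a::comm_ring_1 set"
  assumes A: "subgrp A" and B: "subgrp B" and mul: "\<And>k x. x \<in> B \<Longrightarrow> of_nat k * x \<in> B"
    and A': "\<And>k x. x \<in> A \<Longrightarrow> of_nat k * x \<in> A"
    and m: "index A B \<le> m" "index A B > 0" and x: "x \<in> A"
  shows "of_nat (fact m) * x \<in> B"
proof -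
  obtain T where T: "transversal A B T" using transversal_exists[OF B] .
  have cT: "card T = index A B" using index_transversal[OF B T] by simp
  then have fT: "finite T" using m by (metis card_gt_0_iff)
  have "\<forall>k. \<exists>t. t \<in> T \<and> of_nat k * x - t \<in> B" using T A' x unfolding transversal_def by blast
  then obtain t where t: "\<And>k. t k \<in> T" "\<And>k. of_nat k * x - t k \<in> B" by metis
  have "\<not> inj_on t {..m}"
  proof
    assume "inj_on t {..m}"
    then have "card {..m} \<le> card T" using t fT by (intro card_inj_on_le) auto
    then show False using cT m by simp
  qed
  then obtain i j where ij: "i \<le> m" "j \<le> m" "i < j" "t i = t j"
    unfolding inj_on_def by (metis atMost_iff linorder_neqE_nat)
  have "(of_nat j * x - t j) - (of_nat i * x - t i) \<in> B" by (intro subgrpD(2)[OF B] t)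
  then have "of_nat (j - i) * x \<in> B" using ij by (simp add: of_nat_diff algebra_simps)
  moreover have "(j - i) dvd fact m" using ij by (intro dvd_fact) auto
  then obtain k where "fact m = k * (j - i)" by (auto simp: dvd_def mult.commute)
  ultimately show ?thesis using mul[of "of_nat (j - i) * x" k] by (simp add: mult.assoc)
qed

section \<open>Ideals and their norms\<close>

abbreviation integers :: "'a::number_field set" ("\<O>") where "\<O> \<equiv> ring_of_integers"

lemma integers_closed [simp, intro]:
  "0 \<in> \<O>" "1 \<in> \<O>" "x \<in> \<O> \<Longrightarrow> y \<in> \<O> \<Longrightarrow> x + y \<in> \<O>" "x \<in> \<O> \<Longrightarrow> y \<in> \<O> \<Longrightarrow> x * y \<in> \<O>"
  "x \<in> \<O> \<Longrightarrow> - x \<in> \<O>" "of_int k \<in> \<O>" "of_nat n \<in> \<O>"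
  using int_imp_algebraic_int[OF Ints_of_nat[of n]]
  by (auto simp: ring_of_integers_def algebraic_int_add_mult int_imp_algebraic_int)

lemma integers_diff [simp, intro]: "x \<in> \<O> \<Longrightarrow> y \<in> \<O> \<Longrightarrow> x - y \<in> \<O>"
  using integers_closed(3)[of x "- y"] by auto

lemma integers_power [simp, intro]: "x \<in> \<O> \<Longrightarrow> x ^ k \<in> \<O>"
  by (induction k) auto

lemma integer_multiple:
  fixes x :: "'a::number_field"
  obtains k :: nat where "k > 0" "of_nat k * x \<in> \<O>"
proof -
  obtain k :: int where k: "k \<noteq> 0" "algebraic_int (of_int k * x)"
    using algebraic_int_multiple[OF algebraic_number_field] by blast
  have "of_int k * x \<in> \<O>" using k by (simp add: ring_of_integers_def)
  show ?thesis
  proof (cases "k > 0")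
    case True
    then have "of_nat (nat k) * x = of_int k * x" by simp
    then show ?thesis using True \<open>of_int k * x \<in> \<O>\<close> that[of "nat k"] by simp
  next
    case False
    then have "of_nat (nat (- k)) * x = - (of_int k * x)" by simp
    then show ?thesis using False k(1) integers_closed(5)[OF \<open>of_int k * x \<in> \<O>\<close>] that[of "nat (- k)"] by simp
  qed
qed

definition omodule :: "'a::number_field set \<Rightarrow> bool" where
  "omodule A \<longleftrightarrow> 0 \<in> A \<and> (\<forall>x\<in>A. \<forall>y\<in>A. x + y \<in> A) \<and> (\<forall>a\<in>\<O>. \<forall>x\<in>A. a * x \<in> A)"

lemma fractional_ideal_altdef:
  "fractional_ideal I \<longleftrightarrow> omodule I \<and> (\<exists>d\<in>\<O>. d \<noteq> 0 \<and> scale d I \<subseteq> \<O>)"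
  by (auto simp: fractional_ideal_def omodule_def image_subset_iff)

lemma omoduleD:
  assumes "omodule A"
  shows "0 \<in> A" "x \<in> A \<Longrightarrow> y \<in> A \<Longrightarrow> x + y \<in> A" "a \<in> \<O> \<Longrightarrow> x \<in> A \<Longrightarrow> a * x \<in> A"
  using assms by (auto simp: omodule_def)

lemma omodule_subgrp: "omodule A \<Longrightarrow> subgrp A"
  unfolding subgrp_def
proof (intro conjI ballI)
  assume A: "omodule A"
  fix x y assume "x \<in> A" "y \<in> A"
  then have "x + (- 1) * y \<in> A" using A by (intro omoduleD) auto
  then show "x - y \<in> A" by simp
qed (auto simp: omodule_def)

lemma omodule_integers [simp]: "omodule \<O>"
  by (auto simp: omodule_def)

lemma subgrp_integers [simp]: "subgrp \<O>"
  by (rule omodule_subgrp) simp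

lemma omodule_scale: "omodule A \<Longrightarrow> omodule (scale x A)"
  unfolding omodule_def
proof (intro conjI ballI, goal_cases)
  case 1
  then show ?case by (auto intro: image_eqI[of _ _ 0])
next
  case (2 y z)
  then obtain a b where "y = x * a" "z = x * b" "a \<in> A" "b \<in> A" by blast
  then show ?case using 2 by (intro image_eqI[of _ _ "a + b"]) (auto simp: distrib_left)
next
  case (3 c y)
  then obtain a where "y = x * a" "a \<in> A" by blast
  then show ?case using 3 by (intro image_eqI[of _ _ "c * a"]) auto
qed

text \<open>Reducing the coordinates in an integral basis modulo \<open>k\<close> gives the
  representatives, with \<open>k\<close> choices in each coordinate.\<close>

lemma index_nat_multiple:
  assumes k: "k > 0"
  shows "index (\<O> :: 'a::number_field set) (scale (of_nat k) \<O>) = k ^ field_degree TYPE('a)"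
proof -
  obtain b :: "'a emb \<Rightarrow> 'a" where b: "Determinants.det (emb_matrix b) \<noteq> 0"
    "\<O> = {\<Sum>j\<in>UNIV. of_int (c j) * b j | c. True}"
    by (rule integral_emb_basis_exists)
  define s where "s c = (\<Sum>j\<in>UNIV. of_int (c j) * b j)" for c :: "'a emb \<Rightarrow> int"
  have sO: "s c \<in> \<O>" for c unfolding b(2) s_def by blast
  have inj: "c j = c' j" if "s c = s c'" for c c' j
  proof -
    have "(\<Sum>j\<in>UNIV. of_rat (of_int (c j - c' j)) * b j) = 0"
      using that by (simp add: s_def of_rat_diff left_diff_distrib sum_subtractf)
    from spanning_of_det_emb_matrix(2)[OF b(1) this, of j] show ?thesis by simp
  qed
  define F where "F = (UNIV :: 'a emb set) \<rightarrow>\<^sub>E {0..<int k}"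
  have "transversal \<O> (scale (of_nat k) \<O>) (s ` F)"
    unfolding transversal_def
  proof (intro conjI ballI)
    show "s ` F \<subseteq> \<O>" using sO by blast
    fix x :: 'a assume "x \<in> \<O>"
    then obtain c where c: "x = s c" unfolding b(2) s_def by blast
    define r where "r j = c j mod int k" for j
    have sr: "s c - s r = of_nat k * s (\<lambda>j. c j div int k)"
    proof -
      have "of_int (c j) - of_int (r j) = (of_nat k * of_int (c j div int k) :: 'a)" for j
      proof -
        have "c j - r j = int k * (c j div int k)" by (simp add: r_def minus_mod_eq_mult_div)
        then have "(of_int (c j - r j) :: 'a) = of_int (int k * (c j div int k))" by simp
        then show ?thesis by simp
      qed
      then show ?thesis
        by (simp add: s_def sum_subtractf[symmetric] left_diff_distrib[symmetric] sum_distrib_left mult.assoc)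
    qed
    show "\<exists>!t. t \<in> s ` F \<and> x - t \<in> scale (of_nat k) \<O>"
    proof (rule ex1I[of _ "s r"])
      show "s r \<in> s ` F \<and> x - s r \<in> scale (of_nat k) \<O>"
        using sr sO k by (auto simp: c F_def r_def)
      fix t assume t: "t \<in> s ` F \<and> x - t \<in> scale (of_nat k) \<O>"
      then obtain c' where c': "c' \<in> F" "t = s c'" by blast
      from t obtain y where y: "y \<in> \<O>" "x - t = of_nat k * y" by blast
      then obtain e where e: "y = s e" unfolding b(2) s_def by blast
      have "s c = s (\<lambda>j. c' j + int k * e j)"
        using y(2) by (simp add: c c' e s_def distrib_right sum.distrib sum_distrib_left mult.assoc algebra_simps)
      then have "c j = c' j + int k * e j" for j by (rule inj)
      moreover have "c' j \<in> {0..<int k}" for j using c' by (auto simp: F_def)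
      ultimately have "r j = c' j" for j by (simp add: r_def)
      then show "t = s r" using c' by (metis ext)
    qed
  qed
  then have "index \<O> (scale (of_nat k :: 'a) \<O>) = card (s ` F)"
    by (intro index_transversal subgrp_scale) auto
  also have "\<dots> = card F"
    by (rule card_image) (auto intro!: inj_onI inj)
  also have "\<dots> = k ^ field_degree TYPE('a)"
    by (simp add: F_def card_PiE card_emb)
  finally show ?thesis .
qed

text \<open>Multiplying \<open>x\<close> by an integral multiple of its inverse puts a positive
  integer \<open>k\<close> into \<open>J\<close>, so \<open>J\<close> contains the subgroup
  \<open>k \<O>\<close> of finite index.\<close>

lemma index_integral_ideal_pos:
  assumes J: "omodule J" "J \<subseteq> \<O>" "x \<in> J" "x \<noteq> (0 :: 'a::number_field)"
  shows "index \<O> J > 0"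
proof -
  obtain k where k: "k > 0" "of_nat k * inverse x \<in> \<O>" by (rule integer_multiple)
  have "of_nat k * inverse x * x \<in> J" by (rule omoduleD(3)[OF J(1) k(2) J(3)])
  then have kJ: "of_nat k \<in> J" using J(4) by (simp add: mult.assoc)
  have sub: "scale (of_nat k :: 'a) \<O> \<subseteq> J"
  proof
    fix y :: 'a assume "y \<in> scale (of_nat k) \<O>"
    then obtain z where "y = of_nat k * z" "z \<in> \<O>" by blast
    then show "y \<in> J" using omoduleD(3)[OF J(1) _ kJ, of z] by (simp add: mult.commute)
  qed
  have "index \<O> (scale (of_nat k :: 'a) \<O>) = index \<O> J * index J (scale (of_nat k) \<O>)"
    using J sub by (intro index_mult omodule_subgrp omodule_scale) auto
  moreover have "index \<O> (scale (of_nat k :: 'a) \<O>) > 0" using k by (simp add: index_nat_multiple)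
  ultimately show ?thesis by (metis gr0I mult_0)
qed

section \<open>Absolute norms of elements and of principal ideals\<close>

definition elem_norm :: "'a::number_field \<Rightarrow> real" where
  "elem_norm x = (\<Prod>P\<in>infinite_primes. prime_abs P x ^ prime_deg P)"

lemma elem_norm_mult: "elem_norm (x * y) = elem_norm x * elem_norm y"
  by (simp add: elem_norm_def prod.distrib[symmetric] prime_abs_simps power_mult_distrib)

lemma elem_norm_1 [simp]: "elem_norm 1 = 1"
  by (simp add: elem_norm_def prime_abs_simps)

lemma elem_norm_inverse: "elem_norm (inverse x) = inverse (elem_norm x)"
  by (simp add: elem_norm_def prime_abs_simps power_inverse prod_inversef[unfolded o_def, symmetric])

lemma elem_norm_power: "elem_norm (x ^ k) = elem_norm x ^ k"
  by (induction k) (auto simp: elem_norm_mult)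

lemma elem_norm_pos: "x \<noteq> 0 \<Longrightarrow> elem_norm x > 0"
  unfolding elem_norm_def by (intro prod_pos) (auto simp: prime_abs_simps)

lemma prod_const_prime_deg:
  "(\<Prod>P\<in>(infinite_primes :: 'a::number_field infinite_prime set). c ^ prime_deg P) = c ^ field_degree TYPE('a)"
  by (simp add: power_sum[symmetric] sum_prime_deg)

lemma elem_norm_of_nat: "elem_norm (of_nat k :: 'a::number_field) = real k ^ field_degree TYPE('a)"
proof -
  have "prime_abs P (of_nat k) = real k" if "P \<in> infinite_primes" for P :: "'a infinite_prime"
    using prime_abs_simps(7)[OF that, of "int k"] by simp
  then have "elem_norm (of_nat k :: 'a) = (\<Prod>P\<in>(infinite_primes :: 'a infinite_prime set). real k ^ prime_deg P)"
    unfolding elem_norm_def by (intro prod.cong) auto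
  then show ?thesis by (simp only: prod_const_prime_deg)
qed

lemma index_principal_mult:
  fixes x y :: "'a::number_field"
  assumes "x \<in> \<O>" "y \<in> \<O>" "x \<noteq> 0"
  shows "index \<O> (scale (x * y) \<O>) = index \<O> (scale x \<O>) * index \<O> (scale y \<O>)"
proof -
  have "index \<O> (scale (x * y) \<O>) = index \<O> (scale x \<O>) * index (scale x \<O>) (scale (x * y) \<O>)"
    using assms by (intro index_mult subgrp_scale) auto
  also have "scale (x * y) \<O> = scale x (scale y \<O>)" by (rule scale_scale[symmetric])
  also have "index (scale x \<O>) (scale x (scale y \<O>)) = index \<O> (scale y \<O>)"
    using assms by (intro index_scale subgrp_scale) auto
  finally show ?thesis by (simp add: scale_scale)
qed

lemma index_principal_pos: "x \<in> \<O> \<Longrightarrow> x \<noteq> 0 \<Longrightarrow> index \<O> (scale x \<O>) > 0"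
  by (rule index_integral_ideal_pos[where x = x])
    (auto intro: omodule_scale image_eqI[of _ _ 1])

lemma minkowski_integral:
  fixes J :: "'a::number_field set" and c :: "'a infinite_prime \<Rightarrow> real"
  assumes J: "omodule J" "J \<subseteq> \<O>" "J \<noteq> {0}"
    and c: "\<And>P. P \<in> infinite_primes \<Longrightarrow> c P > 0"
    and big: "(\<Prod>P\<in>infinite_primes. c P ^ prime_deg P) > del_const TYPE('a) * index \<O> J"
  obtains f where "f \<in> J" "f \<noteq> 0" "\<And>P. P \<in> infinite_primes \<Longrightarrow> prime_abs P f < c P"
proof -
  obtain x where x: "x \<in> J" "x \<noteq> 0" using J omoduleD(1) by blast
  have "index \<O> J > 0" by (rule index_integral_ideal_pos[OF J(1,2) x])
  then have fin: "finite (\<O> // {(x, y). x \<in> \<O> \<and> y \<in> \<O> \<and> x - y \<in> J})"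
    unfolding index_def by (rule card_ge_0_finite)
  note sg = omodule_subgrp[OF J(1)]
  show ?thesis
    by (rule minkowski[OF subgrpD(1)[OF sg] subgrpD(2)[OF sg] fin c big]) (auto intro: that)
qed

text \<open>Minkowski's theorem in \<open>y \<O>\<close> gives a nonzero multiple of
  \<open>y\<close> whose norm is at most a constant times the index, and a nonzero integral cofactor
  cannot lower the norm. For \<open>y = x ^ k\<close> norm and index are \<open>k\<close>-th powers,
  so letting \<open>k\<close> grow removes the constant.\<close>

lemma elem_norm_le_index:
  fixes x :: "'a::number_field"
  assumes x: "x \<in> \<O>" "x \<noteq> 0"
  shows "elem_norm x \<le> index \<O> (scale x \<O>)"
proof -
  \<comment> \<open>Adding 1 to the constant makes the volume condition strict.\<close>
  let ?n = "field_degree TYPE('a)" and ?D = "del_const TYPE('a) + 1"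
  have rough: "elem_norm y \<le> ?D * index \<O> (scale y \<O>)" if y: "y \<in> \<O>" "y \<noteq> 0" for y :: 'a
  proof -
    let ?i = "real (index \<O> (scale y \<O>))"
    have i: "?i \<ge> 1" using index_principal_pos[OF y] by simp
    define c where "c = root ?n (?D * ?i)"
    have D: "?D * ?i > 0" using i del_const_pos[where 'a = 'a] by (intro mult_pos_pos) auto
    then have c: "c > 0" "c ^ ?n = ?D * ?i" using field_degree_pos[where 'a = 'a] by (auto simp: c_def)
    have "(\<Prod>P\<in>(infinite_primes :: 'a infinite_prime set). c ^ prime_deg P) > del_const TYPE('a) * index \<O> (scale y \<O>)"
      unfolding prod_const_prime_deg c(2) using i by (simp add: distrib_right)
    then obtain f where f: "f \<in> scale y \<O>" "f \<noteq> 0" "\<And>P. P \<in> infinite_primes \<Longrightarrow> prime_abs P f < c"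
    proof (rule minkowski_integral[rotated 4])
      show "omodule (scale y \<O>)" by (simp add: omodule_scale)
      show "scale y \<O> \<subseteq> \<O>" using y by auto
      show "scale y \<O> \<noteq> {0}" using y integers_closed(2) by (auto simp: image_iff set_eq_iff)
    qed (use c in auto)
    then obtain h where h: "h \<in> \<O>" "f = y * h" "h \<noteq> 0" by auto
    have "elem_norm y \<le> elem_norm y * elem_norm h"
      using prod_prime_abs_ge_1[OF h(1,3)] elem_norm_pos[OF y(2)] by (simp add: elem_norm_def)
    also have "\<dots> = elem_norm f" by (simp add: h elem_norm_mult)
    also have "\<dots> \<le> (\<Prod>P\<in>(infinite_primes :: 'a infinite_prime set). c ^ prime_deg P)"
      unfolding elem_norm_def using f(3)
      by (intro prod_mono conjI power_mono) (auto simp: prime_abs_simps less_imp_le)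
    finally show ?thesis unfolding prod_const_prime_deg c(2) .
  qed
  have ind: "index \<O> (scale (x ^ k) \<O>) = index \<O> (scale x \<O>) ^ k" for k
  proof (induction k)
    case 0
    then show ?case by (simp add: index_self)
  next
    case (Suc k)
    then show ?case using x index_principal_mult[of x "x ^ k"] by simp
  qed
  show ?thesis
  proof (rule ccontr)
    assume less: "\<not> elem_norm x \<le> index \<O> (scale x \<O>)"
    define r where "r = elem_norm x / index \<O> (scale x \<O>)"
    have "real (index \<O> (scale x \<O>)) > 0" using index_principal_pos[OF x] by simp
    then have "r > 1" using less unfolding r_def by (subst less_divide_eq_1_pos) auto
    then obtain k where k: "?D < r ^ k" using real_arch_pow by blast
    have "elem_norm (x ^ k) \<le> ?D * index \<O> (scale (x ^ k) \<O>)" using x by (intro rough) auto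
    then have "r ^ k \<le> ?D"
      using index_principal_pos[OF x] by (simp add: elem_norm_power ind r_def power_divide divide_le_eq)
    with k show False by simp
  qed
qed

text \<open>A suitable integral \<open>y\<close> makes \<open>x * y\<close> a natural number, for
  which index and norm agree. As norm \<le> index holds for both factors, equality of the products
  forces equality for each.\<close>

lemma index_principal:
  fixes x :: "'a::number_field"
  assumes x: "x \<in> \<O>" "x \<noteq> 0"
  shows "index \<O> (scale x \<O>) = elem_norm x"
proof -
  obtain k where k: "k > 0" "of_nat k * inverse x \<in> \<O>" by (rule integer_multiple)
  define y where "y = of_nat k * inverse x"
  have y: "y \<in> \<O>" "y \<noteq> 0" "x * y = of_nat k" using k x by (auto simp: y_def)
  have "real (index \<O> (scale x \<O>)) * real (index \<O> (scale y \<O>)) = elem_norm x * elem_norm y"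
    using index_principal_mult[OF x(1) y(1) x(2)] index_nat_multiple[OF k(1), where 'a = 'a]
    by (simp add: y(3) elem_norm_mult[symmetric] elem_norm_of_nat of_nat_mult[symmetric] del: of_nat_mult)
  moreover have "elem_norm x \<le> index \<O> (scale x \<O>)" "elem_norm y \<le> index \<O> (scale y \<O>)"
    using x y elem_norm_le_index by auto
  moreover have "elem_norm x > 0" "elem_norm y > 0" using x y elem_norm_pos by auto
  ultimately show ?thesis by (smt (verit, best) mult_less_le_imp_less)
qed

text \<open>The denominator inside \<open>ideal_norm\<close> is an arbitrary choice
  \<open>e\<close>. Computing the index of \<open>d e I\<close> once through \<open>d\<close> and
  once through \<open>e\<close> shows that all denominators give the same quotient.\<close>

lemma ideal_norm_eq:
  fixes I :: "'a::number_field set"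
  assumes I: "omodule I" "I \<noteq> {0}" and d: "d \<in> \<O>" "d \<noteq> 0" "scale d I \<subseteq> \<O>"
  shows "ideal_norm I = index \<O> (scale d I) / elem_norm d"
proof -
  define e where "e = (SOME d. d \<in> \<O> \<and> d \<noteq> 0 \<and> (\<lambda>x. d * x) ` I \<subseteq> \<O>)"
  have e: "e \<in> \<O> \<and> e \<noteq> 0 \<and> (\<lambda>x. e * x) ` I \<subseteq> \<O>"
    unfolding e_def by (rule someI[of _ d]) (use d in auto)
  have "ideal_norm I = index \<O> (scale e I) / index \<O> (scale e \<O>)"
    unfolding ideal_norm_def Let_def e_def[symmetric] by (simp add: integral_ideal_norm_def index_def)
  also have "\<dots> = index \<O> (scale e I) / elem_norm e" using e by (simp add: index_principal)
  finally have N: "ideal_norm I = index \<O> (scale e I) / elem_norm e" .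
  have *: "index \<O> (scale (u * v) I) = index \<O> (scale u \<O>) * index \<O> (scale v I)"
    if "u \<in> \<O>" "u \<noteq> 0" "scale v I \<subseteq> \<O>" for u v
  proof -
    have "index \<O> (scale u (scale v I)) = index \<O> (scale u \<O>) * index (scale u \<O>) (scale u (scale v I))"
      using that I by (intro index_mult subgrp_scale omodule_subgrp) auto
    also have "index (scale u \<O>) (scale u (scale v I)) = index \<O> (scale v I)"
      using that I by (intro index_scale subgrp_scale omodule_subgrp)
    finally show ?thesis by (simp only: scale_scale)
  qed
  have "elem_norm d * index \<O> (scale e I) = elem_norm e * index \<O> (scale d I)"
    using *[of d e] *[of e d] d e by (simp add: mult.commute flip: index_principal of_nat_mult)
  then show ?thesis unfolding N using elem_norm_pos[of d] elem_norm_pos[of e] d e by (simp add: field_simps)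
qed

section \<open>Products of ideals\<close>

lemma ideal_mult_mem: "a \<in> I \<Longrightarrow> b \<in> J \<Longrightarrow> a * b \<in> ideal_mult I J"
  unfolding ideal_mult_def by (rule CollectI, rule exI[of _ 1], rule exI[of _ "\<lambda>_. a"], rule exI[of _ "\<lambda>_. b"]) simp

lemma ideal_mult_0: "0 \<in> ideal_mult I J"
  unfolding ideal_mult_def by (rule CollectI, rule exI[of _ 0]) simp

lemma ideal_mult_add:
  assumes "x \<in> ideal_mult I J" "y \<in> ideal_mult I J"
  shows "x + y \<in> ideal_mult I J"
proof -
  obtain k :: nat and a b where x: "x = (\<Sum>i<k. a i * b i)" "\<forall>i<k. a i \<in> I" "\<forall>i<k. b i \<in> J"
    using assms(1) by (auto simp: ideal_mult_def)
  obtain l :: nat and c d where y: "y = (\<Sum>i<l. c i * d i)" "\<forall>i<l. c i \<in> I" "\<forall>i<l. d i \<in> J"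
    using assms(2) by (auto simp: ideal_mult_def)
  define p where "p i = (if i < k then a i else c (i - k))" for i
  define q where "q i = (if i < k then b i else d (i - k))" for i
  have "(\<Sum>i<k + l. p i * q i) = (\<Sum>i<k. p i * q i) + (\<Sum>i<l. p (k + i) * q (k + i))"
    using sum.atLeastLessThan_concat[of 0 k "k + l" "\<lambda>i. p i * q i"]
      sum.shift_bounds_nat_ivl[of "\<lambda>i. p i * q i" 0 k l]
    by (simp add: lessThan_atLeast0 add.commute)
  then have "x + y = (\<Sum>i<k + l. p i * q i)" by (simp add: x y p_def q_def)
  moreover have "\<forall>i<k + l. p i \<in> I" "\<forall>i<k + l. q i \<in> J" using x y by (auto simp: p_def q_def)
  ultimately show ?thesis unfolding ideal_mult_def by blast
qed

lemma ideal_mult_induct [consumes 1, case_names zero add mult]: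
  assumes x: "x \<in> ideal_mult I J" and 0: "Q 0" and add: "\<And>x y. Q x \<Longrightarrow> Q y \<Longrightarrow> Q (x + y)"
    and mult: "\<And>a b. a \<in> I \<Longrightarrow> b \<in> J \<Longrightarrow> Q (a * b)"
  shows "Q x"
proof -
  obtain k :: nat and a b where x: "x = (\<Sum>i<k. a i * b i)" "\<forall>i<k. a i \<in> I" "\<forall>i<k. b i \<in> J"
    using x by (auto simp: ideal_mult_def)
  have "Q (\<Sum>i<m. a i * b i)" if "m \<le> k" for m
    using that by (induction m) (use 0 add mult x in auto)
  then show ?thesis using x by simp
qed

lemma ideal_mult_commute: "ideal_mult I J = ideal_mult J I"
proof -
  have "ideal_mult I J \<subseteq> ideal_mult J I" for I J :: "'a::number_field set"
  proof
    fix x assume "x \<in> ideal_mult I J"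
    then show "x \<in> ideal_mult J I"
    proof (induction rule: ideal_mult_induct)
      case (mult a b)
      then show ?case using ideal_mult_mem[of b J a I] by (simp add: mult.commute)
    qed (auto intro: ideal_mult_0 ideal_mult_add)
  qed
  then show ?thesis by blast
qed

lemma ideal_mult_assoc: "ideal_mult (ideal_mult I J) K = ideal_mult I (ideal_mult J K)"
proof -
  have *: "ideal_mult (ideal_mult I J) K \<subseteq> ideal_mult I (ideal_mult J K)" for I J K :: "'a::number_field set"
  proof
    fix x assume "x \<in> ideal_mult (ideal_mult I J) K"
    then show "x \<in> ideal_mult I (ideal_mult J K)"
    proof (induction rule: ideal_mult_induct)
      case (mult y c)
      from mult(1) show ?case
      proof (induction rule: ideal_mult_induct)
        case (mult a b)
        then have "a * (b * c) \<in> ideal_mult I (ideal_mult J K)"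
          using \<open>c \<in> K\<close> by (intro ideal_mult_mem)
        then show ?case by (simp add: mult.assoc)
      qed (auto intro: ideal_mult_0 ideal_mult_add simp: distrib_right)
    qed (auto intro: ideal_mult_0 ideal_mult_add)
  qed
  have "ideal_mult I (ideal_mult J K) = ideal_mult (ideal_mult K J) I"
    by (metis ideal_mult_commute)
  also have "\<dots> \<subseteq> ideal_mult K (ideal_mult J I)" by (rule *)
  also have "\<dots> = ideal_mult (ideal_mult I J) K" by (metis ideal_mult_commute)
  finally show ?thesis using * by blast
qed

lemma ideal_mult_mono: "I \<subseteq> I' \<Longrightarrow> J \<subseteq> J' \<Longrightarrow> ideal_mult I J \<subseteq> ideal_mult I' J'"
  by (rule subsetI, erule ideal_mult_induct) (auto intro: ideal_mult_0 ideal_mult_add ideal_mult_mem)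

lemma omodule_ideal_mult:
  fixes I :: "'a::number_field set"
  assumes "omodule I"
  shows "omodule (ideal_mult I J)"
  unfolding omodule_def
proof (intro conjI ballI)
  fix c x :: 'a assume c: "c \<in> \<O>" and "x \<in> ideal_mult I J"
  from this(2) show "c * x \<in> ideal_mult I J"
  proof (induction rule: ideal_mult_induct)
    case (mult a b)
    then have "(c * a) * b \<in> ideal_mult I J" using assms c by (intro ideal_mult_mem omoduleD(3))
    then show ?case by (simp add: mult.assoc)
  qed (auto intro: ideal_mult_0 ideal_mult_add simp: distrib_left)
qed (auto intro: ideal_mult_0 ideal_mult_add)

lemma ideal_mult_principal:
  assumes I: "omodule I"
  shows "ideal_mult (scale x \<O>) I = scale x I"
proof (intro equalityI subsetI)
  fix y assume "y \<in> ideal_mult (scale x \<O>) I"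
  then show "y \<in> scale x I"
  proof (induction rule: ideal_mult_induct)
    case (mult a b)
    then obtain c where c: "c \<in> \<O>" "a = x * c" by blast
    then have "c * b \<in> I" using I mult by (intro omoduleD(3))
    then show ?case using c by (auto simp: mult.assoc)
  qed (auto intro: omoduleD[OF omodule_scale[OF I]])
next
  fix y assume "y \<in> scale x I"
  then obtain a where "y = (x * 1) * a" "a \<in> I" by auto
  then show "y \<in> ideal_mult (scale x \<O>) I" by (auto intro!: ideal_mult_mem)
qed

lemma ideal_mult_integers: "omodule I \<Longrightarrow> ideal_mult \<O> I = I"
  using ideal_mult_principal[of I 1] by simp

lemma ideal_mult_scale:
  assumes "omodule I"
  shows "ideal_mult (scale x I) J = scale x (ideal_mult I J)"
proof -
  have "ideal_mult (scale x I) J = ideal_mult (ideal_mult (scale x \<O>) I) J"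
    by (simp only: ideal_mult_principal[OF assms(1)])
  also have "\<dots> = ideal_mult (scale x \<O>) (ideal_mult I J)" by (rule ideal_mult_assoc)
  also have "\<dots> = scale x (ideal_mult I J)" by (intro ideal_mult_principal omodule_ideal_mult assms)
  finally show ?thesis .
qed

section \<open>Fractional ideals and their norms\<close>

definition frac_ideal :: "'a::number_field set \<Rightarrow> bool" where
  "frac_ideal I \<longleftrightarrow> fractional_ideal I \<and> I \<noteq> {0}"

lemma frac_omodule: "frac_ideal I \<Longrightarrow> omodule I"
  by (simp add: frac_ideal_def fractional_ideal_altdef)

lemma frac_nonzero:
  assumes "frac_ideal I"
  obtains x where "x \<in> I" "x \<noteq> 0"
  using assms omoduleD(1)[OF frac_omodule[OF assms]] unfolding frac_ideal_def by blast

lemma frac_denominator: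
  assumes "frac_ideal I"
  obtains d where "d \<in> \<O>" "d \<noteq> 0" "scale d I \<subseteq> \<O>"
  using assms by (auto simp: frac_ideal_def fractional_ideal_altdef)

lemma frac_idealI:
  assumes "omodule I" "x \<in> I" "x \<noteq> 0" "d \<in> \<O>" "d \<noteq> 0" "scale d I \<subseteq> \<O>"
  shows "frac_ideal I"
  using assms by (auto simp: frac_ideal_def fractional_ideal_altdef)

lemma frac_integral: "omodule I \<Longrightarrow> I \<subseteq> \<O> \<Longrightarrow> x \<in> I \<Longrightarrow> x \<noteq> 0 \<Longrightarrow> frac_ideal I"
  by (rule frac_idealI[where d = 1]) auto

lemma frac_integers [simp]: "frac_ideal \<O>"
  by (rule frac_integral[where x = 1]) auto

lemma frac_ideal_mult:
  assumes "frac_ideal I" "frac_ideal J"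
  shows "frac_ideal (ideal_mult I J)"
proof -
  obtain d where d: "d \<in> \<O>" "d \<noteq> 0" "scale d I \<subseteq> \<O>" using frac_denominator[OF assms(1)] .
  obtain e where e: "e \<in> \<O>" "e \<noteq> 0" "scale e J \<subseteq> \<O>" using frac_denominator[OF assms(2)] .
  obtain x where x: "x \<in> I" "x \<noteq> 0" using frac_nonzero[OF assms(1)] .
  obtain y where y: "y \<in> J" "y \<noteq> 0" using frac_nonzero[OF assms(2)] .
  have den: "(d * e) * z \<in> \<O>" if "z \<in> ideal_mult I J" for z
    using that
  proof (induction rule: ideal_mult_induct)
    case (mult a b)
    then have "(d * a) * (e * b) \<in> \<O>" using d e by blast
    then show ?case by (simp add: mult_ac)
  qed (auto simp: distrib_left)
  show ?thesis
  proof (rule frac_idealI)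
    show "omodule (ideal_mult I J)" by (intro omodule_ideal_mult frac_omodule assms)
    show "x * y \<in> ideal_mult I J" by (rule ideal_mult_mem[OF x(1) y(1)])
    show "x * y \<noteq> 0" "d * e \<noteq> 0" using x y d e by auto
    show "d * e \<in> \<O>" by (rule integers_closed(4)[OF d(1) e(1)])
    show "scale (d * e) (ideal_mult I J) \<subseteq> \<O>" using den by blast
  qed
qed

lemma frac_scale:
  assumes "frac_ideal I" "x \<noteq> 0"
  shows "frac_ideal (scale x I)"
proof -
  obtain d where d: "d \<in> \<O>" "d \<noteq> 0" "scale d I \<subseteq> \<O>" using frac_denominator[OF assms(1)] .
  obtain y where y: "y \<in> I" "y \<noteq> 0" using frac_nonzero[OF assms(1)] .
  obtain k where k: "k > 0" "of_nat k * inverse x \<in> \<O>" by (rule integer_multiple)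
  \<comment> \<open>The integral factor \<open>k / x\<close> undoes the scaling by \<open>x\<close>
    up to the integer \<open>k\<close>.\<close>
  have "scale (of_nat k * inverse x * d) (scale x I) \<subseteq> \<O>"
  proof
    fix z assume "z \<in> scale (of_nat k * inverse x * d) (scale x I)"
    then obtain a where "a \<in> I" "z = of_nat k * inverse x * d * (x * a)" by blast
    then have "z = of_nat k * (d * a)" "d * a \<in> \<O>" using assms(2) d by auto
    then show "z \<in> \<O>" by auto
  qed
  then show ?thesis
  proof (rule frac_idealI[rotated 5])
    show "omodule (scale x I)" by (intro omodule_scale frac_omodule assms)
    show "x * y \<in> scale x I" using y by blast
    show "x * y \<noteq> 0" "of_nat k * inverse x * d \<noteq> 0" using y d k assms(2) by auto
    show "of_nat k * inverse x * d \<in> \<O>" by (rule integers_closed(4)[OF k(2) d(1)])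
  qed
qed

lemma ideal_norm_frac:
  assumes "frac_ideal I" "d \<in> \<O>" "d \<noteq> 0" "scale d I \<subseteq> \<O>"
  shows "ideal_norm I = index \<O> (scale d I) / elem_norm d"
  using assms by (intro ideal_norm_eq frac_omodule) (auto simp: frac_ideal_def)

lemma ideal_norm_pos:
  assumes "frac_ideal I"
  shows "ideal_norm I > 0"
proof -
  obtain d where d: "d \<in> \<O>" "d \<noteq> 0" "scale d I \<subseteq> \<O>" using frac_denominator[OF assms] .
  obtain x where x: "x \<in> I" "x \<noteq> 0" using frac_nonzero[OF assms] .
  have "index \<O> (scale d I) > 0"
    using d x by (intro index_integral_ideal_pos[where x = "d * x"] omodule_scale frac_omodule assms) auto
  then show ?thesis unfolding ideal_norm_frac[OF assms d] using elem_norm_pos[OF d(2)] by simp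
qed

lemma ideal_norm_integral: "frac_ideal I \<Longrightarrow> I \<subseteq> \<O> \<Longrightarrow> ideal_norm I = index \<O> I"
  using ideal_norm_frac[of I 1] by simp

lemma ideal_norm_integers: "ideal_norm \<O> = 1"
  by (simp add: ideal_norm_integral index_self)

lemma ideal_norm_scale:
  fixes I :: "'a::number_field set"
  assumes I: "frac_ideal I" and x: "x \<noteq> 0"
  shows "ideal_norm (scale x I) = elem_norm x * ideal_norm I"
proof -
  obtain d where d: "d \<in> \<O>" "d \<noteq> 0" "scale d I \<subseteq> \<O>" using frac_denominator[OF I] .
  obtain k where k: "k > 0" "of_nat k * inverse x \<in> \<O>" by (rule integer_multiple)
  define e where "e = of_nat k * inverse x * d"
  have ex: "e * x = of_nat k * d" using x by (simp add: e_def)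
  then have eq: "scale e (scale x I) = scale (of_nat k) (scale d I)" by (simp only: scale_scale)
  have e: "e \<in> \<O>" "e \<noteq> 0" "scale e (scale x I) \<subseteq> \<O>"
    using d k x unfolding eq by (auto simp: e_def)
  have "index \<O> (scale (of_nat k) (scale d I)) =
      index \<O> (scale (of_nat k :: 'a) \<O>) * index (scale (of_nat k) \<O>) (scale (of_nat k) (scale d I))"
    using d by (intro index_mult subgrp_scale omodule_subgrp frac_omodule I) auto
  also have "index (scale (of_nat k) \<O>) (scale (of_nat k) (scale d I)) = index \<O> (scale d I)"
    using k by (intro index_scale subgrp_scale omodule_subgrp frac_omodule I) auto
  finally have "index \<O> (scale e (scale x I)) = elem_norm (of_nat k :: 'a) * index \<O> (scale d I)"
    using k by (simp add: eq index_principal)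
  moreover have "elem_norm e * elem_norm x = elem_norm (of_nat k :: 'a) * elem_norm d"
    by (simp only: elem_norm_mult[symmetric] ex)
  ultimately show ?thesis
    unfolding ideal_norm_frac[OF frac_scale[OF I x] e] ideal_norm_frac[OF I d]
    using elem_norm_pos[OF x] elem_norm_pos[OF d(2)] elem_norm_pos[OF e(2)] by (simp add: field_simps)
qed

text \<open>The integral case applied to \<open>d I\<close>, with bounds multiplied by the absolute
  values of the denominator \<open>d\<close>.\<close>

lemma minkowski_ideal:
  fixes I :: "'a::number_field set" and c :: "'a infinite_prime \<Rightarrow> real"
  assumes I: "frac_ideal I" and c: "\<And>P. P \<in> infinite_primes \<Longrightarrow> c P > 0"
    and big: "(\<Prod>P\<in>infinite_primes. c P ^ prime_deg P) > del_const TYPE('a) * ideal_norm I"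
  obtains f where "f \<in> I" "f \<noteq> 0" "\<And>P. P \<in> infinite_primes \<Longrightarrow> prime_abs P f < c P"
proof -
  obtain d where d: "d \<in> \<O>" "d \<noteq> 0" "scale d I \<subseteq> \<O>" using frac_denominator[OF I] .
  have "(\<Prod>P\<in>infinite_primes. (c P * prime_abs P d) ^ prime_deg P) =
      (\<Prod>P\<in>infinite_primes. c P ^ prime_deg P) * elem_norm d"
    by (simp add: elem_norm_def power_mult_distrib prod.distrib)
  also have "\<dots> > del_const TYPE('a) * ideal_norm I * elem_norm d"
    using big elem_norm_pos[OF d(2)] by simp
  also have "del_const TYPE('a) * ideal_norm I * elem_norm d = del_const TYPE('a) * index \<O> (scale d I)"
    unfolding ideal_norm_frac[OF I d] using elem_norm_pos[OF d(2)] by simp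
  finally have big': "(\<Prod>P\<in>infinite_primes. (c P * prime_abs P d) ^ prime_deg P) > del_const TYPE('a) * index \<O> (scale d I)" .
  have "scale d I \<noteq> {0}" using frac_scale[OF I d(2)] by (simp add: frac_ideal_def)
  then obtain f where f: "f \<in> scale d I" "f \<noteq> 0" "\<And>P. P \<in> infinite_primes \<Longrightarrow> prime_abs P f < c P * prime_abs P d"
    using minkowski_integral[OF omodule_scale[OF frac_omodule[OF I]] d(3) _ _ big'] c d(2)
    by (metis mult_pos_pos prime_abs_simps(8))
  then obtain g where g: "g \<in> I" "f = d * g" by blast
  show ?thesis
  proof (rule that[OF g(1)])
    show "g \<noteq> 0" using f g by auto
    fix P :: "'a infinite_prime" assume P: "P \<in> infinite_primes"
    then have "prime_abs P g * prime_abs P d < c P * prime_abs P d"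
      using f(3)[OF P] by (simp add: g prime_abs_simps mult.commute)
    then show "prime_abs P g < c P" using P d(2) by (simp add: prime_abs_simps mult_less_cancel_right)
  qed
qed

section \<open>Finiteness of the class group and invertibility of ideals\<close>

text \<open>Dividing \<open>I\<close> by an element of \<open>I\<close> of small norm gives a member
  of the class that contains \<O>. The lower bound on its norm will bound its index over
  \<O>.\<close>

lemma frac_multiple_contains_integers:
  fixes I :: "'a::number_field set"
  assumes I: "frac_ideal I"
  obtains f where "f \<noteq> 0" "\<O> \<subseteq> scale f I" "ideal_norm (scale f I) * (del_const TYPE('a) + 1) \<ge> 1"
proof -
  let ?n = "field_degree TYPE('a)" and ?D = "del_const TYPE('a) + 1"
  define c where "c = root ?n (?D * ideal_norm I)"
  have D: "?D * ideal_norm I > 0" using del_const_pos[where 'a = 'a] ideal_norm_pos[OF I] by simp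
  then have c: "c > 0" "c ^ ?n = ?D * ideal_norm I" using field_degree_pos[where 'a = 'a] by (auto simp: c_def)
  have "(\<Prod>P\<in>(infinite_primes :: 'a infinite_prime set). c ^ prime_deg P) > del_const TYPE('a) * ideal_norm I"
    unfolding prod_const_prime_deg c(2) using ideal_norm_pos[OF I] by (simp add: distrib_right)
  then obtain f where f: "f \<in> I" "f \<noteq> 0" "\<And>P. P \<in> infinite_primes \<Longrightarrow> prime_abs P f < c"
    using minkowski_ideal[OF I, of "\<lambda>_. c"] c(1) by metis
  have "\<O> \<subseteq> scale (inverse f) I"
  proof
    fix x :: 'a assume "x \<in> \<O>"
    then have "x * f \<in> I" using f omoduleD(3)[OF frac_omodule[OF I]] by blast
    then show "x \<in> scale (inverse f) I" using f by (simp add: mem_scale_iff divide_inverse)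
  qed
  have "elem_norm f \<le> (\<Prod>P\<in>(infinite_primes :: 'a infinite_prime set). c ^ prime_deg P)"
    unfolding elem_norm_def using f(3)
    by (intro prod_mono conjI power_mono) (auto simp: prime_abs_simps less_imp_le)
  then have "elem_norm f \<le> ?D * ideal_norm I" unfolding prod_const_prime_deg c(2) .
  then have "1 \<le> ?D * ideal_norm I / elem_norm f" using elem_norm_pos[OF f(2)] by (simp add: le_divide_eq_1_pos)
  moreover have "ideal_norm (scale (inverse f) I) = inverse (elem_norm f) * ideal_norm I"
    using ideal_norm_scale[OF I, of "inverse f"] f(2) by (simp only: elem_norm_inverse) simp
  ultimately have "ideal_norm (scale (inverse f) I) * ?D \<ge> 1" by (simp only: divide_inverse mult_ac)
  with \<open>\<O> \<subseteq> scale (inverse f) I\<close> show ?thesis using f(2) by (intro that[of "inverse f"]) simp_all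
qed

text \<open>For a denominator \<open>d\<close> this is multiplicativity of the index along
  \<open>d \<O> \<subseteq> d J \<subseteq> \<O>\<close>.\<close>

lemma ideal_norm_mult_index:
  fixes J :: "'a::number_field set"
  assumes J: "frac_ideal J" and sub: "\<O> \<subseteq> J"
  shows "ideal_norm J * index J \<O> = 1"
proof -
  obtain d where d: "d \<in> \<O>" "d \<noteq> 0" "scale d J \<subseteq> \<O>" using frac_denominator[OF J] .
  have "index \<O> (scale d \<O>) = index \<O> (scale d J) * index (scale d J) (scale d \<O>)"
    using d sub by (intro index_mult subgrp_scale omodule_subgrp frac_omodule J) auto
  also have "index (scale d J) (scale d \<O>) = index J \<O>" using d by (intro index_scale) auto
  finally have "elem_norm d = real (index \<O> (scale d J)) * real (index J \<O>)"
    using d by (simp flip: index_principal of_nat_mult)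
  then have "ideal_norm J * index J \<O> = elem_norm d / elem_norm d"
    by (simp only: ideal_norm_frac[OF J d] times_divide_eq_left)
  then show ?thesis using elem_norm_pos[OF d(2)] by simp
qed

text \<open>Each class has a representative \<open>J\<close> containing \<O> with index at most
  \<open>m\<close>. Then \<open>M = m!\<close> maps \<open>J\<close> into \<O>, and
  \<open>M J\<close>, lying between \<open>M \<O>\<close> and \<O>, corresponds to a subset of a
  finite quotient.\<close>

lemma finite_ideal_classes:
  "\<exists>F :: 'a::number_field set set. finite F \<and> (\<forall>I. frac_ideal I \<longrightarrow> (\<exists>f J. f \<noteq> 0 \<and> J \<in> F \<and> I = scale f J))"
proof -
  define m where "m = nat \<lceil>del_const TYPE('a) + 1\<rceil>"
  define M :: 'a where "M = of_nat (fact m)"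
  have M: "M \<noteq> 0" "M \<in> \<O>" by (simp_all add: M_def del: of_nat_fact)
  define F where "F = {J :: 'a set. subgrp J \<and> \<O> \<subseteq> J \<and> scale M J \<subseteq> \<O>}"
  define R where "R = {(x, y). x \<in> \<O> \<and> y \<in> \<O> \<and> x - y \<in> scale M \<O>}"
  have "index \<O> (scale M \<O>) > 0" using M by (intro index_principal_pos)
  then have "finite (\<O> // R)" unfolding index_def R_def by (rule card_ge_0_finite)
  \<comment> \<open>\<open>J\<close> is recovered from its set of cosets: it contains \<O>, so
    \<open>M J\<close> is a union of cosets of \<open>M \<O>\<close>.\<close>
  have "inj_on (\<lambda>J. (\<lambda>x. R `` {x}) ` scale M J) F"
  proof (rule inj_on_inverseI[where g = "\<lambda>X. scale (inverse M) (\<Union>X)"])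
    fix J assume "J \<in> F"
    then have J: "subgrp J" "\<O> \<subseteq> J" "scale M J \<subseteq> \<O>" by (auto simp: F_def)
    have "(\<Union>x\<in>scale M J. R `` {x}) = scale M J"
    proof (intro equalityI subsetI)
      fix y assume "y \<in> (\<Union>x\<in>scale M J. R `` {x})"
      then obtain x where x: "x \<in> scale M J" "x - y \<in> scale M \<O>" by (auto simp: R_def)
      then have "x - y \<in> scale M J" using J(2) by blast
      from subgrpD(2)[OF subgrp_scale[OF J(1)] x(1) this] show "y \<in> scale M J" by simp
    next
      fix y assume y: "y \<in> scale M J"
      then have "y \<in> R `` {y}" using J(3) by (auto simp: R_def intro: image_eqI[of _ _ 0])
      then show "y \<in> (\<Union>x\<in>scale M J. R `` {x})" using y by blast
    qed
    then show "scale (inverse M) (\<Union>((\<lambda>x. R `` {x}) ` scale M J)) = J"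
      using M scale_inverse(2) by simp
  qed
  moreover have "(\<lambda>J. (\<lambda>x. R `` {x}) ` scale M J) ` F \<subseteq> Pow (\<O> // R)"
    by (auto simp: F_def quotient_def)
  ultimately have fin: "finite F"
    using \<open>finite (\<O> // R)\<close> by (metis finite_Pow_iff finite_imageD finite_subset)
  have "\<exists>f J. f \<noteq> 0 \<and> J \<in> F \<and> I = scale f J" if I: "frac_ideal I" for I
  proof -
    obtain f where f: "f \<noteq> 0" "\<O> \<subseteq> scale f I" "ideal_norm (scale f I) * (del_const TYPE('a) + 1) \<ge> 1"
      by (rule frac_multiple_contains_integers[OF I])
    define J where "J = scale f I"
    have J: "frac_ideal J" unfolding J_def by (rule frac_scale[OF I f(1)])
    have NJ: "ideal_norm J * index J \<O> = 1" using f(2) by (intro ideal_norm_mult_index J) (simp add: J_def)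
    then have pos: "index J \<O> > 0" by (metis gr0I mult_zero_right of_nat_0 zero_neq_one)
    have "real (index J \<O>) * 1 \<le> real (index J \<O>) * (ideal_norm J * (del_const TYPE('a) + 1))"
      using f(3) by (intro mult_left_mono) (auto simp: J_def)
    also have "\<dots> = (ideal_norm J * real (index J \<O>)) * (del_const TYPE('a) + 1)" by (simp only: mult_ac)
    also have "\<dots> = del_const TYPE('a) + 1" by (simp add: NJ)
    finally have "index J \<O> \<le> m" unfolding m_def by linarith
    then have "of_nat (fact m) * x \<in> \<O>" if "x \<in> J" for x
      using that pos omoduleD(3)[OF frac_omodule[OF J]]
      by (intro fact_index_mult_mem[of J \<O>] omodule_subgrp frac_omodule J) auto
    then have "J \<in> F"
      using f(2) J by (auto simp: F_def M_def J_def[symmetric] intro: omodule_subgrp frac_omodule)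
    moreover have "I = scale (inverse f) J" using f(1) by (simp add: J_def scale_inverse)
    ultimately show ?thesis using f(1) by (intro exI[of _ "inverse f"] exI[of _ J]) auto
  qed
  with fin show ?thesis by blast
qed

text \<open>\<open>d A\<close> has finite index over \<open>d a \<O>\<close>, so an integral basis
  scaled by \<open>a\<close> generates \<open>A\<close> together with finitely many coset
  representatives.\<close>

lemma frac_finitely_generated:
  fixes A :: "'a::number_field set"
  assumes A: "frac_ideal A"
  obtains G where "finite G" "G \<subseteq> A" "A \<subseteq> int_mod.span G"
proof -
  obtain d where d: "d \<in> \<O>" "d \<noteq> 0" "scale d A \<subseteq> \<O>" using frac_denominator[OF A] .
  obtain a where a: "a \<in> A" "a \<noteq> 0" using frac_nonzero[OF A] .
  obtain b :: "'a emb \<Rightarrow> 'a" where b: "\<O> = {\<Sum>j\<in>UNIV. of_int (c j) * b j | c. True}"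
    by (rule integral_emb_basis_exists)
  have bO: "b j \<in> \<O>" for j
  proof -
    have "b j = (\<Sum>i\<in>UNIV. of_int (if i = j then 1 else 0) * b i)"
      by (simp add: if_distrib[of "\<lambda>k. of_int k * _"] cong: if_cong)
    then show ?thesis unfolding b by (intro CollectI exI[of _ "\<lambda>i. if i = j then 1 else 0"]) simp
  qed
  have sub: "scale (d * a) \<O> \<subseteq> scale d A"
  proof
    fix y assume "y \<in> scale (d * a) \<O>"
    then obtain x where x: "x \<in> \<O>" "y = d * a * x" by blast
    then have "x * a \<in> A" using a omoduleD(3)[OF frac_omodule[OF A]] by blast
    then show "y \<in> scale d A" using x by (auto simp: mult_ac)
  qed
  obtain T where T: "transversal (scale d A) (scale (d * a) \<O>) T"
    using transversal_exists[OF subgrp_scale[OF subgrp_integers]] .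
  have "index \<O> (scale (d * a) \<O>) = index \<O> (scale d A) * index (scale d A) (scale (d * a) \<O>)"
    using d sub by (intro index_mult subgrp_scale omodule_subgrp frac_omodule A) auto
  moreover have "d * a \<in> \<O>" using d a by blast
  then have "index \<O> (scale (d * a) \<O>) > 0" using d a by (intro index_principal_pos) auto
  ultimately have "index (scale d A) (scale (d * a) \<O>) > 0" by (metis gr0I mult_0_right)
  then have finT: "finite T"
    using index_transversal[OF subgrp_scale[OF subgrp_integers] T] card_ge_0_finite by metis
  define G where "G = scale (inverse d) T \<union> range (\<lambda>j. a * b j)"
  have TA: "T \<subseteq> scale d A" using T by (simp add: transversal_def)
  have ab: "a * b j \<in> A" for j
    using omoduleD(3)[OF frac_omodule[OF A] bO a(1), of j] by (simp add: mult.commute)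
  have "scale (inverse d) T \<subseteq> A"
    using image_mono[OF TA, of "(*) (inverse d)"] by (simp only: scale_inverse(2)[OF d(2)])
  then have "G \<subseteq> A" unfolding G_def using ab by auto
  moreover have "finite G" using finT by (simp add: G_def)
  moreover have "A \<subseteq> int_mod.span G"
  proof
    fix x assume "x \<in> A"
    then obtain t where t: "t \<in> T" "d * x - t \<in> scale (d * a) \<O>" using T unfolding transversal_def by blast
    then obtain y where y: "y \<in> \<O>" "d * x - t = d * a * y" by blast
    then obtain c where c: "y = (\<Sum>j\<in>UNIV. of_int (c j) * b j)" unfolding b by blast
    have "d * x = t + d * a * y" using y(2) by (simp add: algebra_simps)
    then have "x = inverse d * t + a * y" using d(2) by (simp add: field_simps)
    also have "\<dots> = inverse d * t + (\<Sum>j\<in>UNIV. of_int (c j) * (a * b j))"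
      by (simp add: c sum_distrib_left mult.left_commute)
    also have "\<dots> \<in> int_mod.span G"
      using t(1) by (intro int_mod.span_add int_mod.span_sum int_mod.span_scale int_mod.span_base) (auto simp: G_def)
    finally show "x \<in> int_mod.span G" .
  qed
  ultimately show ?thesis by (intro that)
qed

text \<open>\<open>b\<close> acts on a finitely generated nonzero group, so it is integral by the
  eigenvalue argument.\<close>

lemma multiplier_integral:
  assumes A: "frac_ideal A" and b: "\<And>x. x \<in> A \<Longrightarrow> b * x \<in> A"
  shows "b \<in> \<O>"
proof -
  obtain G where G: "finite G" "G \<subseteq> A" "A \<subseteq> int_mod.span G" using frac_finitely_generated[OF A] .
  have "\<exists>g\<in>G. g \<noteq> 0"
  proof (rule ccontr)
    assume "\<not> (\<exists>g\<in>G. g \<noteq> 0)"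
    then have "int_mod.span G \<subseteq> {0}" by (intro int_mod.span_minimal) (auto simp: int_mod.subspace_def)
    moreover obtain x where "x \<in> A" "x \<noteq> 0" using frac_nonzero[OF A] .
    ultimately show False using G(3) by blast
  qed
  then show ?thesis
    unfolding ring_of_integers_def mem_Collect_eq using G b by (intro algebraic_int_span[OF G(1)]) auto
qed

text \<open>Nakayama's lemma. The generators of \<open>A\<close> are removed one by one.\<close>

lemma one_mem_of_ideal_mult_eq:
  fixes A :: "'a::number_field set"
  assumes A: "frac_ideal A" and B: "omodule B" "B \<subseteq> \<O>" and AB: "ideal_mult A B = A"
  shows "1 \<in> B"
proof -
  define sp where "sp S = {\<Sum>g\<in>S. c g * g | c. \<forall>g\<in>S. c g \<in> \<O>}" for S :: "'a set"
  have spD: "omodule (sp S)" for S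
    unfolding omodule_def
  proof (intro conjI ballI)
    show "0 \<in> sp S" unfolding sp_def by (intro CollectI exI[of _ "\<lambda>_. 0"]) auto
    fix x y assume "x \<in> sp S" "y \<in> sp S"
    then obtain c e where "x = (\<Sum>g\<in>S. c g * g)" "y = (\<Sum>g\<in>S. e g * g)" "\<forall>g\<in>S. c g \<in> \<O>" "\<forall>g\<in>S. e g \<in> \<O>"
      by (auto simp: sp_def)
    then show "x + y \<in> sp S"
      unfolding sp_def by (intro CollectI exI[of _ "\<lambda>g. c g + e g"]) (auto simp: sum.distrib distrib_right)
  next
    fix a x :: 'a assume a: "a \<in> \<O>" and "x \<in> sp S"
    then obtain c where "x = (\<Sum>g\<in>S. c g * g)" "\<forall>g\<in>S. c g \<in> \<O>" by (auto simp: sp_def)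
    then show "a * x \<in> sp S"
      unfolding sp_def using a by (intro CollectI exI[of _ "\<lambda>g. a * c g"]) (auto simp: sum_distrib_left mult.assoc)
  qed
  \<comment> \<open>The invariant is that \<open>1 - b\<close> maps \<open>A\<close> into the module
    generated by \<open>S\<close>, with \<open>b\<close> in \<open>B\<close>. For empty
    \<open>S\<close> it annihilates a nonzero element, so \<open>b = 1\<close>.\<close>
  have rm: "1 \<in> B" if "finite S" "S \<subseteq> A" "b \<in> B" "\<And>x. x \<in> A \<Longrightarrow> (1 - b) * x \<in> sp S" for S b
    using that
  proof (induction S arbitrary: b rule: finite_induct)
    case empty
    obtain a where a: "a \<in> A" "a \<noteq> 0" using frac_nonzero[OF A] .
    have "(1 - b) * a = 0" using empty(3)[OF a(1)] by (simp add: sp_def)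
    then show ?case using a empty by simp
  next
    case (insert s S)
    have ins: "\<exists>c\<in>\<O>. \<exists>y\<in>sp S. z = c * s + y" if "z \<in> sp (insert s S)" for z
    proof -
      have "\<exists>c. z = (\<Sum>g\<in>insert s S. c g * g) \<and> (\<forall>g\<in>insert s S. c g \<in> \<O>)"
        using that unfolding sp_def mem_Collect_eq .
      then obtain c where *: "z = (\<Sum>g\<in>insert s S. c g * g) \<and> (\<forall>g\<in>insert s S. c g \<in> \<O>)" ..
      note c = conjunct1[OF *] conjunct2[OF *]
      have "(\<Sum>g\<in>S. c g * g) \<in> sp S" using c(2) by (auto simp: sp_def)
      then show ?thesis using c insert.hyps by auto
    qed
    \<comment> \<open>Each term of an element of \<open>A B\<close> contributes a factor from
      \<open>B\<close>, so the coefficient of \<open>s\<close> ends up in \<open>B\<close>. Since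
      \<open>A B = A\<close>, this can be applied to \<open>s\<close> itself.\<close>
    have red: "\<exists>\<beta>\<in>B. \<exists>y\<in>sp S. (1 - b) * z = \<beta> * s + y" if "z \<in> ideal_mult A B" for z
      using that
    proof (induction rule: ideal_mult_induct)
      case zero
      then show ?case using omoduleD(1)[OF B(1)] omoduleD(1)[OF spD[of S]] by force
    next
      case (add x y)
      then obtain \<beta> u \<beta>' u' where "\<beta> \<in> B" "u \<in> sp S" "(1 - b) * x = \<beta> * s + u"
        "\<beta>' \<in> B" "u' \<in> sp S" "(1 - b) * y = \<beta>' * s + u'" by blast
      moreover from this have "(1 - b) * (x + y) = (\<beta> + \<beta>') * s + (u + u')"
        by (simp only: distrib_left distrib_right) (simp only: ac_simps)
      moreover have "\<beta> + \<beta>' \<in> B" "u + u' \<in> sp S"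
        using calculation omoduleD(2)[OF B(1)] omoduleD(2)[OF spD] by auto
      ultimately show ?case by blast
    next
      case (mult x e)
      obtain c y where cy: "c \<in> \<O>" "y \<in> sp S" "(1 - b) * x = c * s + y"
        using ins[OF insert.prems(3)[OF mult(1)]] by blast
      have "(1 - b) * (x * e) = ((1 - b) * x) * e" by (simp only: mult.assoc)
      also have "\<dots> = (c * e) * s + e * y" unfolding cy(3) by (simp add: algebra_simps)
      finally have "(1 - b) * (x * e) = (c * e) * s + e * y" .
      moreover have "c * e \<in> B" "e * y \<in> sp S"
        using cy mult B omoduleD(3)[OF B(1)] omoduleD(3)[OF spD] by auto
      ultimately show ?case by blast
    qed
    have "s \<in> ideal_mult A B" using insert.prems AB by simp
    from red[OF this] obtain \<beta> y where \<beta>: "\<beta> \<in> B" "y \<in> sp S" "(1 - b) * s = \<beta> * s + y" by blast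
    \<comment> \<open>Chosen so that \<open>1 - b' = (1 - b - \<beta>) * (1 - b)\<close>: the factor
      \<open>1 - b - \<beta>\<close> sends \<open>s\<close> to \<open>y\<close>, which needs only
      the generators in \<open>S\<close>.\<close>
    define b' where "b' = b + \<beta> + (1 - b - \<beta>) * b"
    have bO: "b \<in> \<O>" "\<beta> \<in> \<O>" using \<beta> insert.prems B by auto
    then have "b' \<in> B"
      unfolding b'_def using \<beta> insert.prems
      by (intro omoduleD(2)[OF B(1)] omoduleD(3)[OF B(1)]) auto
    moreover have "(1 - b') * x \<in> sp S" if x: "x \<in> A" for x
    proof -
      obtain c z where cz: "c \<in> \<O>" "z \<in> sp S" "(1 - b) * x = c * s + z"
        using ins[OF insert.prems(3)[OF x]] by blast
      have "(1 - b') * x = (1 - b - \<beta>) * ((1 - b) * x)" by (simp add: b'_def algebra_simps)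
      also have "\<dots> = c * ((1 - b) * s - \<beta> * s) + (1 - b - \<beta>) * z" unfolding cz(3) by (simp add: algebra_simps)
      also have "(1 - b) * s - \<beta> * s = y" using \<beta>(3) by simp
      finally show ?thesis
        using omoduleD(2)[OF spD omoduleD(3)[OF spD cz(1) \<beta>(2)] omoduleD(3)[OF spD _ cz(2), of "1 - b - \<beta>"]] bO
        by auto
    qed
    ultimately show ?case using insert.prems by (intro insert.IH) auto
  qed
  obtain G where G: "finite G" "G \<subseteq> A" "A \<subseteq> int_mod.span G" using frac_finitely_generated[OF A] .
  show ?thesis
  proof (rule rm[OF G(1,2) omoduleD(1)[OF B(1)]])
    fix x assume "x \<in> A"
    then have "x \<in> int_mod.span G" using G by blast
    then obtain u where "x = (\<Sum>g\<in>G. of_int (u g) * g)" unfolding int_mod.span_finite[OF G(1)] by blast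
    then show "(1 - 0) * x \<in> sp G" unfolding sp_def by (intro CollectI exI[of _ "\<lambda>g. of_int (u g)"]) auto
  qed
qed

lemma ideal_invertible:
  fixes I :: "'a::number_field set"
  assumes I: "frac_ideal I"
  obtains J where "frac_ideal J" "ideal_mult I J = \<O>"
proof -
  define pw where "pw k = (ideal_mult I ^^ k) \<O>" for k
  have pw0: "pw 0 = \<O>" and pwS: "pw (Suc k) = ideal_mult I (pw k)" for k by (simp_all add: pw_def)
  have fpw: "frac_ideal (pw k)" for k by (induction k) (simp_all add: pw0 pwS frac_ideal_mult I)
  have pw_add: "pw (i + j) = ideal_mult (pw i) (pw j)" for i j
    by (induction i) (simp_all add: pw0 pwS ideal_mult_integers frac_omodule fpw ideal_mult_assoc)
  obtain F :: "'a set set" where F: "finite F" "\<And>I. frac_ideal I \<Longrightarrow> \<exists>f J. f \<noteq> 0 \<and> J \<in> F \<and> I = scale f J"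
    using finite_ideal_classes by blast
  have "\<forall>k. \<exists>f J. f \<noteq> 0 \<and> J \<in> F \<and> pw k = scale f J" using F(2)[OF fpw] by blast
  then obtain f J where fJ: "\<And>k. f k \<noteq> 0" "\<And>k. J k \<in> F" "\<And>k. pw k = scale (f k) (J k)" by metis
  have "\<not> inj J"
  proof
    assume "inj J"
    moreover have "finite (range J)" using F(1) fJ(2) by (meson finite_subset image_subsetI)
    ultimately show False using finite_imageD by blast
  qed
  then obtain i j where ij: "i < j" "J i = J j" unfolding inj_on_def by (metis UNIV_I linorder_neqE_nat)
  \<comment> \<open>The ratio \<open>g\<close> makes \<open>g I^j = I^i\<close>. Writing
    \<open>j = i + Suc k\<close> leaves at least one factor \<open>I\<close> in
    \<open>B = g I^(k+1)\<close>, from which the inverse is read off at the end.\<close>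
  define k g where "k = j - Suc i" and "g = f i / f j"
  have j: "j = i + Suc k" using ij by (simp add: k_def)
  have g: "g \<noteq> 0" using fJ(1) by (simp add: g_def)
  have "scale g (pw j) = pw i"
  proof -
    have "g * f j = f i" using fJ(1)[of j] by (simp add: g_def)
    then show ?thesis by (simp only: fJ(3) scale_scale ij(2))
  qed
  then have eq: "ideal_mult (pw i) (scale g (pw (Suc k))) = pw i"
    unfolding j pw_add using fpw
    by (metis frac_omodule ideal_mult_commute ideal_mult_scale)
  define B where "B = scale g (pw (Suc k))"
  have fB: "frac_ideal B" unfolding B_def by (intro frac_scale fpw g)
  \<comment> \<open>The equation \<open>I^i B = I^i\<close> says that every element of
    \<open>B\<close> multiplies \<open>I^i\<close> into itself.\<close>
  have "B \<subseteq> \<O>"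
  proof
    fix b assume b: "b \<in> B"
    show "b \<in> \<O>"
    proof (rule multiplier_integral[OF fpw[of i]])
      fix x assume "x \<in> pw i"
      then have "x * b \<in> ideal_mult (pw i) B" using b by (rule ideal_mult_mem)
      then show "b * x \<in> pw i" using eq by (simp add: B_def mult.commute)
    qed
  qed
  moreover have "1 \<in> B"
    using eq by (intro one_mem_of_ideal_mult_eq[OF fpw[of i] frac_omodule[OF fB] \<open>B \<subseteq> \<O>\<close>]) (simp add: B_def)
  then have "\<O> \<subseteq> B" using omoduleD(3)[OF frac_omodule[OF fB], of _ 1] by auto
  ultimately have "B = \<O>" by blast
  moreover have "B = ideal_mult I (scale g (pw k))"
    unfolding B_def pwS using I fpw[of k]
    by (metis frac_omodule ideal_mult_commute ideal_mult_scale)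
  ultimately show ?thesis using g fpw by (intro that[of "scale g (pw k)"] frac_scale) auto
qed

lemma ideal_mult_cancel:
  assumes "frac_ideal K" "frac_ideal I" "frac_ideal J" "ideal_mult K I = ideal_mult K J"
  shows "I = J"
proof -
  obtain L where L: "frac_ideal L" "ideal_mult K L = \<O>" using ideal_invertible[OF assms(1)] .
  have *: "ideal_mult L (ideal_mult K M) = M" if "frac_ideal M" for M
    using L(2) ideal_mult_integers[OF frac_omodule[OF that]] by (metis ideal_mult_assoc ideal_mult_commute)
  have "I = ideal_mult L (ideal_mult K J)" using *[OF assms(2)] by (simp only: assms(4))
  then show ?thesis by (simp only: *[OF assms(3)])
qed

section \<open>Multiplicativity of the norm\<close>

text \<open>For maximal \<open>P\<close> there is no ideal strictly between \<open>I P\<close> and \<open>I\<close>, so \<open>I = a \<O> + I P\<close> for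
  every \<open>a\<close> in \<open>I\<close> outside \<open>I P\<close>.\<close>

lemma index_ideal_mult_maximal:
  fixes I :: "'a::number_field set"
  assumes I: "frac_ideal I" and P: "frac_ideal P" "P \<subseteq> \<O>" "P \<noteq> \<O>"
    and max: "\<And>Q. omodule Q \<Longrightarrow> P \<subseteq> Q \<Longrightarrow> Q \<subseteq> \<O> \<Longrightarrow> Q = P \<or> Q = \<O>"
  shows "index I (ideal_mult I P) = index \<O> P"
proof -
  note oI = frac_omodule[OF I] and oP = frac_omodule[OF P(1)]
  have oIP: "omodule (ideal_mult I P)" by (rule omodule_ideal_mult[OF oI])
  have IO: "ideal_mult I \<O> = I" using ideal_mult_integers[OF oI] ideal_mult_commute by metis
  have sub: "ideal_mult I P \<subseteq> I" using ideal_mult_mono[OF subset_refl P(2), of I] IO by simp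
  have "ideal_mult I P \<noteq> I"
    using ideal_mult_cancel[OF I P(1) frac_integers] P(3) IO by auto
  then obtain a where a: "a \<in> I" "a \<notin> ideal_mult I P" using sub by blast
  obtain L where L: "frac_ideal L" "ideal_mult I L = \<O>" using ideal_invertible[OF I] .
  have LI: "ideal_mult L I = \<O>" using L ideal_mult_commute by metis
  define K where "K = {a * x + y | x y. x \<in> \<O> \<and> y \<in> ideal_mult I P}"
  have oK: "omodule K"
    unfolding omodule_def
  proof (intro conjI ballI)
    show "0 \<in> K" unfolding K_def using omoduleD(1)[OF oIP] by force
    fix u v assume "u \<in> K" "v \<in> K"
    then obtain x y x' y' where "u = a * x + y" "v = a * x' + y'" "x \<in> \<O>" "x' \<in> \<O>"
      "y \<in> ideal_mult I P" "y' \<in> ideal_mult I P" by (auto simp: K_def)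
    then show "u + v \<in> K"
      unfolding K_def using omoduleD(2)[OF oIP]
      by (intro CollectI exI[of _ "x + x'"] exI[of _ "y + y'"]) (auto simp: algebra_simps)
  next
    fix c u :: 'a assume c: "c \<in> \<O>" and "u \<in> K"
    then obtain x y where "u = a * x + y" "x \<in> \<O>" "y \<in> ideal_mult I P" by (auto simp: K_def)
    then have "c * u = a * (c * x) + c * y \<and> c * x \<in> \<O> \<and> c * y \<in> ideal_mult I P"
      using omoduleD(3)[OF oIP c] c by (auto simp: distrib_left mult.left_commute)
    then show "c * u \<in> K" unfolding K_def by blast
  qed
  have aK: "a \<in> K" unfolding K_def using omoduleD(1)[OF oIP] integers_closed(2) by (intro CollectI exI[of _ 1] exI[of _ 0]) auto
  have IPK: "ideal_mult I P \<subseteq> K"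
  proof
    fix y assume "y \<in> ideal_mult I P"
    then show "y \<in> K" unfolding K_def by (intro CollectI exI[of _ 0] exI[of _ y]) auto
  qed
  have KI: "K \<subseteq> I"
    unfolding K_def using a(1) sub omoduleD[OF oI] by (auto simp: mult.commute[of a] subset_iff)
  \<comment> \<open>Multiplying \<open>I P \<subseteq> K \<subseteq> I\<close> by the inverse
    \<open>L\<close> of \<open>I\<close> gives a module between \<open>P\<close> and \<O>, to which
    maximality applies. As \<open>K\<close> contains \<open>a\<close>, it cannot be
    \<open>I P\<close>.\<close>
  have "P = ideal_mult L (ideal_mult I P)"
    by (simp add: ideal_mult_assoc[symmetric] LI ideal_mult_integers oP)
  also have "\<dots> \<subseteq> ideal_mult L K" by (rule ideal_mult_mono[OF subset_refl IPK])
  finally have 1: "P \<subseteq> ideal_mult L K" .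
  have 2: "ideal_mult L K \<subseteq> \<O>" using ideal_mult_mono[OF subset_refl KI, of L] LI by simp
  have IL: "ideal_mult I (ideal_mult L K) = K"
    by (simp add: ideal_mult_assoc[symmetric] L ideal_mult_integers oK)
  have "ideal_mult L K = P \<or> ideal_mult L K = \<O>"
    using 1 2 by (intro max omodule_ideal_mult frac_omodule L)
  then have K: "K = I" using IL IO a aK by auto
  \<comment> \<open>The annihilator of \<open>a\<close> modulo \<open>I P\<close>. It contains
    \<open>P\<close> but not 1, hence equals \<open>P\<close>, so multiplication by \<open>a\<close>
    identifies \<O> modulo \<open>P\<close> with \<open>I\<close> modulo \<open>I P\<close>.\<close>
  define Q where "Q = {x \<in> \<O>. a * x \<in> ideal_mult I P}"
  have "omodule Q"
    unfolding omodule_def Q_def using omoduleD[OF oIP] by (auto simp: distrib_left mult.left_commute[of a])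
  moreover have "P \<subseteq> Q" using P a ideal_mult_mem by (auto simp: Q_def)
  moreover have "1 \<notin> Q" using a by (simp add: Q_def)
  moreover have "Q \<subseteq> \<O>" by (auto simp: Q_def)
  ultimately have Q: "Q = P" using max[of Q] integers_closed(2) by blast
  obtain T where T: "transversal \<O> P T" using transversal_exists[OF omodule_subgrp[OF oP]] .
  have TO: "T \<subseteq> \<O>" using T by (simp add: transversal_def)
  have uniq: "s = t" if st: "s \<in> T" "t \<in> T" "a * s - a * t \<in> ideal_mult I P" for s t
  proof -
    have "s - t \<in> Q" using st TO by (auto simp: Q_def right_diff_distrib)
    then have "s - t \<in> P" by (simp only: Q)
    then show ?thesis
      using st TO omoduleD(1)[OF oP] by (intro transversal_unique[OF T, of s]) auto
  qed
  have "transversal I (ideal_mult I P) ((*) a ` T)"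
    unfolding transversal_def
  proof (intro conjI ballI)
    show "(*) a ` T \<subseteq> I" using TO a(1) omoduleD(3)[OF oI] by (auto simp: mult.commute[of a])
    fix x assume "x \<in> I"
    then have "x \<in> K" by (simp only: K)
    then obtain c y where c: "x = a * c + y" "c \<in> \<O>" "y \<in> ideal_mult I P" unfolding K_def by blast
    obtain t where t: "t \<in> T" "c - t \<in> P" using T c(2) unfolding transversal_def by blast
    have "a * (c - t) + y \<in> ideal_mult I P"
      using t a c by (intro omoduleD(2)[OF oIP] ideal_mult_mem) auto
    then have xt: "x - a * t \<in> ideal_mult I P" by (simp add: c algebra_simps)
    show "\<exists>!u. u \<in> (*) a ` T \<and> x - u \<in> ideal_mult I P"
    proof (rule ex1I[of _ "a * t"])
      show "a * t \<in> (*) a ` T \<and> x - a * t \<in> ideal_mult I P" using t xt by blast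
      fix u assume u: "u \<in> (*) a ` T \<and> x - u \<in> ideal_mult I P"
      then obtain s where s: "s \<in> T" "u = a * s" by blast
      have "(x - a * t) - (x - u) \<in> ideal_mult I P"
        using u xt subgrpD(2)[OF omodule_subgrp[OF oIP]] by blast
      then have "a * s - a * t \<in> ideal_mult I P" by (simp add: s)
      then show "u = a * t" using uniq[OF s(1) t(1)] s by simp
    qed
  qed
  from index_transversal[OF omodule_subgrp[OF oIP] this]
  have "index I (ideal_mult I P) = card ((*) a ` T)" .
  also have "\<dots> = card T"
    using uniq omoduleD(1)[OF oIP] by (intro card_image inj_onI) auto
  also have "\<dots> = index \<O> P" using index_transversal[OF omodule_subgrp[OF oP] T] by simp
  finally show ?thesis .
qed

text \<open>Induction on the index of \<open>J\<close>: a maximal ideal \<open>P\<close> containing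
  \<open>J\<close> is split off by means of its inverse, \<open>J = Q P\<close>, and
  \<open>Q\<close> has smaller index.\<close>

lemma index_ideal_mult:
  fixes I :: "'a::number_field set"
  assumes I: "frac_ideal I" and J: "frac_ideal J" "J \<subseteq> \<O>"
  shows "index I (ideal_mult I J) = index \<O> J"
  using J I
proof (induction "index \<O> J" arbitrary: I J rule: less_induct)
  case less
  note J = less.prems(1,2) and I = less.prems(3)
  have IO: "ideal_mult I \<O> = I" if "frac_ideal I" for I :: "'a set"
    using ideal_mult_integers[OF frac_omodule[OF that]] ideal_mult_commute by metis
  show ?case
  proof (cases "J = \<O>")
    case True
    then show ?thesis using I by (simp add: IO index_self omodule_subgrp frac_omodule)
  next
    case False
    define \<P> where "\<P> = {P. omodule P \<and> J \<subseteq> P \<and> P \<subseteq> \<O> \<and> P \<noteq> \<O>}"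
    have "J \<in> \<P>" using J False by (simp add: \<P>_def frac_omodule)
    \<comment> \<open>Among the proper ideals containing \<open>J\<close> one of least index is
      maximal, because the index drops strictly when the ideal grows.\<close>
    then obtain P where P: "P \<in> \<P>" and min: "\<And>Q. Q \<in> \<P> \<Longrightarrow> index \<O> P \<le> index \<O> Q"
      using ex_has_least_nat[of "\<lambda>P. P \<in> \<P>" J "index \<O>"] by blast
    have oP: "omodule P" and JP: "J \<subseteq> P" and PO: "P \<subseteq> \<O>" and PnO: "P \<noteq> \<O>" using P by (auto simp: \<P>_def)
    obtain x where x: "x \<in> J" "x \<noteq> 0" using frac_nonzero[OF J(1)] .
    have fP: "frac_ideal P" using oP PO x JP by (intro frac_integral[of P x]) auto
    have max: "Q = P \<or> Q = \<O>" if Q: "omodule Q" "P \<subseteq> Q" "Q \<subseteq> \<O>" for Q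
    proof (rule ccontr)
      assume "\<not> (Q = P \<or> Q = \<O>)"
      then have ne: "Q \<noteq> P" "Q \<noteq> \<O>" by auto
      then have "index \<O> P \<le> index \<O> Q" using Q JP by (intro min) (auto simp: \<P>_def)
      moreover have "index \<O> P = index \<O> Q * index Q P"
        using Q oP by (intro index_mult omodule_subgrp) auto
      moreover have "index \<O> P > 0" using x JP PO oP by (intro index_integral_ideal_pos[of P x]) auto
      moreover have "index Q P \<noteq> 1"
        using index_1_imp_eq[of Q P] Q oP ne(1) by (auto simp: omodule_subgrp)
      ultimately show False
        by (metis One_nat_def Suc_leI le_antisym less_one linorder_not_less mult_0_right mult_le_cancel1 mult.right_neutral
            nat_0_less_mult_iff not_le)
    qed
    obtain L where L: "frac_ideal L" "ideal_mult P L = \<O>" using ideal_invertible[OF fP] .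
    define Q where "Q = ideal_mult J L"
    have fQ: "frac_ideal Q" unfolding Q_def by (intro frac_ideal_mult J L)
    have QO: "Q \<subseteq> \<O>" unfolding Q_def using ideal_mult_mono[OF JP subset_refl, of L] L by simp
    have QP: "ideal_mult Q P = J"
      unfolding Q_def ideal_mult_assoc ideal_mult_commute[of L P] L(2) by (rule IO[OF J(1)])
    have QPO: "ideal_mult Q P \<subseteq> Q" using ideal_mult_mono[OF subset_refl PO, of Q] IO[OF fQ] by simp
    have mx: "index K (ideal_mult K P) = index \<O> P" if "frac_ideal K" for K
      by (rule index_ideal_mult_maximal[OF that fP PO PnO max])
    have J_idx: "index \<O> J = index \<O> Q * index \<O> P"
    proof -
      have "index \<O> J = index \<O> Q * index Q J"
        using QPO QP QO fQ J by (intro index_mult omodule_subgrp frac_omodule) auto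
      also have "index Q J = index \<O> P" using mx[OF fQ] by (simp add: QP)
      finally show ?thesis .
    qed
    have "index \<O> P \<noteq> 1" using index_1_imp_eq[OF subgrp_integers omodule_subgrp[OF oP] PO] PnO by auto
    moreover have "index \<O> J > 0" using x J by (intro index_integral_ideal_pos[of J x] frac_omodule) auto
    ultimately have "index \<O> Q < index \<O> J"
      unfolding J_idx by (metis One_nat_def mult.right_neutral nat_0_less_mult_iff nat_mult_less_cancel_disj Suc_lessI)
    then have "index I (ideal_mult I Q) = index \<O> Q" by (intro less.hyps fQ QO I)
    moreover have IJ: "ideal_mult I J = ideal_mult (ideal_mult I Q) P" by (simp add: ideal_mult_assoc QP)
    have IQ: "frac_ideal (ideal_mult I Q)" by (intro frac_ideal_mult I fQ)
    have "index I (ideal_mult I J) = index I (ideal_mult I Q) * index (ideal_mult I Q) (ideal_mult I J)"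
      unfolding IJ
      using ideal_mult_mono[OF subset_refl QO, of I] IO[OF I] ideal_mult_mono[OF subset_refl PO, of "ideal_mult I Q"] IO[OF IQ]
      by (intro index_mult omodule_subgrp omodule_ideal_mult frac_omodule I IQ) auto
    moreover have "index (ideal_mult I Q) (ideal_mult I J) = index \<O> P" unfolding IJ by (rule mx[OF IQ])
    ultimately show ?thesis by (simp add: J_idx)
  qed
qed

text \<open>For integral ideals the norm is the index, which splits along
  \<open>I' J' \<subseteq> I' \<subseteq> \<O>\<close>. The denominators contribute norms of
  elements, which are multiplicative.\<close>

lemma ideal_norm_mult:
  fixes I :: "'a::number_field set"
  assumes I: "frac_ideal I" and J: "frac_ideal J"
  shows "ideal_norm (ideal_mult I J) = ideal_norm I * ideal_norm J"
proof -
  obtain d where d: "d \<in> \<O>" "d \<noteq> 0" "scale d I \<subseteq> \<O>" using frac_denominator[OF I] .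
  obtain e where e: "e \<in> \<O>" "e \<noteq> 0" "scale e J \<subseteq> \<O>" using frac_denominator[OF J] .
  define I' J' where "I' = scale d I" and "J' = scale e J"
  have f: "frac_ideal I'" "frac_ideal J'" using I J d e by (auto simp: I'_def J'_def frac_scale)
  have IO: "ideal_mult I' \<O> = I'" using ideal_mult_integers[OF frac_omodule[OF f(1)]] ideal_mult_commute by metis
  have sub: "ideal_mult I' J' \<subseteq> I'" using ideal_mult_mono[OF subset_refl e(3), of I'] IO by (simp add: J'_def)
  have "ideal_mult I' J' = scale (d * e) (ideal_mult I J)"
    unfolding I'_def J'_def using I J
    by (metis frac_omodule ideal_mult_commute ideal_mult_scale omodule_scale scale_scale)
  then have "ideal_norm (ideal_mult I' J') = elem_norm (d * e) * ideal_norm (ideal_mult I J)"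
    using d e I J by (simp add: ideal_norm_scale frac_ideal_mult)
  moreover have "ideal_norm (ideal_mult I' J') = ideal_norm I' * ideal_norm J'"
  proof -
    have "ideal_norm (ideal_mult I' J') = index \<O> (ideal_mult I' J')"
      using sub d(3) f by (intro ideal_norm_integral frac_ideal_mult) (auto simp: I'_def)
    also have "index \<O> (ideal_mult I' J') = index \<O> I' * index I' (ideal_mult I' J')"
      using sub d(3) f by (intro index_mult omodule_subgrp frac_omodule frac_ideal_mult) (auto simp: I'_def)
    also have "index I' (ideal_mult I' J') = index \<O> J'"
      using f e(3) by (intro index_ideal_mult) (auto simp: J'_def)
    finally show ?thesis using f d(3) e(3) by (simp add: ideal_norm_integral I'_def[symmetric] J'_def[symmetric])
  qed
  moreover have "ideal_norm I' = elem_norm d * ideal_norm I" "ideal_norm J' = elem_norm e * ideal_norm J"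
    using d e I J by (auto simp: I'_def J'_def ideal_norm_scale)
  ultimately show ?thesis
    using elem_norm_pos[OF d(2)] elem_norm_pos[OF e(2)] by (simp add: elem_norm_mult)
qed

section \<open>The Arakelov divisor class group\<close>

lemma infinite_primes_nonempty: "(infinite_primes :: 'a::number_field infinite_prime set) \<noteq> {}"
  using sum_prime_deg[where 'a = 'a] field_degree_pos[where 'a = 'a] by auto

lemma pos_vectorsD: "u \<in> pos_vectors \<Longrightarrow> P \<in> infinite_primes \<Longrightarrow> u P > 0"
  by (auto simp: pos_vectors_def)

lemma restrict_pos_vectors:
  "(\<And>P. P \<in> infinite_primes \<Longrightarrow> f P > 0) \<Longrightarrow> restrict f infinite_primes \<in> pos_vectors"
  by (auto simp: pos_vectors_def)

lemma pos_vectors_ext: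
  assumes "u \<in> pos_vectors" "v \<in> pos_vectors" "\<And>P. P \<in> infinite_primes \<Longrightarrow> u P = v P"
  shows "u = v"
  using assms unfolding pos_vectors_def by (intro PiE_ext)

lemma carrier_Div_grp: "carrier Div_grp = {D. frac_ideal (fst D) \<and> snd D \<in> pos_vectors}"
  unfolding Div_grp_def frac_ideal_def partial_object.simps by (rule Set.set_eqI) (simp only: mem_Times_iff mem_Collect_eq)

lemma mult_Div_grp: "D \<otimes>\<^bsub>Div_grp\<^esub> E =
    (ideal_mult (fst D) (fst E), restrict (\<lambda>P. snd D P * snd E P) infinite_primes)"
  by (simp only: Div_grp_def monoid.simps case_prod_beta)

lemma one_Div_grp: "\<one>\<^bsub>Div_grp\<^esub> = (\<O>, restrict (\<lambda>_. 1) infinite_primes)"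
  by (simp only: Div_grp_def monoid.simps)

lemma comm_group_Div_grp: "comm_group (Div_grp :: 'a::number_field divisor monoid)"
proof (rule comm_groupI)
  show closed: "D \<otimes>\<^bsub>Div_grp\<^esub> E \<in> carrier Div_grp" if "D \<in> carrier Div_grp" "E \<in> carrier Div_grp" for D E :: "'a divisor"
    using that unfolding carrier_Div_grp mult_Div_grp mem_Collect_eq fst_conv snd_conv
    by (intro conjI frac_ideal_mult restrict_pos_vectors mult_pos_pos) (blast intro: pos_vectorsD)+
  show one: "\<one>\<^bsub>Div_grp\<^esub> \<in> carrier (Div_grp :: 'a divisor monoid)"
    unfolding carrier_Div_grp one_Div_grp mem_Collect_eq fst_conv snd_conv
    by (intro conjI frac_integers restrict_pos_vectors) simp
  show "(D \<otimes>\<^bsub>Div_grp\<^esub> E) \<otimes>\<^bsub>Div_grp\<^esub> G = D \<otimes>\<^bsub>Div_grp\<^esub> (E \<otimes>\<^bsub>Div_grp\<^esub> G)" for D E G :: "'a divisor"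
    unfolding mult_Div_grp fst_conv snd_conv ideal_mult_assoc by (simp add: restrict_def fun_eq_iff mult.assoc)
  show "D \<otimes>\<^bsub>Div_grp\<^esub> E = E \<otimes>\<^bsub>Div_grp\<^esub> D" for D E :: "'a divisor"
    unfolding mult_Div_grp ideal_mult_commute[of "fst E" "fst D"] by (simp add: mult.commute)
  show "\<one>\<^bsub>Div_grp\<^esub> \<otimes>\<^bsub>Div_grp\<^esub> D = D" if D: "D \<in> carrier Div_grp" for D :: "'a divisor"
  proof (rule prod_eqI)
    show "fst (\<one>\<^bsub>Div_grp\<^esub> \<otimes>\<^bsub>Div_grp\<^esub> D) = fst D"
      using D by (simp add: mult_Div_grp one_Div_grp ideal_mult_integers frac_omodule carrier_Div_grp)
    show "snd (\<one>\<^bsub>Div_grp\<^esub> \<otimes>\<^bsub>Div_grp\<^esub> D) = snd D"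
    proof (rule pos_vectors_ext)
      show "snd (\<one>\<^bsub>Div_grp\<^esub> \<otimes>\<^bsub>Div_grp\<^esub> D) \<in> pos_vectors" using closed[OF one D] by (simp add: carrier_Div_grp)
      show "snd D \<in> pos_vectors" using D by (simp add: carrier_Div_grp)
    qed (simp add: mult_Div_grp one_Div_grp)
  qed
  show "\<exists>E\<in>carrier Div_grp. E \<otimes>\<^bsub>Div_grp\<^esub> D = \<one>\<^bsub>Div_grp\<^esub>" if D: "D \<in> carrier Div_grp" for D :: "'a divisor"
  proof -
    have "frac_ideal (fst D)" using D by (simp add: carrier_Div_grp)
    then obtain J where J: "frac_ideal J" "ideal_mult (fst D) J = \<O>" by (rule ideal_invertible)
    define u where "u = restrict (\<lambda>P. inverse (snd D P)) infinite_primes"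
    have pos: "snd D P > 0" if "P \<in> infinite_primes" for P using D that by (auto simp: carrier_Div_grp pos_vectorsD)
    have "(J, u) \<in> carrier Div_grp"
      unfolding carrier_Div_grp u_def mem_Collect_eq fst_conv snd_conv
      by (intro conjI J restrict_pos_vectors) (simp add: pos)
    moreover have "(J, u) \<otimes>\<^bsub>Div_grp\<^esub> D = \<one>\<^bsub>Div_grp\<^esub>"
    proof -
      have "restrict (\<lambda>P. u P * snd D P) infinite_primes = restrict (\<lambda>_. 1) infinite_primes"
        using pos by (intro restrict_ext) (simp add: u_def less_imp_neq[symmetric])
      then show ?thesis using J ideal_mult_commute[of J "fst D"] by (simp add: mult_Div_grp one_Div_grp)
    qed
    ultimately show ?thesis by blast
  qed
qed

interpretation Div: comm_group "Div_grp :: 'a::number_field divisor monoid"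
  by (rule comm_group_Div_grp)

text \<open>This is \<open>e\<close> to the minus degree.\<close>

definition div_norm :: "'a::number_field divisor \<Rightarrow> real" where
  "div_norm D = ideal_norm (fst D) * (\<Prod>P\<in>infinite_primes. snd D P ^ prime_deg P)"

lemma div_norm_pos:
  assumes "D \<in> carrier Div_grp"
  shows "div_norm D > 0"
proof -
  have "frac_ideal (fst D)" "snd D \<in> pos_vectors" using assms by (simp_all add: carrier_Div_grp)
  then show ?thesis
    unfolding div_norm_def by (intro mult_pos_pos ideal_norm_pos prod_pos zero_less_power) (simp_all add: pos_vectorsD)
qed

lemma div_norm_mult:
  assumes "D \<in> carrier Div_grp" "E \<in> carrier Div_grp"
  shows "div_norm (D \<otimes>\<^bsub>Div_grp\<^esub> E) = div_norm D * div_norm E"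
proof -
  have "frac_ideal (fst D)" "frac_ideal (fst E)" using assms by (simp_all add: carrier_Div_grp)
  then have "ideal_norm (ideal_mult (fst D) (fst E)) = ideal_norm (fst D) * ideal_norm (fst E)" by (rule ideal_norm_mult)
  then show ?thesis by (simp add: div_norm_def mult_Div_grp power_mult_distrib prod.distrib)
qed

lemma carrier_Div0_grp: "carrier Div0_grp = {D \<in> carrier Div_grp. div_norm D = 1}"
proof -
  have "div_degree D = 0 \<longleftrightarrow> div_norm D = 1" if "D \<in> carrier Div_grp" for D :: "'a divisor"
    using div_norm_pos[OF that] by (simp add: div_degree_def div_norm_def[symmetric])
  then show ?thesis by (auto simp: Div0_grp_def)
qed

text \<open>Closure under products and inverses is multiplicativity of \<open>div_norm\<close>,
  hence of the ideal norm.\<close>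

lemma subgroup_Div0: "subgroup (carrier Div0_grp) (Div_grp :: 'a::number_field divisor monoid)"
proof (rule Div.subgroupI)
  have 1: "div_norm (\<one>\<^bsub>Div_grp\<^esub> :: 'a divisor) = 1"
    by (simp add: div_norm_def one_Div_grp ideal_norm_integers)
  have "\<one>\<^bsub>Div_grp\<^esub> \<in> carrier (Div0_grp :: 'a divisor monoid)"
    unfolding carrier_Div0_grp using 1 Div.one_closed by blast
  then show "carrier (Div0_grp :: 'a divisor monoid) \<noteq> {}" by blast
  fix D E :: "'a divisor" assume DE: "D \<in> carrier Div0_grp" "E \<in> carrier Div0_grp"
  then show "D \<otimes>\<^bsub>Div_grp\<^esub> E \<in> carrier Div0_grp" by (simp add: carrier_Div0_grp div_norm_mult)
  have "div_norm (D \<otimes>\<^bsub>Div_grp\<^esub> inv\<^bsub>Div_grp\<^esub> D) = div_norm D * div_norm (inv\<^bsub>Div_grp\<^esub> D)"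
    using DE by (intro div_norm_mult) (simp_all add: carrier_Div0_grp)
  then show "inv\<^bsub>Div_grp\<^esub> D \<in> carrier Div0_grp" using DE 1 by (simp add: carrier_Div0_grp)
next
  show "carrier Div0_grp \<subseteq> carrier (Div_grp :: 'a divisor monoid)" unfolding carrier_Div0_grp by blast
qed

lemma Div0_grp_eq: "Div0_grp = Div_grp\<lparr>carrier := carrier Div0_grp\<rparr>"
  by (simp add: Div0_grp_def)

lemma mult_Div0_grp [simp]: "D \<otimes>\<^bsub>Div0_grp\<^esub> E = D \<otimes>\<^bsub>Div_grp\<^esub> E"
  by (simp add: Div0_grp_def)

lemma one_Div0_grp [simp]: "\<one>\<^bsub>Div0_grp\<^esub> = \<one>\<^bsub>Div_grp\<^esub>"
  by (simp add: Div0_grp_def)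

interpretation Div0: comm_group "Div0_grp :: 'a::number_field divisor monoid"
proof -
  have "group (Div0_grp :: 'a divisor monoid)"
    using subgroup.subgroup_is_group[OF subgroup_Div0 Div.is_group] by (simp only: Div0_grp_eq[symmetric])
  then show "comm_group (Div0_grp :: 'a divisor monoid)"
    by (rule group.group_comm_groupI) (simp add: carrier_Div0_grp Div.m_comm)
qed

lemma inv_Div0_grp: "D \<in> carrier Div0_grp \<Longrightarrow> inv\<^bsub>Div0_grp\<^esub> D = inv\<^bsub>Div_grp\<^esub> D"
  using Div.m_inv_consistent[OF subgroup_Div0] by (simp only: Div0_grp_eq[symmetric])

lemma principal_divisor_altdef:
  "principal_divisor f = (scale (inverse f) \<O>, restrict (\<lambda>P. prime_abs P f) infinite_primes)"
  by (simp add: principal_divisor_def)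

lemma principal_divisor_mult:
  "principal_divisor f \<otimes>\<^bsub>Div_grp\<^esub> principal_divisor g = principal_divisor (f * g)"
proof (rule prod_eqI)
  have "ideal_mult (scale (inverse f) \<O>) (scale (inverse g) \<O>) = scale (inverse f * inverse g) \<O>"
    unfolding ideal_mult_principal[OF omodule_scale[OF omodule_integers]] by (rule scale_scale)
  then show "fst (principal_divisor f \<otimes>\<^bsub>Div_grp\<^esub> principal_divisor g) = fst (principal_divisor (f * g))"
    by (simp add: principal_divisor_altdef mult_Div_grp mult.commute)
  show "snd (principal_divisor f \<otimes>\<^bsub>Div_grp\<^esub> principal_divisor g) = snd (principal_divisor (f * g))"
    unfolding principal_divisor_altdef mult_Div_grp fst_conv snd_conv by (intro restrict_ext) (simp add: prime_abs_simps)
qed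

lemma principal_divisor_Div0:
  assumes "f \<noteq> 0"
  shows "principal_divisor f \<in> carrier Div0_grp"
proof -
  have "principal_divisor f \<in> carrier Div_grp"
    unfolding carrier_Div_grp principal_divisor_altdef mem_Collect_eq fst_conv snd_conv
    using assms by (intro conjI frac_scale frac_integers restrict_pos_vectors) (simp_all add: prime_abs_simps)
  moreover have "div_norm (principal_divisor f) = elem_norm (inverse f) * elem_norm f"
    using ideal_norm_scale[OF frac_integers, of "inverse f"] assms
    by (simp add: div_norm_def principal_divisor_altdef ideal_norm_integers elem_norm_def)
  ultimately show ?thesis
    using assms elem_norm_pos[OF assms] by (simp add: carrier_Div0_grp elem_norm_inverse)
qed

lemma principal_divisor_1: "principal_divisor (1 :: 'a::number_field) = \<one>\<^bsub>Div_grp\<^esub>"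
proof -
  have "restrict (\<lambda>P. prime_abs P (1 :: 'a)) infinite_primes = restrict (\<lambda>_. 1) infinite_primes"
    by (intro restrict_ext) (simp add: prime_abs_simps)
  then show ?thesis by (simp add: principal_divisor_altdef one_Div_grp)
qed

lemma subgroup_principal_divisors: "subgroup principal_divisors (Div0_grp :: 'a::number_field divisor monoid)"
proof (rule Div0.subgroupI)
  show "principal_divisors \<subseteq> carrier (Div0_grp :: 'a divisor monoid)"
    unfolding principal_divisors_def by (intro image_subsetI principal_divisor_Div0) simp
  show "(principal_divisors :: 'a divisor set) \<noteq> {}" unfolding principal_divisors_def using one_neq_zero[where 'a = 'a] by blast
  fix D E :: "'a divisor" assume "D \<in> principal_divisors" "E \<in> principal_divisors"
  then obtain f g where f: "D = principal_divisor f" "f \<noteq> 0" and g: "E = principal_divisor g" "g \<noteq> 0"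
    by (auto simp: principal_divisors_def)
  show "D \<otimes>\<^bsub>Div0_grp\<^esub> E \<in> principal_divisors"
    unfolding mult_Div0_grp principal_divisors_def using f g by (intro image_eqI[of _ _ "f * g"]) (simp_all add: principal_divisor_mult)
  have "inv\<^bsub>Div0_grp\<^esub> D = principal_divisor (inverse f)"
    unfolding f(1) using f(2) by (intro Div0.inv_equality principal_divisor_Div0) (simp_all add: principal_divisor_mult principal_divisor_1)
  then show "inv\<^bsub>Div0_grp\<^esub> D \<in> principal_divisors" using f by (simp add: principal_divisors_def)
qed

interpretation principal: normal principal_divisors "Div0_grp :: 'a::number_field divisor monoid"
  by (rule Div0.subgroup_imp_normal[OF subgroup_principal_divisors])

lemma carrier_Pic0_grp: "carrier Pic0_grp = div_class ` carrier Div0_grp"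
  by (auto simp: Pic0_grp_def carrier_FactGroup div_class_def)

lemma div_class_diff:
  assumes "D \<in> carrier Div0_grp" "E \<in> carrier Div0_grp"
  shows "div_class D \<otimes>\<^bsub>Pic0_grp\<^esub> inv\<^bsub>Pic0_grp\<^esub> div_class E = div_class (D \<otimes>\<^bsub>Div_grp\<^esub> inv\<^bsub>Div_grp\<^esub> E)"
proof -
  have "inv\<^bsub>Pic0_grp\<^esub> div_class E = div_class (inv\<^bsub>Div0_grp\<^esub> E)"
    using assms carrier_Pic0_grp unfolding Pic0_grp_def div_class_def
    by (subst principal.inv_FactGroup) (auto simp: carrier_FactGroup principal.rcos_inv)
  then show ?thesis
    using assms by (simp add: Pic0_grp_def div_class_def principal.rcos_sum inv_Div0_grp[symmetric])
qed

lemma div_class_principal_mult: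
  assumes "f \<noteq> 0" "D \<in> carrier Div0_grp"
  shows "div_class (principal_divisor f \<otimes>\<^bsub>Div_grp\<^esub> D) = div_class D"
proof -
  have "principal_divisor f \<otimes>\<^bsub>Div0_grp\<^esub> D \<in> principal_divisors #>\<^bsub>Div0_grp\<^esub> D"
    using assms by (intro Div0.rcosI principal.subset) (auto simp: principal_divisors_def)
  from Div0.repr_independence[OF this assms(2) subgroup_principal_divisors] show ?thesis
    by (simp add: div_class_def)
qed

lemma div_class_eqD:
  assumes "D \<in> carrier Div0_grp" "E \<in> carrier Div0_grp" "div_class D = div_class E"
  obtains f where "f \<noteq> 0" "D = principal_divisor f \<otimes>\<^bsub>Div_grp\<^esub> E"
proof -
  have "D \<in> principal_divisors #>\<^bsub>Div0_grp\<^esub> E"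
    using Div0.repr_independenceD[OF subgroup_principal_divisors assms(1)] assms(3) by (simp add: div_class_def)
  then show ?thesis using that by (auto simp: r_coset_def principal_divisors_def)
qed

section \<open>The distance\<close>

text \<open>\<open>LEAST\<close> on the reals is informative only if a minimum exists; having
  finitely many elements up to \<open>b\<close> provides one.\<close>

lemma least_attained:
  fixes V :: "real set"
  assumes "finite {r \<in> V. r \<le> b}" "b \<in> V"
  shows "(LEAST r. r \<in> V) \<le> b"
proof -
  let ?S = "{r \<in> V. r \<le> b}"
  have ne: "?S \<noteq> {}" using assms by auto
  have "(LEAST r. r \<in> V) = Min ?S"
  proof (rule Least_equality)
    show "Min ?S \<in> V" using Min_in[OF assms(1) ne] by simp
    fix r assume "r \<in> V"
    then show "Min ?S \<le> r"
      using Min_le[OF assms(1), of r] Min_le[OF assms(1), of b] assms(2) by (cases "r \<le> b") auto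
  qed
  also have "\<dots> \<le> b" using assms by (intro Min_le) auto
  finally show ?thesis .
qed

lemma finite_bounded_integers':
  fixes c :: "'a::number_field infinite_prime \<Rightarrow> real"
  shows "finite {x \<in> \<O>. \<forall>P\<in>infinite_primes. prime_abs P x \<le> c P}"
proof (rule finite_subset)
  let ?C = "\<Sum>P\<in>infinite_primes. \<bar>c P\<bar>"
  show "finite {x :: 'a. x \<in> \<O> \<and> (\<forall>P\<in>infinite_primes. prime_abs P x \<le> ?C)}" by (rule finite_bounded_integers)
  have "c P \<le> ?C" if "P \<in> infinite_primes" for P
    using member_le_sum[OF that, of "\<lambda>P. \<bar>c P\<bar>"] infinite_primes_index(1)[where 'a = 'a] by force
  then show "{x \<in> \<O>. \<forall>P\<in>infinite_primes. prime_abs P x \<le> c P} \<subseteq>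
      {x. x \<in> \<O> \<and> (\<forall>P\<in>infinite_primes. prime_abs P x \<le> ?C)}" by (auto intro: order.trans)
qed

text \<open>\<open>\<Sum> d x\<^sup>2\<close> is convex in \<open>x\<close>; with \<open>y = c - x \<ge> 0\<close> it equals \<open>\<Sum> d y\<^sup>2 - n c\<^sup>2\<close>, and \<open>\<Sum> d y\<^sup>2 \<le> (\<Sum> d y)\<^sup>2 = (n c)\<^sup>2\<close>.\<close>

lemma sqrt_weighted_sum_squares_le:
  fixes x :: "'i \<Rightarrow> real" and d :: "'i \<Rightarrow> nat" and c :: real
  assumes K: "finite K" and d: "\<And>i. i \<in> K \<Longrightarrow> d i \<ge> 1"
    and x: "\<And>i. i \<in> K \<Longrightarrow> x i \<le> c" "(\<Sum>i\<in>K. d i * x i) = 0"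
  shows "sqrt (\<Sum>i\<in>K. d i * (x i)\<^sup>2) \<le> (\<Sum>i\<in>K. d i) * c"
proof -
  define n where "n = real (\<Sum>i\<in>K. d i)"
  define y where "y i = c - x i" for i
  have y: "y i \<ge> 0" if "i \<in> K" for i using x(1)[OF that] by (simp add: y_def)
  have sy: "(\<Sum>i\<in>K. d i * y i) = n * c"
    using x(2) by (simp add: y_def n_def right_diff_distrib sum_subtractf sum_distrib_right)
  have nc: "n * c \<ge> 0" unfolding sy[symmetric] using y by (intro sum_nonneg) auto
  have "(\<Sum>i\<in>K. d i * (y i)\<^sup>2) \<le> (\<Sum>i\<in>K. (d i * y i) * (n * c))"
  proof (rule sum_mono)
    fix i assume i: "i \<in> K"
    have "real (d i) * y i \<le> n * c"
      unfolding sy[symmetric] using i y K by (intro member_le_sum) auto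
    moreover have "1 * y i \<le> real (d i) * y i" using d[OF i] y[OF i] by (intro mult_right_mono) auto
    ultimately have "y i \<le> n * c" by simp
    then have "(real (d i) * y i) * y i \<le> (real (d i) * y i) * (n * c)"
      using y[OF i] by (intro mult_left_mono) auto
    then show "real (d i) * (y i)\<^sup>2 \<le> (real (d i) * y i) * (n * c)" by (simp add: power2_eq_square mult.assoc)
  qed
  also have "\<dots> = (n * c)\<^sup>2" by (simp only: sum_distrib_right[symmetric] sy power2_eq_square)
  finally have yy: "(\<Sum>i\<in>K. d i * (y i)\<^sup>2) \<le> (n * c)\<^sup>2" .
  have "real (d i) * (x i)\<^sup>2 = d i * (y i)\<^sup>2 + 2 * c * (d i * x i) - c\<^sup>2 * d i" for i
    by (simp add: y_def power2_eq_square algebra_simps)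
  then have "(\<Sum>i\<in>K. d i * (x i)\<^sup>2) = (\<Sum>i\<in>K. d i * (y i)\<^sup>2 + 2 * c * (d i * x i) - c\<^sup>2 * d i)" by simp
  also have "\<dots> = (\<Sum>i\<in>K. d i * (y i)\<^sup>2) + 2 * c * (\<Sum>i\<in>K. d i * x i) - c\<^sup>2 * n"
    by (simp add: sum.distrib sum_subtractf sum_distrib_left n_def)
  also have "\<dots> = (\<Sum>i\<in>K. d i * (y i)\<^sup>2) - c\<^sup>2 * n" by (simp add: x(2))
  also have "\<dots> \<le> (n * c)\<^sup>2"
  proof -
    have "c\<^sup>2 * n \<ge> 0" unfolding n_def by (intro mult_nonneg_nonneg zero_le_power2 of_nat_0_le_iff)
    then show ?thesis using yy by linarith
  qed
  finally have "sqrt (\<Sum>i\<in>K. d i * (x i)\<^sup>2) \<le> sqrt ((n * c)\<^sup>2)" by (rule real_sqrt_le_mono)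
  then show ?thesis using nc by (simp add: n_def)
qed

text \<open>The chosen \<open>w\<close> differs from \<open>v\<close> by the absolute values of a
  unit \<open>g\<close>, because their classes agree. So the bound is the value taken at
  \<open>g\<close>, and the distance is below it once a minimum is known to exist.\<close>

lemma pic_dist_le:
  fixes D D' :: "'a::number_field divisor"
  assumes D: "D \<in> carrier Div0_grp" "D' \<in> carrier Div0_grp" and f: "f \<noteq> 0" and v: "v \<in> pos_vectors"
    and eq: "D \<otimes>\<^bsub>Div_grp\<^esub> inv\<^bsub>Div_grp\<^esub> D' = principal_divisor f \<otimes>\<^bsub>Div_grp\<^esub> (\<O>, v)"
  shows "(\<O>, v) \<in> carrier Div0_grp"
    and "pic_dist D D' \<le> sqrt (\<Sum>P\<in>infinite_primes. real (prime_deg P) * (ln (v P))\<^sup>2)"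
proof -
  have Ov: "(\<O>, v) \<in> carrier Div_grp" using v by (simp add: carrier_Div_grp)
  have "D \<otimes>\<^bsub>Div0_grp\<^esub> inv\<^bsub>Div0_grp\<^esub> D' \<in> carrier Div0_grp" using D by blast
  then have "principal_divisor f \<otimes>\<^bsub>Div_grp\<^esub> (\<O>, v) \<in> carrier Div0_grp" by (simp add: inv_Div0_grp D eq)
  then have "div_norm (\<O>, v) = 1"
    using principal_divisor_Div0[OF f] Ov by (simp add: carrier_Div0_grp div_norm_mult)
  then show v0: "(\<O>, v) \<in> carrier Div0_grp" using Ov by (simp add: carrier_Div0_grp)
  have cls: "div_class D \<otimes>\<^bsub>Pic0_grp\<^esub> inv\<^bsub>Pic0_grp\<^esub> div_class D' = div_class (\<O>, v)"
    by (simp add: div_class_diff D eq div_class_principal_mult f v0)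
  define w where "w = (SOME w. w \<in> pos_vectors \<and> (\<O>, w) \<in> carrier Div0_grp \<and>
                 div_class D \<otimes>\<^bsub>Pic0_grp\<^esub> inv\<^bsub>Pic0_grp\<^esub> div_class D' = div_class (\<O>, w))"
  have w: "w \<in> pos_vectors \<and> (\<O>, w) \<in> carrier Div0_grp \<and>
                 div_class D \<otimes>\<^bsub>Pic0_grp\<^esub> inv\<^bsub>Pic0_grp\<^esub> div_class D' = div_class (\<O>, w)"
    unfolding w_def by (rule someI[of _ v]) (use v v0 cls in auto)
  then have "div_class (\<O>, v) = div_class (\<O>, w)" using cls by simp
  then obtain g where g: "g \<noteq> 0" "(\<O>, v) = principal_divisor g \<otimes>\<^bsub>Div_grp\<^esub> (\<O>, w)"
    using div_class_eqD v0 w by metis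
  \<comment> \<open>Comparing the ideals shows that \<open>g\<close> is a unit; comparing the
    vectors shows that it carries \<open>w\<close> to \<open>v\<close>.\<close>
  have gO: "\<O> = scale (inverse g) \<O>" and vw: "v = restrict (\<lambda>P. restrict (\<lambda>P. prime_abs P g) infinite_primes P * w P) infinite_primes"
    using g(2) by (simp_all add: mult_Div_grp principal_divisor_altdef ideal_mult_principal)
  have vw': "v P = prime_abs P g * w P" if "P \<in> infinite_primes" for P using that by (simp add: vw)
  have "inverse g * 1 \<in> \<O>" using gO integers_closed(2) by blast
  moreover obtain h where "h \<in> \<O>" "1 = inverse g * h" using gO integers_closed(2) by blast
  ultimately have unit: "g \<in> unit_group"
    using g(1) unfolding unit_group_def by (auto simp: field_simps intro: bexI[of _ "inverse g"])
  define val where "val \<epsilon> = sqrt (\<Sum>P\<in>infinite_primes. real (prime_deg P) * (ln (prime_abs P \<epsilon> * w P))\<^sup>2)" for \<epsilon>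
  define V where "V = val ` unit_group"
  have vg: "val g = sqrt (\<Sum>P\<in>infinite_primes. real (prime_deg P) * (ln (v P))\<^sup>2)"
    by (simp add: val_def vw')
  \<comment> \<open>A bound on the value bounds each logarithm from above, and only finitely many
    integers satisfy the resulting bounds at all primes.\<close>
  have "{r \<in> V. r \<le> val g} \<subseteq> val ` {x \<in> \<O>. \<forall>P\<in>infinite_primes. prime_abs P x \<le> exp (val g) / w P}"
  proof
    fix r assume "r \<in> {r \<in> V. r \<le> val g}"
    then obtain \<epsilon> where e: "\<epsilon> \<in> unit_group" "r = val \<epsilon>" "val \<epsilon> \<le> val g" by (auto simp: V_def)
    have e0: "\<epsilon> \<noteq> 0" "\<epsilon> \<in> \<O>" using e(1) by (auto simp: unit_group_def)
    have "prime_abs P \<epsilon> \<le> exp (val g) / w P" if P: "P \<in> infinite_primes" for P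
    proof -
      have wP: "w P > 0" using w P by (auto simp: pos_vectorsD)
      let ?l = "ln (prime_abs P \<epsilon> * w P)"
      have "?l\<^sup>2 \<le> real (prime_deg P) * ?l\<^sup>2"
        using prime_deg_cases[of P] by auto
      also have "\<dots> \<le> (\<Sum>P\<in>infinite_primes. real (prime_deg P) * (ln (prime_abs P \<epsilon> * w P))\<^sup>2)"
        using P infinite_primes_index(1)[where 'a = 'a]
        by (intro member_le_sum[where f = "\<lambda>P. real (prime_deg P) * (ln (prime_abs P \<epsilon> * w P))\<^sup>2"]) auto
      finally have "sqrt (?l\<^sup>2) \<le> val \<epsilon>" unfolding val_def by (rule real_sqrt_le_mono)
      then have "?l \<le> val g" using e(3) by simp
      moreover have "prime_abs P \<epsilon> * w P > 0" using e0 wP P by (simp add: prime_abs_simps)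
      ultimately have "prime_abs P \<epsilon> * w P \<le> exp (val g)" by (metis exp_le_cancel_iff exp_ln)
      then show ?thesis using wP by (simp add: le_divide_eq)
    qed
    then show "r \<in> val ` {x \<in> \<O>. \<forall>P\<in>infinite_primes. prime_abs P x \<le> exp (val g) / w P}"
      using e e0 by blast
  qed
  then have "finite {r \<in> V. r \<le> val g}" by (rule finite_subset) (intro finite_imageI finite_bounded_integers')
  then have "(LEAST r. r \<in> V) \<le> val g" using unit by (intro least_attained) (auto simp: V_def)
  moreover have "pic_dist D D' = (LEAST r. r \<in> V)"
    unfolding pic_dist_def Let_def w_def[symmetric] V_def val_def by (simp add: image_iff)
  ultimately show "pic_dist D D' \<le> sqrt (\<Sum>P\<in>infinite_primes. real (prime_deg P) * (ln (v P))\<^sup>2)"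
    by (simp add: vg)
qed

section \<open>Reduction\<close>

text \<open>Minkowski's theorem gives elements with \<open>u\<^sub>P \<bar>f\<bar>\<^sub>P < (1 + \<epsilon>) \<partial>\<^bsup>1/n\<^esup>\<close> for every \<open>\<epsilon> > 0\<close>; by
  discreteness \<open>\<epsilon> = 0\<close> is attained too, and among the finitely many such elements one is minimal.\<close>

lemma exists_small_minimal_element:
  fixes I :: "'a::number_field set"
  assumes D: "(I, u) \<in> carrier Div0_grp"
  defines "t \<equiv> del_const TYPE('a) powr (1 / real (field_degree TYPE('a)))"
  obtains f where "minimal_in I f" "\<And>P. P \<in> infinite_primes \<Longrightarrow> u P * prime_abs P f \<le> t"
proof -
  let ?K = "infinite_primes :: 'a infinite_prime set" and ?n = "field_degree TYPE('a)"
  have I: "frac_ideal I" and u: "u \<in> pos_vectors" and nrm: "ideal_norm I * (\<Prod>P\<in>?K. u P ^ prime_deg P) = 1"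
    using D by (auto simp: carrier_Div0_grp carrier_Div_grp div_norm_def)
  have uP: "u P > 0" if "P \<in> ?K" for P using u that by (rule pos_vectorsD)
  have t: "t > 0" using del_const_pos[where 'a = 'a] by (simp add: t_def)
  have tn: "t ^ ?n = del_const TYPE('a)"
    using field_degree_pos[where 'a = 'a] del_const_pos[where 'a = 'a]
    by (simp add: t_def powr_realpow[symmetric] powr_powr)
  define S where "S c = {g \<in> I. g \<noteq> 0 \<and> (\<forall>P\<in>?K. u P * prime_abs P g \<le> c)}" for c
  have ex: "\<exists>g\<in>I. g \<noteq> 0 \<and> (\<forall>P\<in>?K. u P * prime_abs P g < t * (1 + \<epsilon>))" if "\<epsilon> > 0" for \<epsilon> :: real
  proof -
    have "(\<Prod>P\<in>?K. (t * (1 + \<epsilon>) / u P) ^ prime_deg P) * (\<Prod>P\<in>?K. u P ^ prime_deg P) = (\<Prod>P\<in>?K. (t * (1 + \<epsilon>)) ^ prime_deg P)"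
      unfolding prod.distrib[symmetric]
      by (intro prod.cong refl) (use uP in \<open>force simp: power_mult_distrib[symmetric]\<close>)
    also have "\<dots> = del_const TYPE('a) * (1 + \<epsilon>) ^ ?n"
      by (subst prod_const_prime_deg) (simp only: power_mult_distrib tn)
    also have "\<dots> > del_const TYPE('a) * 1"
      using that del_const_pos[where 'a = 'a] field_degree_pos[where 'a = 'a] by (intro mult_strict_left_mono) auto
    finally have "del_const TYPE('a) * (ideal_norm I * (\<Prod>P\<in>?K. u P ^ prime_deg P)) <
        (\<Prod>P\<in>?K. (t * (1 + \<epsilon>) / u P) ^ prime_deg P) * (\<Prod>P\<in>?K. u P ^ prime_deg P)"
      by (simp add: nrm)
    moreover have "(\<Prod>P\<in>?K. u P ^ prime_deg P) > 0" using uP by (intro prod_pos) auto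
    ultimately have "(\<Prod>P\<in>?K. (t * (1 + \<epsilon>) / u P) ^ prime_deg P) > del_const TYPE('a) * ideal_norm I"
      by (simp add: mult.assoc[symmetric])
    moreover have "t * (1 + \<epsilon>) / u P > 0" if "P \<in> ?K" for P
      using uP[OF that] t \<open>\<epsilon> > 0\<close> by (intro divide_pos_pos mult_pos_pos) simp_all
    ultimately obtain g where g: "g \<in> I" "g \<noteq> 0" "\<And>P. P \<in> ?K \<Longrightarrow> prime_abs P g < t * (1 + \<epsilon>) / u P"
      using minkowski_ideal[OF I, of "\<lambda>P. t * (1 + \<epsilon>) / u P"] by metis
    then have "u P * prime_abs P g < t * (1 + \<epsilon>)" if "P \<in> ?K" for P
      using g(3)[OF that] uP[OF that] by (simp add: less_divide_eq mult.commute)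
    then show ?thesis using g by blast
  qed
  have finS: "finite (S c)" for c
  proof -
    obtain d where d: "d \<in> \<O>" "d \<noteq> 0" "scale d I \<subseteq> \<O>" using frac_denominator[OF I] .
    have "scale d (S c) \<subseteq> {x \<in> \<O>. \<forall>P\<in>?K. prime_abs P x \<le> prime_abs P d * (c / u P)}"
    proof
      fix x assume "x \<in> scale d (S c)"
      then obtain g where g: "g \<in> S c" "x = d * g" by (rule imageE)
      have "prime_abs P g \<le> c / u P" if "P \<in> ?K" for P
        using g(1) that uP[OF that] by (simp add: S_def le_divide_eq mult.commute)
      then have "prime_abs P x \<le> prime_abs P d * (c / u P)" if "P \<in> ?K" for P
        unfolding g(2) prime_abs_simps(1)[OF that] using that by (intro mult_left_mono prime_abs_simps(6)) simp_all
      moreover have "x \<in> \<O>" using g d(3) by (simp add: S_def image_subset_iff)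
      ultimately show "x \<in> {x \<in> \<O>. \<forall>P\<in>?K. prime_abs P x \<le> prime_abs P d * (c / u P)}" by simp
    qed
    then have "finite (scale d (S c))" by (rule finite_subset) (rule finite_bounded_integers')
    moreover have "inj_on ((*) d) (S c)" using d(2) by (simp add: inj_on_def)
    ultimately show ?thesis by (rule finite_imageD)
  qed
  define \<mu> where "\<mu> g = Max ((\<lambda>P. u P * prime_abs P g) ` ?K)" for g
  have \<mu>_less: "\<mu> g < c \<longleftrightarrow> (\<forall>P\<in>?K. u P * prime_abs P g < c)" for g c
    unfolding \<mu>_def using infinite_primes_index(1) infinite_primes_nonempty by (subst Max_less_iff) auto
  have \<mu>_le: "\<mu> g \<le> c \<longleftrightarrow> (\<forall>P\<in>?K. u P * prime_abs P g \<le> c)" for g c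
    unfolding \<mu>_def using infinite_primes_index(1) infinite_primes_nonempty by (subst Max_le_iff) auto
  \<comment> \<open>The radius \<open>2 * t\<close> is the case \<open>\<epsilon> = 1\<close>. It
    makes the finite set nonempty, so that a nonzero element with least weighted maximum
    \<open>\<mu>\<close> can be taken from it.\<close>
  have "S (2 * t) \<noteq> {}" using ex[of 1] by (force simp: S_def less_imp_le)
  then obtain g where g: "g \<in> S (2 * t)" "\<And>h. h \<in> S (2 * t) \<Longrightarrow> \<mu> g \<le> \<mu> h"
    using arg_min_if_finite(1)[OF finS, of "2 * t" \<mu>] arg_min_least[OF finS, of "2 * t" _ \<mu>] by blast
  have "\<mu> g \<le> t"
  proof (rule ccontr)
    assume "\<not> \<mu> g \<le> t"
    \<comment> \<open>Chosen so that \<open>t * (1 + \<epsilon>)\<close> exceeds neither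
      \<open>2 * t\<close> nor \<open>\<mu> g\<close>: the element it provides lies in
      \<open>S (2 * t)\<close> and beats \<open>g\<close>.\<close>
    define \<epsilon> where "\<epsilon> = min 1 (\<mu> g / t - 1)"
    have e: "\<epsilon> > 0" "\<epsilon> \<le> 1" "\<epsilon> \<le> \<mu> g / t - 1" using \<open>\<not> \<mu> g \<le> t\<close> t by (auto simp: \<epsilon>_def)
    obtain h where h: "h \<in> I" "h \<noteq> 0" "\<forall>P\<in>?K. u P * prime_abs P h < t * (1 + \<epsilon>)" using ex[OF e(1)] by blast
    have "t * (1 + \<epsilon>) \<le> t * 2" using e t by (intro mult_left_mono) auto
    then have "h \<in> S (2 * t)" using h by (force simp: S_def)
    then have "\<mu> g \<le> \<mu> h" by (rule g(2))
    also have "\<mu> h < t * (1 + \<epsilon>)" using h(3) by (simp add: \<mu>_less)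
    also have "\<dots> \<le> t * (\<mu> g / t)" using e t by (intro mult_left_mono) auto
    also have "\<dots> = \<mu> g" using t by simp
    finally show False by simp
  qed
  then have "g \<in> S t" using g(1) by (auto simp: S_def \<mu>_le)
  \<comment> \<open>A nonzero element of \<open>I\<close> smaller than \<open>f\<close> at every
    prime would stay in \<open>S t\<close> and have a smaller sum, so least sum implies minimality
    in \<open>I\<close>.\<close>
  define \<Sigma> where "\<Sigma> g = (\<Sum>P\<in>?K. prime_abs P g)" for g
  obtain f where f: "f \<in> S t" "\<And>h. h \<in> S t \<Longrightarrow> \<Sigma> f \<le> \<Sigma> h"
    using arg_min_if_finite(1)[OF finS, of t \<Sigma>] arg_min_least[OF finS, of t _ \<Sigma>] \<open>g \<in> S t\<close> by blast
  have "minimal_in I f"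
    unfolding minimal_in_def
  proof (intro conjI ballI impI)
    show "f \<in> I" "f \<noteq> 0" using f(1) by (auto simp: S_def)
    fix h assume h: "h \<in> I" "\<forall>P\<in>?K. prime_abs P h < prime_abs P f"
    show "h = 0"
    proof (rule ccontr)
      assume "h \<noteq> 0"
      have "u P * prime_abs P h \<le> t" if P: "P \<in> ?K" for P
      proof -
        have "u P * prime_abs P h \<le> u P * prime_abs P f" using h(2) P uP[OF P] by (intro mult_left_mono) (auto simp: less_imp_le)
        also have "\<dots> \<le> t" using f(1) P by (auto simp: S_def)
        finally show ?thesis .
      qed
      then have "h \<in> S t" using h(1) \<open>h \<noteq> 0\<close> by (auto simp: S_def)
      then have "\<Sigma> f \<le> \<Sigma> h" by (rule f(2))
      moreover have "\<Sigma> h < \<Sigma> f"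
        unfolding \<Sigma>_def using h(2) infinite_primes_index(1) infinite_primes_nonempty by (intro sum_strict_mono) auto
      ultimately show False by simp
    qed
  qed
  then show ?thesis using f(1) by (intro that[of f]) (auto simp: S_def)
qed

text \<open>The degrees of the primes add up to the degree of the field, so the equal coordinates
  multiply to the inverse of the norm.\<close>

lemma ideal_divisor_Div0:
  fixes J :: "'a::number_field set"
  assumes J: "frac_ideal J"
  shows "ideal_divisor J \<in> carrier Div0_grp"
proof -
  let ?n = "field_degree TYPE('a)"
  have "ideal_divisor J \<in> carrier Div_grp"
    using J ideal_norm_pos[OF J] by (auto simp: ideal_divisor_def carrier_Div_grp intro!: restrict_pos_vectors)
  moreover have "div_norm (ideal_divisor J) = ideal_norm J * (ideal_norm J powr (- 1 / real ?n)) ^ ?n"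
    by (simp add: div_norm_def ideal_divisor_def prod_const_prime_deg)
  moreover have "(ideal_norm J powr (- 1 / real ?n)) ^ ?n = inverse (ideal_norm J)"
  proof -
    have "(ideal_norm J powr (- 1 / real ?n)) ^ ?n = ideal_norm J powr (real ?n * (- 1 / real ?n))"
      using ideal_norm_pos[OF J] by (intro powr_power) simp
    also have "real ?n * (- 1 / real ?n) = - 1" using field_degree_pos[where 'a = 'a] by simp
    also have "ideal_norm J powr - 1 = inverse (ideal_norm J)" using ideal_norm_pos[OF J] by (simp add: powr_minus)
    finally show ?thesis .
  qed
  ultimately show ?thesis using ideal_norm_pos[OF J] by (simp add: carrier_Div0_grp)
qed

text \<open>Shared by both parts of the theorem. The bound is stated for
  \<open>u P * prime_abs P f\<close>, before any normalisation by the norm of \<open>J\<close>,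
  which only the first part performs.\<close>

lemma reduction:
  fixes I :: "'a::number_field set"
  assumes D: "(I, u) \<in> carrier Div0_grp"
  obtains f J where "f \<noteq> 0" "frac_ideal J" "minimal_in J 1" "J = scale (inverse f) I" "ideal_norm J \<le> 1"
    "\<And>P. P \<in> infinite_primes \<Longrightarrow> u P * prime_abs P f \<le> del_const TYPE('a) powr (1 / real (field_degree TYPE('a)))"
proof -
  obtain f where f: "minimal_in I f"
    "\<And>P. P \<in> infinite_primes \<Longrightarrow> u P * prime_abs P f \<le> del_const TYPE('a) powr (1 / real (field_degree TYPE('a)))"
    using exists_small_minimal_element[OF D] by metis
  have fI: "f \<in> I" "f \<noteq> 0" using f(1) by (auto simp: minimal_in_def)
  have I: "frac_ideal I" using D by (auto simp: carrier_Div0_grp carrier_Div_grp)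
  define J where "J = scale (inverse f) I"
  have J: "frac_ideal J" unfolding J_def using I fI by (intro frac_scale) auto
  have 1: "1 \<in> J" unfolding J_def using fI by (auto intro: image_eqI[of _ _ f])
  have "minimal_in J 1"
    unfolding minimal_in_def
  proof (intro conjI ballI impI 1)
    fix g assume g: "g \<in> J" "\<forall>P\<in>infinite_primes. prime_abs P g < prime_abs P 1"
    then have fg: "f * g \<in> I" using fI(2) by (auto simp: J_def mult.assoc[symmetric])
    have "prime_abs P (f * g) < prime_abs P f" if P: "P \<in> infinite_primes" for P
    proof -
      have "prime_abs P f * prime_abs P g < prime_abs P f * 1"
        using g(2) P fI(2) by (intro mult_strict_left_mono) (auto simp: prime_abs_simps)
      then show ?thesis using P by (simp add: prime_abs_simps)
    qed
    then have "f * g = 0" using f(1) fg by (auto simp: minimal_in_def)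
    then show "g = 0" using fI by simp
  qed simp
  moreover have "ideal_norm J \<le> 1"
  proof -
    have "\<O> \<subseteq> J" using omoduleD(3)[OF frac_omodule[OF J] _ 1] by auto
    then have NJ: "ideal_norm J * index J \<O> = 1" by (rule ideal_norm_mult_index[OF J])
    then have "index J \<O> > 0" by (metis gr0I mult_zero_right of_nat_0 zero_neq_one)
    then have "ideal_norm J * 1 \<le> ideal_norm J * index J \<O>"
      using ideal_norm_pos[OF J] by (intro mult_left_mono) auto
    then show ?thesis using NJ by simp
  qed
  ultimately show ?thesis using fI(2) J f(2) by (intro that[of f J]) (auto simp: J_def)
qed

lemma reduced_approximation:
  fixes D :: "'a::number_field divisor"
  assumes D: "D \<in> carrier Div0_grp"
  shows "\<exists>D' f v. reduced_divisor D' \<and> f \<noteq> 0 \<and> v \<in> pos_vectors \<and>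
    D \<otimes>\<^bsub>Div_grp\<^esub> inv\<^bsub>Div_grp\<^esub> D' = principal_divisor f \<otimes>\<^bsub>Div_grp\<^esub> (\<O>, v) \<and>
    (\<forall>P\<in>infinite_primes. ln \<bar>v P\<bar> \<le> 1 / real (field_degree TYPE('a)) * ln (del_const TYPE('a))) \<and>
    pic_dist D D' \<le> ln (del_const TYPE('a))"
proof -
  let ?n = "field_degree TYPE('a)" and ?d = "del_const TYPE('a)"
  obtain I u where Iu: "D = (I, u)" by (cases D)
  have I: "frac_ideal I" and u: "u \<in> pos_vectors" using D by (auto simp: Iu carrier_Div0_grp carrier_Div_grp)
  obtain f J where f: "f \<noteq> 0" "frac_ideal J" "minimal_in J 1" "J = scale (inverse f) I" "ideal_norm J \<le> 1"
    "\<And>P. P \<in> infinite_primes \<Longrightarrow> u P * prime_abs P f \<le> ?d powr (1 / real ?n)"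
    using reduction[OF D[unfolded Iu]] by metis
  \<comment> \<open>Compensates the coordinates of \<open>ideal_divisor J\<close>, which are
    \<open>inverse s\<close>. As \<open>s \<le> 1\<close>, the vector \<open>v\<close> inherits the
    bound on \<open>u P * prime_abs P f\<close>.\<close>
  define s where "s = ideal_norm J powr (1 / real ?n)"
  have s: "s > 0" "s \<le> 1"
    using ideal_norm_pos[OF f(2)] f(5) powr_mono2[of "1 / real ?n" "ideal_norm J" 1] by (auto simp: s_def)
  have s': "ideal_norm J powr - (1 / real ?n) = inverse s"
    unfolding s_def by (rule powr_minus)
  define v where "v = restrict (\<lambda>P. u P * prime_abs P f * s) infinite_primes"
  define D' where "D' = ideal_divisor J"
  have D': "D' \<in> carrier Div0_grp" unfolding D'_def by (rule ideal_divisor_Div0[OF f(2)])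
  have red: "reduced_divisor D'"
    unfolding reduced_divisor_def D'_def using f(2,3) by (auto simp: frac_ideal_def)
  have uf: "u P * prime_abs P f > 0" if "P \<in> infinite_primes" for P
    using f(1) that pos_vectorsD[OF u that] by (simp add: prime_abs_simps)
  have v: "v \<in> pos_vectors" unfolding v_def using uf s by (intro restrict_pos_vectors) simp
  have carr: "D \<in> carrier Div_grp" "D' \<in> carrier Div_grp" "principal_divisor (inverse f) \<in> carrier Div_grp"
    "(\<O>, v) \<in> carrier Div_grp"
    using D D' principal_divisor_Div0[of "inverse f"] f(1) v by (auto simp: carrier_Div0_grp carrier_Div_grp)
  \<comment> \<open>The principal divisor of \<open>inverse f\<close> has ideal
    \<open>f \<O>\<close>, which carries \<open>J\<close> back to \<open>I\<close>, and its absolute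
    values cancel the factor \<open>prime_abs P f\<close> in \<open>v\<close>.\<close>
  have "principal_divisor (inverse f) \<otimes>\<^bsub>Div_grp\<^esub> (\<O>, v) \<otimes>\<^bsub>Div_grp\<^esub> D' = D"
  proof (rule prod_eqI)
    have "ideal_mult (ideal_mult (scale f \<O>) \<O>) J = scale f J"
      by (simp add: ideal_mult_principal ideal_mult_scale omodule_scale ideal_mult_integers frac_omodule f(2))
    also have "\<dots> = I" unfolding f(4) by (rule scale_inverse(1)[OF f(1)])
    finally show "fst (principal_divisor (inverse f) \<otimes>\<^bsub>Div_grp\<^esub> (\<O>, v) \<otimes>\<^bsub>Div_grp\<^esub> D') = fst D"
      by (simp add: mult_Div_grp principal_divisor_altdef D'_def ideal_divisor_def Iu)
    show "snd (principal_divisor (inverse f) \<otimes>\<^bsub>Div_grp\<^esub> (\<O>, v) \<otimes>\<^bsub>Div_grp\<^esub> D') = snd D"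
    proof (rule pos_vectors_ext)
      have "principal_divisor (inverse f) \<otimes>\<^bsub>Div_grp\<^esub> (\<O>, v) \<otimes>\<^bsub>Div_grp\<^esub> D' \<in> carrier Div_grp"
        using carr by blast
      then show "snd (principal_divisor (inverse f) \<otimes>\<^bsub>Div_grp\<^esub> (\<O>, v) \<otimes>\<^bsub>Div_grp\<^esub> D') \<in> pos_vectors"
        by (simp add: carrier_Div_grp)
      show "snd D \<in> pos_vectors" using u by (simp add: Iu)
      fix P :: "'a infinite_prime" assume P: "P \<in> infinite_primes"
      have "prime_abs P f \<noteq> 0" using P f(1) by (simp add: prime_abs_simps)
      then show "snd (principal_divisor (inverse f) \<otimes>\<^bsub>Div_grp\<^esub> (\<O>, v) \<otimes>\<^bsub>Div_grp\<^esub> D') P = snd D P"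
        using P less_imp_neq[OF s(1)] by (simp add: mult_Div_grp principal_divisor_altdef D'_def ideal_divisor_def Iu v_def s' prime_abs_simps)
    qed
  qed
  then have eq: "D \<otimes>\<^bsub>Div_grp\<^esub> inv\<^bsub>Div_grp\<^esub> D' = principal_divisor (inverse f) \<otimes>\<^bsub>Div_grp\<^esub> (\<O>, v)"
    using carr Div.inv_solve_right[of "principal_divisor (inverse f) \<otimes>\<^bsub>Div_grp\<^esub> (\<O>, v)" D D'] by simp
  define c where "c = 1 / real ?n * ln ?d"
  have bound: "ln (v P) \<le> c" if P: "P \<in> infinite_primes" for P
  proof -
    have "v P \<le> u P * prime_abs P f * 1"
      unfolding v_def using P s uf[OF P] by (simp add: mult_left_le)
    also have "\<dots> \<le> ?d powr (1 / real ?n)" using f(6)[OF P] by simp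
    finally have "ln (v P) \<le> ln (?d powr (1 / real ?n))" using pos_vectorsD[OF v P] by (intro ln_mono)
    then show ?thesis using del_const_pos[where 'a = 'a] by (simp add: ln_powr c_def)
  qed
  have f': "inverse f \<noteq> 0" using f(1) by simp
  note dist = pic_dist_le[OF D D' f' v eq]
  \<comment> \<open>Degree 0 passes to \<open>(\<O>, v)\<close> from \<open>D\<close>,
    \<open>D'\<close> and the principal divisor; in logarithms it is the vanishing weighted sum
    required below.\<close>
  have "(\<Prod>P\<in>infinite_primes. v P ^ prime_deg P) = 1"
    using dist(1) by (simp add: carrier_Div0_grp div_norm_def ideal_norm_integers)
  moreover have "ln (\<Prod>P\<in>infinite_primes. v P ^ prime_deg P) = (\<Sum>P\<in>infinite_primes. ln (v P ^ prime_deg P))"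
    using pos_vectorsD[OF v] by (intro ln_prod infinite_primes_index(1)) (simp add: less_imp_neq[symmetric])
  moreover have "ln (v P ^ prime_deg P) = real (prime_deg P) * ln (v P)" if "P \<in> infinite_primes" for P
    using pos_vectorsD[OF v that] by (simp add: ln_realpow)
  ultimately have "(\<Sum>P\<in>infinite_primes. real (prime_deg P) * ln (v P)) = 0" by simp
  then have "sqrt (\<Sum>P\<in>infinite_primes. real (prime_deg P) * (ln (v P))\<^sup>2) \<le>
      real (\<Sum>P\<in>(infinite_primes :: 'a infinite_prime set). prime_deg P) * c"
  proof (intro sqrt_weighted_sum_squares_le bound)
    show "prime_deg P \<ge> 1" for P :: "'a infinite_prime" using prime_deg_cases[of P] by auto
  qed (simp_all add: infinite_primes_index(1))
  also have "\<dots> = ln ?d"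
    using field_degree_pos[where 'a = 'a] by (simp add: sum_prime_deg c_def)
  finally have "pic_dist D D' \<le> ln ?d" using dist(2) by simp
  moreover have "ln \<bar>v P\<bar> \<le> 1 / real ?n * ln ?d" if "P \<in> infinite_primes" for P
    using bound[OF that] pos_vectorsD[OF v that] by (simp add: c_def)
  ultimately show ?thesis using red f' v eq by blast
qed

text \<open>Multiplying \<open>D\<close> by the principal divisor of \<open>f\<close> keeps its
  class and gives the ideal \<open>J\<close> with coordinates \<open>u P * prime_abs P f\<close>,
  which is a member of the set for \<open>ideal_divisor J\<close> by the bound on
  \<open>f\<close>.\<close>

lemma Sigma_set_surjective:
  "div_class ` (\<Union>D \<in> {D :: 'a::number_field divisor. reduced_divisor D}. Sigma_set D) = carrier Pic0_grp"
proof (intro equalityI subsetI)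
  fix X :: "'a divisor set" assume "X \<in> carrier Pic0_grp"
  then obtain D where D: "D \<in> carrier Div0_grp" "X = div_class D" by (auto simp: carrier_Pic0_grp)
  obtain I u where Iu: "D = (I, u)" by (cases D)
  have I: "frac_ideal I" and u: "u \<in> pos_vectors" using D by (auto simp: Iu carrier_Div0_grp carrier_Div_grp)
  obtain f J where f: "f \<noteq> 0" "frac_ideal J" "minimal_in J 1" "J = scale (inverse f) I"
    "\<And>P. P \<in> infinite_primes \<Longrightarrow> u P * prime_abs P f \<le> del_const TYPE('a) powr (1 / real (field_degree TYPE('a)))"
    using reduction[OF D(1)[unfolded Iu]] by metis
  define E where "E = principal_divisor f \<otimes>\<^bsub>Div_grp\<^esub> D"
  have E: "E \<in> carrier Div0_grp"
    unfolding E_def using subgroup.m_closed[OF subgroup_Div0] principal_divisor_Div0[OF f(1)] D(1) by blast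
  have E': "fst E = J" "\<And>P. P \<in> infinite_primes \<Longrightarrow> snd E P = prime_abs P f * u P"
    by (simp_all add: E_def mult_Div_grp principal_divisor_altdef Iu f(4) ideal_mult_principal frac_omodule I)
  have "ln (snd E P) \<le> 1 / real (field_degree TYPE('a)) * ln (del_const TYPE('a))" if P: "P \<in> infinite_primes" for P
  proof -
    have "snd E P > 0" using E P by (auto simp: carrier_Div0_grp carrier_Div_grp pos_vectorsD)
    moreover have "snd E P \<le> del_const TYPE('a) powr (1 / real (field_degree TYPE('a)))"
      using f(5)[OF P] by (simp add: E' P mult.commute)
    ultimately have "ln (snd E P) \<le> ln (del_const TYPE('a) powr (1 / real (field_degree TYPE('a))))" by (intro ln_mono)
    then show ?thesis using del_const_pos[where 'a = 'a] by (simp add: ln_powr)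
  qed
  then have "E \<in> Sigma_set (ideal_divisor J)" using E E'(1) by (simp add: Sigma_set_def ideal_divisor_def)
  moreover have "reduced_divisor (ideal_divisor J)"
    unfolding reduced_divisor_def using f(2,3) by (auto simp: frac_ideal_def)
  moreover have "X = div_class E" unfolding E_def D(2) using div_class_principal_mult[OF f(1) D(1)] by simp
  ultimately show "X \<in> div_class ` (\<Union>D \<in> {D :: 'a divisor. reduced_divisor D}. Sigma_set D)" by blast
next
  fix X assume "X \<in> div_class ` (\<Union>D \<in> {D :: 'a divisor. reduced_divisor D}. Sigma_set D)"
  then show "X \<in> carrier Pic0_grp" by (auto simp: carrier_Pic0_grp Sigma_set_def)
qed

theorem theorem7p4:
  shows "(\<forall>D \<in> carrier (Div0_grp :: 'a::number_field divisor monoid).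
            \<exists>D' f v. reduced_divisor D' \<and> f \<noteq> 0 \<and> v \<in> pos_vectors \<and>
              D \<otimes>\<^bsub>Div_grp\<^esub> inv\<^bsub>Div_grp\<^esub> D' =
                principal_divisor f \<otimes>\<^bsub>Div_grp\<^esub> (ring_of_integers, v) \<and>
              (\<forall>P\<in>infinite_primes.
                 ln \<bar>v P\<bar> \<le> 1 / real (field_degree TYPE('a)) * ln (del_const TYPE('a))) \<and>
              pic_dist D D' \<le> ln (del_const TYPE('a)))
         \<and> div_class ` (\<Union>D \<in> {D :: 'a divisor. reduced_divisor D}. Sigma_set D)
             = carrier Pic0_grp"
  by (intro conjI ballI reduced_approximation Sigma_set_surjective)

end
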